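(* Let $H$ be a finite-dimensional factorisable ribbon quasi-Hopf algebra over an algebraically closed field $k$, with $R$-matrix $R$, ribbon element $\boldsymbol v$, evaluation element $\alpha$ and centre $Z=Z(H)$. Let $\boldsymbol\lambda\in H^*$ be the (non-zero) right monadic cointegral for $H$-mod, used as the integral $\Lambda_{\mathcal L}=\boldsymbol\lambda:\mathbf 1\to\mathcal L$ of the coend $\mathcal L=H^*$ in the definition of $\mathscr S$. Then the $\mathbf S$- and $\mathbf T$-transformations on $\alpha Z=\{\alpha z\mid z\in Z\}$ are the linear maps $$\mathscr S_{\alpha Z}(\alpha z)=\langle\boldsymbol\lambda\mid\widehat\omega_1z\rangle\,\widehat\omega_2,\qquad\mathscr T_{\alpha Z}(\alpha z)=\boldsymbol v^{-1}\alpha z\qquad(z\in Z).$$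
   Context: **Quasi-Hopf conventions.** $H$ has coproduct $\Delta$, counit $\varepsilon$, bijective antipode $S$, coassociator $\Phi$, coevaluation element $\beta$, $\varepsilon(\alpha)=\varepsilon(\beta)=1$, with $(\Delta\otimes\mathrm{id})(\Delta(h))\Phi=\Phi(\mathrm{id}\otimes\Delta)(\Delta(h))$, $S(h_{(1)})\alpha h_{(2)}=\varepsilon(h)\alpha$, $h_{(1)}\beta S(h_{(2)})=\varepsilon(h)\beta$. In $\mathcal C=H$-mod (finite-dimensional left modules) the associator $U\otimes(V\otimes W)\to(U\otimes V)\otimes W$ is the action of $\Phi$, the left dual $X^\vee$ is $X^*$ with $(h.f)(x)=f(S(h)x)$, $\mathrm{ev}^l_X(f\otimes x)=f(\alpha x)$, $\mathrm{coev}^l_X(1)=\sum\beta x_i\otimes x^i$; the braiding is $c_{X,Y}(x\otimes y)=R_2y\otimes R_1x$, and the ribbon twist $\vartheta_X$ is the action of $\boldsymbol v^{-1}$. Coherence isomorphisms are suppressed below. $\gamma_{V,W}:V^\vee\otimes W^\vee\to(W\otimes V)^\vee$ is the canonical isomorphism. **Coend.** $\mathcal L=\int^XX^\vee\otimes X$ is realised as $H^*$ with coadjoint action $h.f=\langle f\mid S(h_{(1)})\,?\,h_{(2)}\rangle$ and dinatural transformation $j_X(f\otimes x)=\langle f\mid(?)\,x\rangle$, i.e. $h\mapsto f(hx)$. It is a Hopf algebra in $\mathcal C$ with counit $\varepsilon_{\mathcal L}\circ j_X=\mathrm{ev}^l_X$ and multiplication $m\circ(j_X\otimes j_Y)=j_{Y\otimes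 X}\circ(\gamma_{X,Y}\otimes\mathrm{id})\circ(\mathrm{id}\otimes c_{X,Y^\vee\otimes Y})$. Define $\mathcal Q:\mathcal L\otimes\mathcal L\to\mathcal L\otimes\mathcal L$ by $\mathcal Q\circ(j_X\otimes j_Y)=(j_X\otimes j_Y)\circ(\mathrm{id}_{X^\vee}\otimes(c_{Y^\vee,X}\circ c_{X,Y^\vee})\otimes\mathrm{id}_Y)$, and the Hopf pairing $\omega=(\varepsilon_{\mathcal L}\otimes\varepsilon_{\mathcal L})\circ\mathcal Q$. $H$ is factorisable iff $\mathcal C$ is, i.e. iff $\omega$ induces an isomorphism $\mathcal L\cong\mathcal L^\vee$. The element $\widehat\omega=\widehat\omega_1\otimes\widehat\omega_2\in H\otimes H$ is determined by $\omega(f\otimes g)=g(\widehat\omega_1)f(\widehat\omega_2)$ for $f,g\in H^*$. **Monadic cointegral.** Factorisable $H$ is unimodular, so the distinguished invertible object is $\mathbf 1$. The monad $A_2(V)=\int^XX^\vee\otimes(V\otimes X)$ is realised on $H^*\otimes V$ with $\iota_2(V)_X(f\otimes v\otimes x)=\sum_if(e_ix)e^i\otimes v$, so $A_2(\mathbf 1)=\mathcal L$; its multiplication is determined by $\mu_2(V)\circ\iota_2(A_2V)_Y\circ(\mathrm{id}_{Y^\vee}\otimes\iota_2(V)_X\otimes\mathrm{id}_Y)=\iota_2(V)_{X\otimes Y}\circ(\gamma_{Y,X}\otimes\mathrm{id})$ and its counit by $\epsilon_2\circ\iota_2(\mathbf 1)_X=\mathrm{ev}^l_X$. A right monadic cointegral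 is a morphism $\boldsymbol\lambda:\mathbf 1\to A_2(\mathbf 1)=\mathcal L$ (identified with an element of $H^*$) with $\boldsymbol\lambda\circ\epsilon_2=\mu_2(\mathbf 1)\circ A_2(\boldsymbol\lambda)$; it is unique up to scalar and is a two-sided integral for $\mathcal L$. **Action.** Define $\mathscr S,\mathscr T\in\mathrm{End}_{\mathcal C}(\mathcal L)$ by $\mathscr S=(\varepsilon_{\mathcal L}\otimes\mathrm{id})\circ\mathcal Q\circ(\mathrm{id}\otimes\Lambda_{\mathcal L})$ and $\mathscr T\circ j_X=j_X\circ(\mathrm{id}\otimes\vartheta_X)$. The group $SL(2,\mathbb Z)$, generated by $\mathbf S=\begin{pmatrix}0&-1\\1&0\end{pmatrix}$ and $\mathbf T=\begin{pmatrix}1&1\\0&1\end{pmatrix}$, acts projectively on $\mathcal C(\mathcal L,\mathbf 1)$ by $\mathbf S.f=f\circ\mathscr S$, $\mathbf T.f=f\circ\mathscr T$. The map $\alpha Z\to\mathcal C(\mathcal L,\mathbf 1)$, $\alpha z\mapsto(f\mapsto f(\alpha z))$ is an isomorphism, and $\mathscr S_{\alpha Z},\mathscr T_{\alpha Z}:\alpha Z\to\alpha Z$ are the transported maps: $f(\mathscr S_{\alpha Z}(h))=\mathscr S(f)(h)$ and $f(\mathscr T_{\alpha Z}(h))=\mathscr T(f)(h)$ for $f\in H^*$, $h\in\alpha Z$. *)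

theory Defs
  imports "HOL-Computational_Algebra.Polynomial" "HOL-Library.Function_Algebras" "HOL-Library.FuncSet"
begin

section \<open>Tensor powers of a finite-dimensional algebra\<close>

text \<open>
  The algebra is given by a type \<open>'h :: ring_1\<close> with a scalar multiplication and a finite basis \<open>B\<close>
  (as in the library locale \<open>finite_dimensional_vector_space\<close>).
  An element of the tensor product of \<open>H\<close> with itself is its coefficient family: a function on
  \<open>'h \<times> 'h\<close> that vanishes outside \<open>B \<times> B\<close>, standing for the sum of the \<open>t (x, y)\<close>-fold of
  \<open>x \<otimes> y\<close>. Threefold and fourfold tensors are treated in the same way.
\<close>

record ('k, 'h) quasi_hopf =
  scal :: "'k \<Rightarrow> 'h \<Rightarrow> 'h"
  bas :: "'h set"
  cop :: "'h \<Rightarrow> 'h \<times> 'h \<Rightarrow> 'k"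
  cou :: "'h \<Rightarrow> 'k"
  apd :: "'h \<Rightarrow> 'h"
  coas :: "'h \<times> 'h \<times> 'h \<Rightarrow> 'k"
  coas_inv :: "'h \<times> 'h \<times> 'h \<Rightarrow> 'k"
  alp :: 'h
  bet :: 'h

record ('k, 'h) ribbon_quasi_hopf = "('k, 'h) quasi_hopf" +
  rmat :: "'h \<times> 'h \<Rightarrow> 'k"
  rib :: 'h

text \<open>\<open>supp I\<close> is the vector space with basis indexed by \<open>I\<close>.\<close>

definition supp :: "'i set \<Rightarrow> ('i \<Rightarrow> 'k::zero) set" where
  "supp I = {t. \<forall>i. i \<notin> I \<longrightarrow> t i = 0}"

definition fscale :: "'k::times \<Rightarrow> ('i \<Rightarrow> 'k) \<Rightarrow> 'i \<Rightarrow> 'k" where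
  "fscale c t = (\<lambda>i. c * t i)"

definition coord :: "('k::field, 'h::ring_1, 'z) quasi_hopf_scheme \<Rightarrow> 'h \<Rightarrow> 'h \<Rightarrow> 'k" where
  "coord H a = module.representation (scal H) (bas H) a"

abbreviation B2 where "B2 H \<equiv> bas H \<times> bas H"
abbreviation B3 where "B3 H \<equiv> bas H \<times> bas H \<times> bas H"
abbreviation B4 where "B4 H \<equiv> bas H \<times> bas H \<times> bas H \<times> bas H"

text \<open>Products: \<open>c x y z\<close> is the coefficient of the basis element \<open>z\<close> in the product of the basis
  elements \<open>x\<close> and \<open>y\<close>; tensor powers carry the componentwise product.\<close>

definition struc :: "('k::field, 'h::ring_1, 'z) quasi_hopf_scheme \<Rightarrow> 'h \<Rightarrow> 'h \<Rightarrow> 'h \<Rightarrow> 'k" where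
  "struc H x y z = coord H (x * y) z"

definition struc_tensor :: "('a \<Rightarrow> 'a \<Rightarrow> 'a \<Rightarrow> 'k::times) \<Rightarrow> ('b \<Rightarrow> 'b \<Rightarrow> 'b \<Rightarrow> 'k)
    \<Rightarrow> 'a \<times> 'b \<Rightarrow> 'a \<times> 'b \<Rightarrow> 'a \<times> 'b \<Rightarrow> 'k" where
  "struc_tensor c d = (\<lambda>(x, x') (y, y') (z, z'). c x y z * d x' y' z')"

definition struc_mult :: "'a set \<Rightarrow> ('a \<Rightarrow> 'a \<Rightarrow> 'a \<Rightarrow> 'k::field) \<Rightarrow> ('a \<Rightarrow> 'k) \<Rightarrow> ('a \<Rightarrow> 'k) \<Rightarrow> 'a \<Rightarrow> 'k" where
  "struc_mult I c s t = (\<lambda>z. \<Sum>x\<in>I. \<Sum>y\<in>I. s x * t y * c x y z)"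

definition mult2 where
  "mult2 H = struc_mult (B2 H) (struc_tensor (struc H) (struc H))"

definition mult3 where
  "mult3 H = struc_mult (B3 H) (struc_tensor (struc H) (struc_tensor (struc H) (struc H)))"

definition mult4 where
  "mult4 H = struc_mult (B4 H)
     (struc_tensor (struc H) (struc_tensor (struc H) (struc_tensor (struc H) (struc H))))"

definition one2 :: "('k::field, 'h::ring_1, 'z) quasi_hopf_scheme \<Rightarrow> 'h \<times> 'h \<Rightarrow> 'k" where
  "one2 H = (\<lambda>(x, y). coord H 1 x * coord H 1 y)"

definition one3 :: "('k::field, 'h::ring_1, 'z) quasi_hopf_scheme \<Rightarrow> 'h \<times> 'h \<times> 'h \<Rightarrow> 'k" where
  "one3 H = (\<lambda>(x, y, z). coord H 1 x * coord H 1 y * coord H 1 z)"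

text \<open>Sweedler sums: for \<open>t = t\<^sub>1 \<otimes> t\<^sub>2\<close> the element \<open>F t\<^sub>1 t\<^sub>2\<close>, where \<open>F\<close> is bilinear
  with values in \<open>H\<close>.\<close>

definition sweedler2 ::
  "('k::field, 'h::ring_1, 'z) quasi_hopf_scheme \<Rightarrow> ('h \<times> 'h \<Rightarrow> 'k) \<Rightarrow> ('h \<Rightarrow> 'h \<Rightarrow> 'h) \<Rightarrow> 'h" where
  "sweedler2 H t F = (\<Sum>(x, y)\<in>B2 H. scal H (t (x, y)) (F x y))"

definition sweedler3 ::
  "('k::field, 'h::ring_1, 'z) quasi_hopf_scheme \<Rightarrow> ('h \<times> 'h \<times> 'h \<Rightarrow> 'k) \<Rightarrow> ('h \<Rightarrow> 'h \<Rightarrow> 'h \<Rightarrow> 'h) \<Rightarrow> 'h" where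
  "sweedler3 H t F = (\<Sum>(x, y, z)\<in>B3 H. scal H (t (x, y, z)) (F x y z))"

definition cop_id :: "('k::field, 'h::ring_1, 'z) quasi_hopf_scheme \<Rightarrow> ('h \<times> 'h \<Rightarrow> 'k) \<Rightarrow> 'h \<times> 'h \<times> 'h \<Rightarrow> 'k" where
  "cop_id H t = (\<lambda>(x, y, z). \<Sum>u\<in>bas H. t (u, z) * cop H u (x, y))"

definition id_cop :: "('k::field, 'h::ring_1, 'z) quasi_hopf_scheme \<Rightarrow> ('h \<times> 'h \<Rightarrow> 'k) \<Rightarrow> 'h \<times> 'h \<times> 'h \<Rightarrow> 'k" where
  "id_cop H t = (\<lambda>(x, y, z). \<Sum>u\<in>bas H. t (x, u) * cop H u (y, z))"


section \<open>Factorisable ribbon quasi-Hopf algebras\<close>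

definition fd_algebra :: "('k::field, 'h::ring_1, 'z) quasi_hopf_scheme \<Rightarrow> bool" where
  "fd_algebra H \<longleftrightarrow>
     finite_dimensional_vector_space (scal H) (bas H) \<and>
     (\<forall>c a b. scal H c a * b = scal H c (a * b) \<and> a * scal H c b = scal H c (a * b))"

definition is_quasi_bialgebra :: "('k::field, 'h::ring_1, 'z) quasi_hopf_scheme \<Rightarrow> bool" where
  "is_quasi_bialgebra H \<longleftrightarrow>
     fd_algebra H \<and>
     (\<forall>h. cop H h \<in> supp (B2 H)) \<and>
     Vector_Spaces.linear (scal H) fscale (cop H) \<and>
     (\<forall>a b. cop H (a * b) = mult2 H (cop H a) (cop H b)) \<and>
     cop H 1 = one2 H \<and>
     Vector_Spaces.linear (scal H) (*) (cou H) \<and>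
     (\<forall>a b. cou H (a * b) = cou H a * cou H b) \<and>
     cou H 1 = 1 \<and>
     (\<forall>h. sweedler2 H (cop H h) (\<lambda>a b. scal H (cou H a) b) = h) \<and>
     (\<forall>h. sweedler2 H (cop H h) (\<lambda>a b. scal H (cou H b) a) = h) \<and>
     coas H \<in> supp (B3 H) \<and> coas_inv H \<in> supp (B3 H) \<and>
     mult3 H (coas H) (coas_inv H) = one3 H \<and>
     mult3 H (coas_inv H) (coas H) = one3 H \<and>
     (\<forall>h. mult3 H (cop_id H (cop H h)) (coas H) = mult3 H (coas H) (id_cop H (cop H h))) \<and>
     \<comment> \<open>pentagon: the coassociator acts as \<open>U \<otimes> (V \<otimes> W) \<rightarrow> (U \<otimes> V) \<otimes> W\<close>\<close>
     mult4 H (\<lambda>(x, y, z, w). \<Sum>u\<in>bas H. coas H (u, z, w) * cop H u (x, y))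
             (\<lambda>(x, y, z, w). \<Sum>u\<in>bas H. coas H (x, y, u) * cop H u (z, w)) =
     mult4 H (\<lambda>(x, y, z, w). coas H (x, y, z) * coord H 1 w)
       (mult4 H (\<lambda>(x, y, z, w). \<Sum>u\<in>bas H. coas H (x, u, w) * cop H u (y, z))
                (\<lambda>(x, y, z, w). coord H 1 x * coas H (y, z, w))) \<and>
     (\<lambda>(x, z). \<Sum>u\<in>bas H. coas H (x, u, z) * cou H u) = one2 H"

definition is_quasi_hopf :: "('k::field, 'h::ring_1, 'z) quasi_hopf_scheme \<Rightarrow> bool" where
  "is_quasi_hopf H \<longleftrightarrow>
     is_quasi_bialgebra H \<and>
     Vector_Spaces.linear (scal H) (scal H) (apd H) \<and>
     bij (apd H) \<and>
     (\<forall>a b. apd H (a * b) = apd H b * apd H a) \<and>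
     apd H 1 = 1 \<and>
     (\<forall>h. sweedler2 H (cop H h) (\<lambda>a b. apd H a * alp H * b) = scal H (cou H h) (alp H)) \<and>
     (\<forall>h. sweedler2 H (cop H h) (\<lambda>a b. a * bet H * apd H b) = scal H (cou H h) (bet H)) \<and>
     sweedler3 H (coas H) (\<lambda>a b c. apd H a * alp H * b * bet H * apd H c) = 1 \<and>
     sweedler3 H (coas_inv H) (\<lambda>a b c. a * bet H * apd H b * alp H * c) = 1 \<and>
     cou H (alp H) = 1 \<and> cou H (bet H) = 1"

text \<open>The two hexagons below say that \<open>x \<otimes> y \<mapsto> R\<^sub>2 y \<otimes> R\<^sub>1 x\<close> is a braiding for the associator
  \<open>U \<otimes> (V \<otimes> W) \<rightarrow> (U \<otimes> V) \<otimes> W\<close> given by the action of the coassociator. In Sweedler notation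
  they read (with \<open>\<Psi>\<close> the inverse of \<open>\<Phi>\<close>)
  \<open>(\<Delta> \<otimes> id) R = (\<Psi>\<^sub>2 \<otimes> \<Psi>\<^sub>3 \<otimes> \<Psi>\<^sub>1) R\<^sub>1\<^sub>3 (\<Phi>\<^sub>1 \<otimes> \<Phi>\<^sub>3 \<otimes> \<Phi>\<^sub>2) R\<^sub>2\<^sub>3 \<Psi>\<close> and
  \<open>(id \<otimes> \<Delta>) R = (\<Phi>\<^sub>3 \<otimes> \<Phi>\<^sub>1 \<otimes> \<Phi>\<^sub>2) R\<^sub>1\<^sub>3 (\<Psi>\<^sub>2 \<otimes> \<Psi>\<^sub>1 \<otimes> \<Psi>\<^sub>3) R\<^sub>1\<^sub>2 \<Phi>\<close>.\<close>

definition is_quasitriangular :: "('k::field, 'h::ring_1, 'z) ribbon_quasi_hopf_scheme \<Rightarrow> bool" where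
  "is_quasitriangular H \<longleftrightarrow>
     rmat H \<in> supp (B2 H) \<and>
     (\<exists>r \<in> supp (B2 H). mult2 H (rmat H) r = one2 H \<and> mult2 H r (rmat H) = one2 H) \<and>
     (\<forall>h. mult2 H (rmat H) (cop H h) = mult2 H (\<lambda>(x, y). cop H h (y, x)) (rmat H)) \<and>
     (let R12 = (\<lambda>(x, y, z). rmat H (x, y) * coord H 1 z);
          R13 = (\<lambda>(x, y, z). rmat H (x, z) * coord H 1 y);
          R23 = (\<lambda>(x, y, z). rmat H (y, z) * coord H 1 x)
      in cop_id H (rmat H) =
           mult3 H (\<lambda>(x, y, z). coas_inv H (z, x, y)) (mult3 H R13
             (mult3 H (\<lambda>(x, y, z). coas H (x, z, y)) (mult3 H R23 (coas_inv H)))) \<and>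
         id_cop H (rmat H) =
           mult3 H (\<lambda>(x, y, z). coas H (y, z, x)) (mult3 H R13
             (mult3 H (\<lambda>(x, y, z). coas_inv H (y, x, z)) (mult3 H R12 (coas H)))))"

definition centre :: "'h::ring_1 set" where
  "centre = {z. \<forall>h. z * h = h * z}"

definition is_ribbon :: "('k::field, 'h::ring_1, 'z) ribbon_quasi_hopf_scheme \<Rightarrow> bool" where
  "is_ribbon H \<longleftrightarrow>
     rib H \<in> centre \<and>
     (\<exists>w. w * rib H = 1 \<and> rib H * w = 1) \<and>
     apd H (rib H) = rib H \<and>
     mult2 H (mult2 H (\<lambda>(x, y). rmat H (y, x)) (rmat H)) (cop H (rib H)) =
       (\<lambda>(x, y). coord H (rib H) x * coord H (rib H) y)"

definition rib_inv :: "('k::field, 'h::ring_1, 'z) ribbon_quasi_hopf_scheme \<Rightarrow> 'h" where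
  "rib_inv H = (THE w. w * rib H = 1 \<and> rib H * w = 1)"


section \<open>The category of finite-dimensional left modules\<close>

text \<open>A finite-dimensional left module is a vector space \<open>supp I\<close> on a finite index set \<open>I\<close> with
  an action. Indices of tensor products are pairs and the dual of a module has the same index set,
  standing for the dual basis. Structure maps are maps on coefficient families, so \<open>\<lambda>x. x\<close> is an
  identity morphism, and the unit object has the index set \<open>{()}\<close>.\<close>

record ('k, 'h, 'i) hmod =
  idx :: "'i set"
  act :: "'h \<Rightarrow> ('i \<Rightarrow> 'k) \<Rightarrow> 'i \<Rightarrow> 'k"

definition vecs :: "('k::zero, 'h, 'i) hmod \<Rightarrow> ('i \<Rightarrow> 'k) set" where
  "vecs X = supp (idx X)"

definition unit_vec :: "'i \<Rightarrow> 'i \<Rightarrow> 'k::zero_neq_one" where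
  "unit_vec i = (\<lambda>j. if j = i then 1 else 0)"

definition linear_vecs :: "('k::field, 'h, 'i) hmod \<Rightarrow> ('k, 'h, 'j) hmod \<Rightarrow> (('i \<Rightarrow> 'k) \<Rightarrow> 'j \<Rightarrow> 'k) \<Rightarrow> bool" where
  "linear_vecs X Y f \<longleftrightarrow>
     (\<forall>x\<in>vecs X. f x \<in> vecs Y) \<and>
     (\<forall>x\<in>vecs X. \<forall>y\<in>vecs X. f (x + y) = f x + f y) \<and>
     (\<forall>c. \<forall>x\<in>vecs X. f (fscale c x) = fscale c (f x))"

definition hmodule :: "('k::field, 'h::ring_1, 'z) quasi_hopf_scheme \<Rightarrow> ('k, 'h, 'i) hmod \<Rightarrow> bool" where
  "hmodule H X \<longleftrightarrow>
     finite (idx X) \<and>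
     (\<forall>h. linear_vecs X X (act X h)) \<and>
     (\<forall>x\<in>vecs X. \<forall>a b. act X (a + b) x = act X a x + act X b x) \<and>
     (\<forall>x\<in>vecs X. \<forall>c a. act X (scal H c a) x = fscale c (act X a x)) \<and>
     (\<forall>x\<in>vecs X. act X 1 x = x) \<and>
     (\<forall>x\<in>vecs X. \<forall>a b. act X (a * b) x = act X a (act X b x))"

definition hom :: "('k::field, 'h, 'i) hmod \<Rightarrow> ('k, 'h, 'j) hmod \<Rightarrow> (('i \<Rightarrow> 'k) \<Rightarrow> 'j \<Rightarrow> 'k) set" where
  "hom X Y = {f. linear_vecs X Y f \<and> (\<forall>h. \<forall>x\<in>vecs X. f (act X h x) = act Y h (f x))}"

text \<open>Tensor product of linear maps: \<open>f\<close> acts on the first index, \<open>g\<close> on the second, so that the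
  family \<open>\<lambda>(i, j). x i * y j\<close> is sent to \<open>\<lambda>(i, j). f x i * g y j\<close>.\<close>

definition tmap :: "(('i \<Rightarrow> 'k) \<Rightarrow> 'a \<Rightarrow> 'k) \<Rightarrow> (('j \<Rightarrow> 'k) \<Rightarrow> 'b \<Rightarrow> 'k) \<Rightarrow> ('i \<times> 'j \<Rightarrow> 'k) \<Rightarrow> 'a \<times> 'b \<Rightarrow> 'k" where
  "tmap f g t = (\<lambda>(a, b). g (\<lambda>j. f (\<lambda>i. t (i, j)) a) b)"

definition act2 :: "('k::field, 'h::ring_1, 'z) quasi_hopf_scheme \<Rightarrow> ('k, 'h, 'i) hmod \<Rightarrow> ('k, 'h, 'j) hmod
    \<Rightarrow> ('h \<times> 'h \<Rightarrow> 'k) \<Rightarrow> ('i \<times> 'j \<Rightarrow> 'k) \<Rightarrow> 'i \<times> 'j \<Rightarrow> 'k" where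
  "act2 H X Y s t = (\<lambda>p. \<Sum>(a, b)\<in>B2 H. s (a, b) * tmap (act X a) (act Y b) t p)"

definition act3 :: "('k::field, 'h::ring_1, 'z) quasi_hopf_scheme \<Rightarrow> ('k, 'h, 'i) hmod \<Rightarrow> ('k, 'h, 'j) hmod
    \<Rightarrow> ('k, 'h, 'l) hmod \<Rightarrow> ('h \<times> 'h \<times> 'h \<Rightarrow> 'k) \<Rightarrow> ('i \<times> 'j \<times> 'l \<Rightarrow> 'k) \<Rightarrow> 'i \<times> 'j \<times> 'l \<Rightarrow> 'k" where
  "act3 H X Y Z s t =
     (\<lambda>p. \<Sum>(a, b, c)\<in>B3 H. s (a, b, c) * tmap (act X a) (tmap (act Y b) (act Z c)) t p)"

definition tens :: "('k::field, 'h::ring_1, 'z) quasi_hopf_scheme \<Rightarrow> ('k, 'h, 'i) hmod \<Rightarrow> ('k, 'h, 'j) hmod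
    \<Rightarrow> ('k, 'h, 'i \<times> 'j) hmod" where
  "tens H X Y = \<lparr>idx = idx X \<times> idx Y, act = (\<lambda>h. act2 H X Y (cop H h))\<rparr>"

definition one_mod :: "('k::field, 'h::ring_1, 'z) quasi_hopf_scheme \<Rightarrow> ('k, 'h, unit) hmod" where
  "one_mod H = \<lparr>idx = {()}, act = (\<lambda>h u _. cou H h * u ())\<rparr>"

text \<open>\<open>(h.f)(x) = f(S(h) x)\<close>, evaluated at the basis vectors \<open>x = unit_vec i\<close>.\<close>

definition dual :: "('k::field, 'h::ring_1, 'z) quasi_hopf_scheme \<Rightarrow> ('k, 'h, 'i) hmod \<Rightarrow> ('k, 'h, 'i) hmod" where
  "dual H X = \<lparr>idx = idx X,
     act = (\<lambda>h f i. if i \<in> idx X then \<Sum>j\<in>idx X. f j * act X (apd H h) (unit_vec i) j else 0)\<rparr>"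

definition assoc :: "('k::field, 'h::ring_1, 'z) quasi_hopf_scheme \<Rightarrow> ('k, 'h, 'i) hmod \<Rightarrow> ('k, 'h, 'j) hmod
    \<Rightarrow> ('k, 'h, 'l) hmod \<Rightarrow> ('i \<times> 'j \<times> 'l \<Rightarrow> 'k) \<Rightarrow> ('i \<times> 'j) \<times> 'l \<Rightarrow> 'k" where
  "assoc H X Y Z t = (\<lambda>((i, j), l). act3 H X Y Z (coas H) t (i, j, l))"

definition assoc_inv :: "('k::field, 'h::ring_1, 'z) quasi_hopf_scheme \<Rightarrow> ('k, 'h, 'i) hmod \<Rightarrow> ('k, 'h, 'j) hmod
    \<Rightarrow> ('k, 'h, 'l) hmod \<Rightarrow> (('i \<times> 'j) \<times> 'l \<Rightarrow> 'k) \<Rightarrow> 'i \<times> 'j \<times> 'l \<Rightarrow> 'k" where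
  "assoc_inv H X Y Z t = act3 H X Y Z (coas_inv H) (\<lambda>(i, j, l). t ((i, j), l))"

definition lunit :: "(unit \<times> 'i \<Rightarrow> 'k) \<Rightarrow> 'i \<Rightarrow> 'k" where
  "lunit t = (\<lambda>i. t ((), i))"

definition runit_inv :: "('i \<Rightarrow> 'k) \<Rightarrow> 'i \<times> unit \<Rightarrow> 'k" where
  "runit_inv x = (\<lambda>(i, _). x i)"

definition braid :: "('k::field, 'h::ring_1, 'z) ribbon_quasi_hopf_scheme \<Rightarrow> ('k, 'h, 'i) hmod \<Rightarrow> ('k, 'h, 'j) hmod
    \<Rightarrow> ('i \<times> 'j \<Rightarrow> 'k) \<Rightarrow> 'j \<times> 'i \<Rightarrow> 'k" where
  "braid H X Y t = (\<lambda>(j, i). act2 H X Y (rmat H) t (i, j))"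

definition twist :: "('k::field, 'h::ring_1, 'z) ribbon_quasi_hopf_scheme \<Rightarrow> ('k, 'h, 'i) hmod
    \<Rightarrow> ('i \<Rightarrow> 'k) \<Rightarrow> 'i \<Rightarrow> 'k" where
  "twist H X = act X (rib_inv H)"

text \<open>\<open>ev (f \<otimes> x) = f(\<alpha> x)\<close> and \<open>coev 1\<close> is the sum of the \<open>\<beta> x\<^sub>j \<otimes> x\<^sup>j\<close>.\<close>

definition ev :: "('k::field, 'h::ring_1, 'z) quasi_hopf_scheme \<Rightarrow> ('k, 'h, 'i) hmod
    \<Rightarrow> ('i \<times> 'i \<Rightarrow> 'k) \<Rightarrow> unit \<Rightarrow> 'k" where
  "ev H X t = (\<lambda>_. \<Sum>(i, j)\<in>idx X \<times> idx X. t (i, j) * act X (alp H) (unit_vec j) i)"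

definition coev :: "('k::field, 'h::ring_1, 'z) quasi_hopf_scheme \<Rightarrow> ('k, 'h, 'i) hmod
    \<Rightarrow> (unit \<Rightarrow> 'k) \<Rightarrow> 'i \<times> 'i \<Rightarrow> 'k" where
  "coev H X u = (\<lambda>(i, j). if j \<in> idx X then u () * act X (bet H) (unit_vec j) i else 0)"

text \<open>The canonical isomorphism from \<open>V\<^sup>\<or> \<otimes> W\<^sup>\<or>\<close> to the dual of \<open>W \<otimes> V\<close>: the morphism that
  corresponds under the duality to the nested evaluation
  \<open>(V\<^sup>\<or> \<otimes> W\<^sup>\<or>) \<otimes> (W \<otimes> V) \<rightarrow> V\<^sup>\<or> \<otimes> ((W\<^sup>\<or> \<otimes> W) \<otimes> V) \<rightarrow> V\<^sup>\<or> \<otimes> V \<rightarrow> 1\<close>.\<close>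

definition nested_ev where
  "nested_ev H V W = ev H V \<circ> tmap (\<lambda>x. x) (lunit \<circ> tmap (ev H W) (\<lambda>x. x) \<circ> assoc H (dual H W) W V)
     \<circ> assoc_inv H (dual H V) (dual H W) (tens H W V)"

definition gam where
  "gam H V W =
     lunit \<circ> tmap (nested_ev H V W) (\<lambda>x. x)
     \<circ> assoc H (tens H (dual H V) (dual H W)) (tens H W V) (dual H (tens H W V))
     \<circ> tmap (\<lambda>x. x) (coev H (tens H W V)) \<circ> runit_inv"


section \<open>The coend and its structure\<close>

text \<open>\<open>H\<^sup>*\<close> consists of coefficient families over the dual basis; \<open>hpair H f h\<close> is the value of
  \<open>f\<close> at \<open>h\<close>, and \<open>f b = hpair H f b\<close> for basis elements \<open>b\<close>.\<close>

definition hpair :: "('k::field, 'h::ring_1, 'z) quasi_hopf_scheme \<Rightarrow> ('h \<Rightarrow> 'k) \<Rightarrow> 'h \<Rightarrow> 'k" where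
  "hpair H f h = (\<Sum>b\<in>bas H. f b * coord H h b)"

definition coend :: "('k::field, 'h::ring_1, 'z) quasi_hopf_scheme \<Rightarrow> ('k, 'h, 'h) hmod" where
  "coend H = \<lparr>idx = bas H,
     act = (\<lambda>h f b. if b \<in> bas H then hpair H f (sweedler2 H (cop H h) (\<lambda>h1 h2. apd H h1 * b * h2)) else 0)\<rparr>"

definition jmap :: "('k::field, 'h::ring_1, 'z) quasi_hopf_scheme \<Rightarrow> ('k, 'h, 'i) hmod
    \<Rightarrow> ('i \<times> 'i \<Rightarrow> 'k) \<Rightarrow> 'h \<Rightarrow> 'k" where
  "jmap H X t = (\<lambda>b. if b \<in> bas H
     then \<Sum>(i, j)\<in>idx X \<times> idx X. t (i, j) * act X b (unit_vec j) i else 0)"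

abbreviation dxx where "dxx H X \<equiv> tens H (dual H X) X"

text \<open>Morphisms out of (tensor products of) coends are determined by the dinatural transformations.
  The test modules \<open>X\<close> and \<open>Y\<close> have index sets of natural numbers; every finite-dimensional module
  is isomorphic to such a module. Membership in \<open>extensional\<close> makes the descriptions unique as
  functions on all coefficient families.\<close>

definition morph :: "('k::field, 'h, 'i) hmod \<Rightarrow> ('k, 'h, 'j) hmod \<Rightarrow> (('i \<Rightarrow> 'k) \<Rightarrow> 'j \<Rightarrow> 'k) set" where
  "morph X Y = hom X Y \<inter> extensional (vecs X)"

definition counit_coend :: "('k::field, 'h::ring_1, 'z) quasi_hopf_scheme \<Rightarrow> ('h \<Rightarrow> 'k) \<Rightarrow> unit \<Rightarrow> 'k" where
  "counit_coend H = (THE e. e \<in> morph (coend H) (one_mod H) \<and>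
     (\<forall>X :: ('k, 'h, nat) hmod. hmodule H X \<longrightarrow> (\<forall>t\<in>vecs (dxx H X). e (jmap H X t) = ev H X t)))"

text \<open>The double braiding of the two middle factors, on \<open>(X\<^sup>\<or> \<otimes> X) \<otimes> (Y\<^sup>\<or> \<otimes> Y)\<close>.\<close>

definition middle_monodromy where
  "middle_monodromy H X Y =
     assoc_inv H (dxx H X) (dual H Y) Y
     \<circ> tmap (assoc H (dual H X) X (dual H Y)
              \<circ> tmap (\<lambda>x. x) (braid H (dual H Y) X \<circ> braid H X (dual H Y))
              \<circ> assoc_inv H (dual H X) X (dual H Y)) (\<lambda>x. x)
     \<circ> assoc H (dxx H X) (dual H Y) Y"

definition Qmap :: "('k::field, 'h::ring_1, 'z) ribbon_quasi_hopf_scheme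
    \<Rightarrow> ('h \<times> 'h \<Rightarrow> 'k) \<Rightarrow> 'h \<times> 'h \<Rightarrow> 'k" where
  "Qmap H = (THE q. q \<in> morph (tens H (coend H) (coend H)) (tens H (coend H) (coend H)) \<and>
     (\<forall>(X :: ('k, 'h, nat) hmod) (Y :: ('k, 'h, nat) hmod). hmodule H X \<longrightarrow> hmodule H Y \<longrightarrow>
       (\<forall>t\<in>vecs (tens H (dxx H X) (dxx H Y)).
          q (tmap (jmap H X) (jmap H Y) t) = tmap (jmap H X) (jmap H Y) (middle_monodromy H X Y t))))"

definition hopf_pairing :: "('k::field, 'h::ring_1, 'z) ribbon_quasi_hopf_scheme
    \<Rightarrow> ('h \<times> 'h \<Rightarrow> 'k) \<Rightarrow> unit \<Rightarrow> 'k" where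
  "hopf_pairing H = lunit \<circ> tmap (counit_coend H) (counit_coend H) \<circ> Qmap H"

text \<open>The morphism from the coend to its dual that is induced by the Hopf pairing.\<close>

definition pairing_to_dual :: "('k::field, 'h::ring_1, 'z) ribbon_quasi_hopf_scheme
    \<Rightarrow> ('h \<Rightarrow> 'k) \<Rightarrow> 'h \<Rightarrow> 'k" where
  "pairing_to_dual H =
     lunit \<circ> tmap (hopf_pairing H) (\<lambda>x. x) \<circ> assoc H (coend H) (coend H) (dual H (coend H))
     \<circ> tmap (\<lambda>x. x) (coev H (coend H)) \<circ> runit_inv"

definition is_factorisable :: "('k::field, 'h::ring_1, 'z) ribbon_quasi_hopf_scheme \<Rightarrow> bool" where
  "is_factorisable H \<longleftrightarrow> bij_betw (pairing_to_dual H) (vecs (coend H)) (vecs (dual H (coend H)))"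

definition factorisable_ribbon_quasi_hopf :: "('k::field, 'h::ring_1, 'z) ribbon_quasi_hopf_scheme \<Rightarrow> bool" where
  "factorisable_ribbon_quasi_hopf H \<longleftrightarrow>
     is_quasi_hopf H \<and> is_quasitriangular H \<and> is_ribbon H \<and> is_factorisable H"

text \<open>\<open>\<omega>(f \<otimes> g) = g(w\<^sub>1) f(w\<^sub>2)\<close>; note the order of the two factors.\<close>

definition omega_hat :: "('k::field, 'h::ring_1, 'z) ribbon_quasi_hopf_scheme \<Rightarrow> 'h \<times> 'h \<Rightarrow> 'k" where
  "omega_hat H = (THE w. w \<in> supp (B2 H) \<and>
     (\<forall>f\<in>vecs (coend H). \<forall>g\<in>vecs (coend H).
        hopf_pairing H (\<lambda>(a, b). f a * g b) () =
          (\<Sum>(a, b)\<in>B2 H. w (a, b) * hpair H g a * hpair H f b)))"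


section \<open>Right monadic cointegrals\<close>

text \<open>The action on \<open>A\<^sub>2(V)\<close> is the one for which the maps \<open>\<iota>\<^sub>2(V)\<^sub>X\<close> defined on
  \<open>X\<^sup>\<or> \<otimes> (V \<otimes> X)\<close> are module morphisms:
  \<open>h\<close> sends \<open>f \<otimes> v\<close> to \<open>f(S(h\<^sub>(\<^sub>1\<^sub>)) ? h\<^sub>(\<^sub>2\<^sub>,\<^sub>2\<^sub>)) \<otimes> h\<^sub>(\<^sub>2\<^sub>,\<^sub>1\<^sub>) v\<close>.\<close>

definition A2 :: "('k::field, 'h::ring_1, 'z) quasi_hopf_scheme \<Rightarrow> ('k, 'h, 'v) hmod \<Rightarrow> ('k, 'h, 'h \<times> 'v) hmod" where
  "A2 H V = \<lparr>idx = bas H \<times> idx V,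
     act = (\<lambda>h t. \<lambda>(b, v). if b \<in> bas H then
       \<Sum>(h1, h21, h22)\<in>B3 H. id_cop H (cop H h) (h1, h21, h22) *
         act V h21 (\<lambda>v'. hpair H (\<lambda>b'. t (b', v')) (apd H h1 * b * h22)) v else 0)\<rparr>"

definition iota2 :: "('k::field, 'h::ring_1, 'z) quasi_hopf_scheme \<Rightarrow> ('k, 'h, 'i) hmod
    \<Rightarrow> ('i \<times> 'v \<times> 'i \<Rightarrow> 'k) \<Rightarrow> 'h \<times> 'v \<Rightarrow> 'k" where
  "iota2 H X t = (\<lambda>(b, v). if b \<in> bas H
     then \<Sum>(i, j)\<in>idx X \<times> idx X. t (i, v, j) * act X b (unit_vec j) i else 0)"

definition counit_A2 :: "('k::field, 'h::ring_1, 'z) quasi_hopf_scheme \<Rightarrow> ('h \<times> unit \<Rightarrow> 'k) \<Rightarrow> unit \<Rightarrow> 'k" where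
  "counit_A2 H = (THE e. e \<in> morph (A2 H (one_mod H)) (one_mod H) \<and>
     (\<forall>X :: ('k, 'h, nat) hmod. hmodule H X \<longrightarrow>
       (\<forall>t\<in>vecs (tens H (dual H X) (tens H (one_mod H) X)).
          e (iota2 H X t) = ev H X (tmap (\<lambda>x. x) lunit t))))"

text \<open>The rebracketing
  \<open>Y\<^sup>\<or> \<otimes> ((X\<^sup>\<or> \<otimes> (V \<otimes> X)) \<otimes> Y) \<rightarrow> (Y\<^sup>\<or> \<otimes> X\<^sup>\<or>) \<otimes> (V \<otimes> (X \<otimes> Y))\<close>.\<close>

definition rebracket where
  "rebracket H V X Y =
     assoc H (dual H Y) (dual H X) (tens H V (tens H X Y))
     \<circ> tmap (\<lambda>x. x) (tmap (\<lambda>x. x) (assoc_inv H V X Y) \<circ> assoc_inv H (dual H X) (tens H V X) Y)"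

definition mu2 :: "('k::field, 'h::ring_1, 'z) quasi_hopf_scheme \<Rightarrow> ('k, 'h, 'v) hmod
    \<Rightarrow> ('h \<times> 'h \<times> 'v \<Rightarrow> 'k) \<Rightarrow> 'h \<times> 'v \<Rightarrow> 'k" where
  "mu2 H V = (THE m. m \<in> morph (A2 H (A2 H V)) (A2 H V) \<and>
     (\<forall>(X :: ('k, 'h, nat) hmod) (Y :: ('k, 'h, nat) hmod). hmodule H X \<longrightarrow> hmodule H Y \<longrightarrow>
       (\<forall>t\<in>vecs (tens H (dual H Y) (tens H (tens H (dual H X) (tens H V X)) Y)).
          m (iota2 H Y (tmap (\<lambda>x. x) (tmap (iota2 H X) (\<lambda>x. x)) t)) =
          iota2 H (tens H X Y) (tmap (gam H Y X) (\<lambda>x. x) (rebracket H V X Y t)))))"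

text \<open>An element of \<open>H\<^sup>*\<close> as a linear map from the unit object to the coend. The functor
  \<open>A\<^sub>2\<close> acts on morphisms by \<open>f \<mapsto> id \<otimes> f\<close>, and \<open>runit_inv\<close> identifies \<open>H\<^sup>*\<close> with \<open>A\<^sub>2(1)\<close>.\<close>

definition from_one :: "('h \<Rightarrow> 'k::times) \<Rightarrow> (unit \<Rightarrow> 'k) \<Rightarrow> 'h \<Rightarrow> 'k" where
  "from_one lam u = (\<lambda>b. u () * lam b)"

definition right_monadic_cointegral ::
  "('k::field, 'h::ring_1, 'z) quasi_hopf_scheme \<Rightarrow> ('h \<Rightarrow> 'k) \<Rightarrow> bool" where
  "right_monadic_cointegral H lam \<longleftrightarrow>
     lam \<in> vecs (coend H) \<and>
     runit_inv \<circ> from_one lam \<in> hom (one_mod H) (A2 H (one_mod H)) \<and>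
     (\<forall>t\<in>vecs (A2 H (one_mod H)).
        (runit_inv \<circ> from_one lam) (counit_A2 H t) =
        mu2 H (one_mod H) (tmap (\<lambda>x. x) (runit_inv \<circ> from_one lam) t))"


section \<open>The action on \<open>\<alpha>Z\<close>\<close>

definition Scoend :: "('k::field, 'h::ring_1, 'z) ribbon_quasi_hopf_scheme \<Rightarrow> ('h \<Rightarrow> 'k)
    \<Rightarrow> ('h \<Rightarrow> 'k) \<Rightarrow> 'h \<Rightarrow> 'k" where
  "Scoend H lam =
     lunit \<circ> tmap (counit_coend H) (\<lambda>x. x) \<circ> Qmap H \<circ> tmap (\<lambda>x. x) (from_one lam) \<circ> runit_inv"

definition Tcoend :: "('k::field, 'h::ring_1, 'z) ribbon_quasi_hopf_scheme
    \<Rightarrow> ('h \<Rightarrow> 'k) \<Rightarrow> 'h \<Rightarrow> 'k" where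
  "Tcoend H = (THE f. f \<in> morph (coend H) (coend H) \<and>
     (\<forall>X :: ('k, 'h, nat) hmod. hmodule H X \<longrightarrow>
       (\<forall>t\<in>vecs (dxx H X). f (jmap H X t) = jmap H X (tmap (\<lambda>x. x) (twist H X) t))))"

definition alphaZ :: "('k::field, 'h::ring_1, 'z) quasi_hopf_scheme \<Rightarrow> 'h set" where
  "alphaZ H = (\<lambda>z. alp H * z) ` centre"

text \<open>Transport of the map \<open>\<phi> \<mapsto> \<phi> \<circ> F\<close> on the invariant functionals on \<open>H\<^sup>*\<close> along the
  isomorphism from \<open>\<alpha>Z\<close> that sends \<open>h\<close> to \<open>f \<mapsto> f(h)\<close>.\<close>

definition transport :: "('k::field, 'h::ring_1, 'z) quasi_hopf_scheme
    \<Rightarrow> (('h \<Rightarrow> 'k) \<Rightarrow> 'h \<Rightarrow> 'k) \<Rightarrow> 'h \<Rightarrow> 'h" where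
  "transport H F h =
     (THE h'. h' \<in> alphaZ H \<and> (\<forall>f\<in>vecs (coend H). hpair H f h' = hpair H (F f) h))"

definition S_alphaZ where "S_alphaZ H lam = transport H (Scoend H lam)"

definition T_alphaZ where "T_alphaZ H = transport H (Tcoend H)"

definition linear_endo_on :: "('k \<Rightarrow> 'h \<Rightarrow> 'h) \<Rightarrow> 'h::ring_1 set \<Rightarrow> ('h \<Rightarrow> 'h) \<Rightarrow> bool" where
  "linear_endo_on s U F \<longleftrightarrow>
     (\<forall>x\<in>U. F x \<in> U) \<and> (\<forall>x\<in>U. \<forall>y\<in>U. F (x + y) = F x + F y) \<and> (\<forall>c. \<forall>x\<in>U. F (s c x) = s c (F x))"

end

theory Submission
  imports Defs
begin

text \<open>
  The invariant functionals on the coend \<open>H\<^sup>*\<close> are the evaluations at the elements \<open>a\<close> of \<open>H\<close> with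
  \<open>S(h\<^sub>1) a h\<^sub>2 = \<epsilon>(h) a\<close>, and these elements are exactly the \<open>\<alpha> z\<close> with \<open>z\<close> central. The inclusion
  that matters here (\<open>coinvariant_alphaZ\<close>) is the translation of the isomorphism
  \<open>Hom(\<L>, 1) = Nat(id, id)\<close> into elements: for an invariant \<open>a\<close> put
  \<open>z = \<Psi>\<^sub>1 \<beta> S(\<Psi>\<^sub>2) a \<Psi>\<^sub>3\<close> with \<open>\<Psi>\<close> the inverse coassociator; \<open>z\<close> is central by
  quasi-coassociativity, and \<open>\<alpha> z = a\<close> by the pentagon and the zigzag identity
  \<open>S(\<Phi>\<^sub>1) \<alpha> \<Phi>\<^sub>2 \<beta> S(\<Phi>\<^sub>3) = 1\<close>.

  The double braiding of the middle factors of \<open>(X\<^sup>\<or> \<otimes> X) \<otimes> (Y\<^sup>\<or> \<otimes> Y)\<close>, rebracketings included, is the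
  action of one element \<open>M\<close> of \<open>H \<otimes> H \<otimes> H \<otimes> H\<close>, called \<open>middle_element\<close> below. Hence \<open>\<Q>\<close> is the map
  \<open>(\<Q> F)(p, q) = F(S(M\<^sub>1) p M\<^sub>2, S(M\<^sub>3) q M\<^sub>4)\<close> (\<open>Qmap_eq\<close>). It is a module morphism because \<open>M\<close>
  commutes with \<open>(\<Delta> \<otimes> \<Delta>) \<circ> \<Delta>\<close> (\<open>agree_middle_element\<close>), and it is the only map with the defining
  property because the dinatural transformation of the regular module is onto.

  Now let \<open>z\<close> be central. The value of \<open>\<S>(f)\<close> at \<open>\<alpha> z\<close> is the value of \<open>\<Q>(f \<otimes> \<lambda>)\<close> at
  \<open>(\<alpha>, \<alpha> z)\<close>. Since \<open>z\<close> can be moved past \<open>M\<^sub>4\<close>, this is the value of \<open>\<Q>(f \<otimes> \<lambda>(? z))\<close> at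
  \<open>(\<alpha>, \<alpha>)\<close>, that is, the Hopf pairing \<open>\<omega>(f \<otimes> \<lambda>(? z)) = \<lambda>(w\<^sub>1 z) f(w\<^sub>2)\<close> for the element \<open>w\<close> that
  represents \<open>\<omega>\<close> (\<open>hpair_S_value\<close>). The element \<open>\<lambda>(w\<^sub>1 z) w\<^sub>2\<close> is invariant, because
  \<open>\<lambda>\<close> is invariant and \<open>\<Q>\<close> is a morphism, and so it lies in \<open>\<alpha>Z\<close>. The statement on
  \<open>\<T>\<close> is immediate from \<open>\<T>(f) = f(? v\<^sup>-\<^sup>1)\<close>.
\<close>

section \<open>Evaluation of tensors on multilinear functionals\<close>

text \<open>A functional of four arguments in \<open>'x\<close> is sent to a scalar: the way in which elements of
  the fourth tensor power are represented below.\<close>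

type_synonym ('x, 'y) functional4 = "('x \<Rightarrow> 'x \<Rightarrow> 'x \<Rightarrow> 'x \<Rightarrow> 'y) \<Rightarrow> 'y"

lemma struc_mult_eval:
  assumes "finite I"
  shows "(\<Sum>z\<in>I. struc_mult I c s t z * T z) = (\<Sum>x\<in>I. s x * (\<Sum>y\<in>I. t y * (\<Sum>z\<in>I. c x y z * T z)))"
proof -
  have "(\<Sum>z\<in>I. struc_mult I c s t z * T z) = (\<Sum>z\<in>I. \<Sum>x\<in>I. \<Sum>y\<in>I. s x * (t y * (c x y z * T z)))"
    by (simp add: struc_mult_def sum_distrib_right mult.assoc)
  also have "\<dots> = (\<Sum>x\<in>I. \<Sum>z\<in>I. \<Sum>y\<in>I. s x * (t y * (c x y z * T z)))"
    by (rule sum.swap)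
  also have "\<dots> = (\<Sum>x\<in>I. \<Sum>y\<in>I. \<Sum>z\<in>I. s x * (t y * (c x y z * T z)))"
    by (intro sum.cong refl sum.swap)
  finally show ?thesis by (simp add: sum_distrib_left)
qed

lemma sum_struc_tensor:
  "(\<Sum>z\<in>I \<times> J. struc_tensor c d x y z * T (fst z) (snd z)) =
    (\<Sum>z\<in>I. c (fst x) (fst y) z * (\<Sum>z'\<in>J. (d (snd x) (snd y) z' :: 'k::comm_ring_1) * T z z'))"
  by (cases x; cases y)
    (simp add: struc_tensor_def sum_distrib_left sum.cartesian_product mult.assoc split_def)

text \<open>The inverse coassociator is written \<open>\<Psi>\<close>.\<close>

locale quasi_hopf_alg =
  fixes H :: "('k::field, 'h::ring_1, 'z) quasi_hopf_scheme"
  assumes quasi_hopf: "is_quasi_hopf H"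
begin

abbreviation "S \<equiv> apd H"
abbreviation "\<epsilon> \<equiv> cou H"
abbreviation "\<Delta> \<equiv> cop H"
abbreviation "\<Phi> \<equiv> coas H"
abbreviation "\<Psi> \<equiv> coas_inv H"
abbreviation "\<alpha> \<equiv> alp H"
abbreviation "\<beta> \<equiv> bet H"

lemma quasi_bialgebra: "is_quasi_bialgebra H"
  using quasi_hopf by (simp add: is_quasi_hopf_def)

lemma fd_algebra: "fd_algebra H"
  using quasi_bialgebra by (simp add: is_quasi_bialgebra_def)

sublocale vs: finite_dimensional_vector_space "scal H" "bas H"
  using fd_algebra by (simp add: fd_algebra_def)

lemma scal_mult [simp]: "scal H c a * b = scal H c (a * b)" "a * scal H c b = scal H c (a * b)"
  using fd_algebra by (auto simp: fd_algebra_def)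

lemma finite_bas [simp]: "finite (bas H)"
  by (rule vs.finite_Basis)

text \<open>Linear functionals on \<open>H\<close> and linear endomorphisms of \<open>H\<close>. They are kept as plain
  conjunctions so that linearity of a composite expression follows by rewriting.\<close>

definition functional :: "('h \<Rightarrow> 'k) \<Rightarrow> bool" where
  "functional \<phi> \<longleftrightarrow> (\<forall>a b. \<phi> (a + b) = \<phi> a + \<phi> b) \<and> (\<forall>c a. \<phi> (scal H c a) = c * \<phi> a)"

definition endo :: "('h \<Rightarrow> 'h) \<Rightarrow> bool" where
  "endo f \<longleftrightarrow> (\<forall>a b. f (a + b) = f a + f b) \<and> (\<forall>c a. f (scal H c a) = scal H c (f a))"

lemma functional_zero: "functional \<phi> \<Longrightarrow> \<phi> 0 = 0"
  by (metis functional_def add_cancel_right_left add.right_neutral)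

lemma functional_sum: "functional \<phi> \<Longrightarrow> \<phi> (\<Sum>i\<in>A. f i) = (\<Sum>i\<in>A. \<phi> (f i))"
  by (induction A rule: infinite_finite_induct) (auto simp: functional_zero functional_def)

lemma coord_sum: "(\<Sum>b\<in>bas H. scal H (coord H h b) b) = h"
  unfolding coord_def
  by (rule vs.sum_representation_eq) (auto simp: vs.independent_Basis vs.span_Basis)

lemma functional_expand: "functional \<phi> \<Longrightarrow> \<phi> h = (\<Sum>b\<in>bas H. coord H h b * \<phi> b)"
proof -
  assume \<phi>: "functional \<phi>"
  have "\<phi> (\<Sum>b\<in>bas H. scal H (coord H h b) b) = (\<Sum>b\<in>bas H. coord H h b * \<phi> b)"
    by (subst functional_sum [OF \<phi>]) (use \<phi> in \<open>simp add: functional_def\<close>)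
  then show ?thesis by (simp only: coord_sum)
qed

lemma functional_coord: "functional (\<lambda>h. coord H h b)"
  unfolding coord_def functional_def
  by (auto simp: vs.representation_add vs.representation_scale vs.independent_Basis vs.span_Basis)

lemma coord_basis: "b \<in> bas H \<Longrightarrow> coord H b c = (if c = b then 1 else 0)"
  unfolding coord_def by (simp add: vs.representation_basis vs.independent_Basis)

text \<open>Identities in \<open>H\<close> are proved by applying an arbitrary functional to both sides.\<close>

lemma functional_separate:
  assumes "\<And>\<phi>. functional \<phi> \<Longrightarrow> \<phi> a = \<phi> b"
  shows "a = b"
proof -
  have "coord H a c = coord H b c" for c
    by (rule assms [OF functional_coord])
  then have "(\<Sum>c\<in>bas H. scal H (coord H a c) c) = (\<Sum>c\<in>bas H. scal H (coord H b c) c)"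
    by (simp only:)
  then show ?thesis by (simp only: coord_sum)
qed

lemma functional_hpair [simp]: "functional (hpair H f)"
  using functional_coord
  by (auto simp: functional_def hpair_def algebra_simps sum.distrib sum_distrib_left)

lemma endo_apd: "endo S"
  using quasi_hopf unfolding is_quasi_hopf_def endo_def
  by (auto simp: Vector_Spaces.linear_iff)

lemma apd_mult: "S (a * b) = S b * S a"
  using quasi_hopf unfolding is_quasi_hopf_def by auto

lemma apd_1 [simp]: "S 1 = 1"
  using quasi_hopf unfolding is_quasi_hopf_def by auto

lemma apd_lin [simp]: "S (a + b) = S a + S b" "S (scal H c a) = scal H c (S a)"
  using endo_apd by (auto simp: endo_def)

lemma functional_cou: "functional \<epsilon>"
  using quasi_bialgebra unfolding is_quasi_bialgebra_def functional_def
  by (auto simp: Vector_Spaces.linear_iff)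

lemma cou_lin [simp]: "\<epsilon> (a + b) = \<epsilon> a + \<epsilon> b" "\<epsilon> (scal H c a) = c * \<epsilon> a"
  using functional_cou by (auto simp: functional_def)

lemma cou_mult [simp]: "\<epsilon> (a * b) = \<epsilon> a * \<epsilon> b" and cou_1 [simp]: "\<epsilon> 1 = 1"
  using quasi_bialgebra unfolding is_quasi_bialgebra_def by auto

text \<open>The value of a multilinear functional \<open>T\<close> at a tensor: for \<open>s = s\<^sub>1 \<otimes> s\<^sub>2\<close> the scalar
  \<open>eval2 s T\<close> is \<open>T s\<^sub>1 s\<^sub>2\<close> in Sweedler notation. Nested evaluations express
  products of tensors and iterated coproducts.\<close>

definition eval2 :: "('h \<times> 'h \<Rightarrow> 'k) \<Rightarrow> ('h \<Rightarrow> 'h \<Rightarrow> 'k) \<Rightarrow> 'k" where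
  "eval2 s T = (\<Sum>p\<in>B2 H. s p * T (fst p) (snd p))"

definition eval3 :: "('h \<times> 'h \<times> 'h \<Rightarrow> 'k) \<Rightarrow> ('h \<Rightarrow> 'h \<Rightarrow> 'h \<Rightarrow> 'k) \<Rightarrow> 'k" where
  "eval3 s T = (\<Sum>p\<in>B3 H. s p * T (fst p) (fst (snd p)) (snd (snd p)))"

definition eval4 :: "('h \<times> 'h \<times> 'h \<times> 'h \<Rightarrow> 'k) \<Rightarrow> ('h \<Rightarrow> 'h \<Rightarrow> 'h \<Rightarrow> 'h \<Rightarrow> 'k) \<Rightarrow> 'k" where
  "eval4 s T = (\<Sum>p\<in>B4 H. s p * T (fst p) (fst (snd p)) (fst (snd (snd p))) (snd (snd (snd p))))"

text \<open>Multilinearity in two, three and four arguments.\<close>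

definition bilin :: "('h \<Rightarrow> 'h \<Rightarrow> 'k) \<Rightarrow> bool" where
  "bilin T \<longleftrightarrow> (\<forall>b. functional (\<lambda>a. T a b)) \<and> (\<forall>a. functional (\<lambda>b. T a b))"

definition trilin :: "('h \<Rightarrow> 'h \<Rightarrow> 'h \<Rightarrow> 'k) \<Rightarrow> bool" where
  "trilin T \<longleftrightarrow> (\<forall>b c. functional (\<lambda>a. T a b c)) \<and> (\<forall>a c. functional (\<lambda>b. T a b c))
     \<and> (\<forall>a b. functional (\<lambda>c. T a b c))"

definition quadlin :: "('h \<Rightarrow> 'h \<Rightarrow> 'h \<Rightarrow> 'h \<Rightarrow> 'k) \<Rightarrow> bool" where
  "quadlin T \<longleftrightarrow> (\<forall>b c d. functional (\<lambda>a. T a b c d)) \<and> (\<forall>a c d. functional (\<lambda>b. T a b c d))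
     \<and> (\<forall>a b d. functional (\<lambda>c. T a b c d)) \<and> (\<forall>a b c. functional (\<lambda>d. T a b c d))"

lemma functionalD:
  assumes "functional \<phi>"
  shows "\<phi> (x + y) = \<phi> x + \<phi> y" "\<phi> (scal H k x) = k * \<phi> x"
  using assms by (auto simp: functional_def)

lemma bilinD:
  assumes "bilin B"
  shows "B (a + a') b = B a b + B a' b" "B a (b + b') = B a b + B a b'"
     "B (scal H k a) b = k * B a b" "B a (scal H k b) = k * B a b"
  using assms by (auto simp: bilin_def functional_def)

lemma trilinD:
  assumes "trilin T"
  shows "T (a + a') b c = T a b c + T a' b c" "T a (b + b') c = T a b c + T a b' c"
     "T a b (c + c') = T a b c + T a b c'"
     "T (scal H k a) b c = k * T a b c" "T a (scal H k b) c = k * T a b c"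
     "T a b (scal H k c) = k * T a b c"
  using assms by (auto simp: trilin_def functional_def)

lemma quadlinD:
  assumes "quadlin T"
  shows "T (a + a') b c d = T a b c d + T a' b c d" "T a (b + b') c d = T a b c d + T a b' c d"
     "T a b (c + c') d = T a b c d + T a b c' d" "T a b c (d + d') = T a b c d + T a b c d'"
     "T (scal H k a) b c d = k * T a b c d" "T a (scal H k b) c d = k * T a b c d"
     "T a b (scal H k c) d = k * T a b c d" "T a b c (scal H k d) = k * T a b c d"
  using assms by (auto simp: quadlin_def functional_def)

lemma eval2_scale: "eval2 s (\<lambda>a b. c * T a b) = c * eval2 s T"
  and eval3_scale: "eval3 t (\<lambda>a b d. c * U a b d) = c * eval3 t U"
  by (simp_all add: eval2_def eval3_def sum_distrib_left mult.left_commute)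

lemma eval2_swap: "eval2 s (\<lambda>a b. eval2 t (\<lambda>a' b'. T a b a' b')) = eval2 t (\<lambda>a' b'. eval2 s (\<lambda>a b. T a b a' b'))"
  unfolding eval2_def sum_distrib_left
  by (subst sum.swap) (simp add: mult.left_commute)

lemma eval3_swap: "eval3 s (\<lambda>a b c. eval3 t (\<lambda>a' b' c'. T a b c a' b' c')) = eval3 t (\<lambda>a' b' c'. eval3 s (\<lambda>a b c. T a b c a' b' c'))"
  unfolding eval3_def sum_distrib_left
  by (subst sum.swap) (simp add: mult.left_commute)

lemma eval32_swap: "eval3 s (\<lambda>a b c. eval2 t (\<lambda>a' b'. T a b c a' b')) = eval2 t (\<lambda>a' b'. eval3 s (\<lambda>a b c. T a b c a' b'))"
  unfolding eval2_def eval3_def sum_distrib_left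
  by (subst sum.swap) (simp add: mult.left_commute)

lemma functional_eval2: "(\<And>a b. functional (\<lambda>x. T x a b)) \<Longrightarrow> functional (\<lambda>x. eval2 s (\<lambda>a b. T x a b))"
  by (auto simp: functional_def eval2_def algebra_simps sum.distrib sum_distrib_left)

lemma functional_eval3: "(\<And>a b c. functional (\<lambda>x. T x a b c)) \<Longrightarrow> functional (\<lambda>x. eval3 s (\<lambda>a b c. T x a b c))"
  by (auto simp: functional_def eval3_def algebra_simps sum.distrib sum_distrib_left)

lemma functional_scale: "functional \<phi> \<Longrightarrow> functional (\<lambda>x. c * \<phi> x)"
  and functional_scale': "functional \<phi> \<Longrightarrow> functional (\<lambda>x. \<phi> x * c)"
  by (auto simp: functional_def algebra_simps)

lemma cop_add: "\<Delta> (a + b) = \<Delta> a + \<Delta> b" and cop_scal: "\<Delta> (scal H c a) = fscale c (\<Delta> a)"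
  using quasi_bialgebra unfolding is_quasi_bialgebra_def
  by (auto simp: Vector_Spaces.linear_iff)

lemma functional_eval2_cop: "endo f \<Longrightarrow> functional (\<lambda>x. eval2 (\<Delta> (f x)) T)"
  by (auto simp: functional_def endo_def cop_add cop_scal eval2_def fscale_def algebra_simps
      sum.distrib sum_distrib_left)

lemma functional_cou_endo: "endo f \<Longrightarrow> functional (\<lambda>x. \<epsilon> (f x))"
  by (auto simp: functional_def endo_def)

text \<open>Linearity of nested evaluations: the introduction rules strip the evaluations, and the
  rewrite rules decide what remains.\<close>

lemmas functional_intros = functional_eval2 functional_eval3 functional_scale functional_scale'
  functional_eval2_cop functional_cou_endo functional_coord functional_cou

lemmas functional_simps = functional_def endo_def distrib_left distrib_right

lemma sum_struc: "functional \<phi> \<Longrightarrow> (\<Sum>z\<in>bas H. struc H x y z * \<phi> z) = \<phi> (x * y)"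
  unfolding struc_def by (subst functional_expand [of \<phi> "x * y"]) auto

text \<open>Componentwise products of tensors become nested evaluations.\<close>

lemma eval2_mult2:
  assumes "bilin T"
  shows "eval2 (mult2 H s t) T = eval2 s (\<lambda>a b. eval2 t (\<lambda>a' b'. T (a * a') (b * b')))"
proof -
  have *: "(\<Sum>z\<in>B2 H. struc_tensor (struc H) (struc H) x y z * T (fst z) (snd z)) =
      T (fst x * fst y) (snd x * snd y)" for x y
    using assms by (simp add: sum_struc_tensor sum_struc bilin_def)
  show ?thesis
    unfolding eval2_def mult2_def by (simp add: struc_mult_eval *)
qed

lemma eval3_mult3:
  assumes "trilin T"
  shows "eval3 (mult3 H s t) T = eval3 s (\<lambda>a b c. eval3 t (\<lambda>a' b' c'. T (a * a') (b * b') (c * c')))"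
proof -
  have *: "(\<Sum>z\<in>B3 H. struc_tensor (struc H) (struc_tensor (struc H) (struc H)) x y z * T (fst z) (fst (snd z)) (snd (snd z))) =
      T (fst x * fst y) (fst (snd x) * fst (snd y)) (snd (snd x) * snd (snd y))" for x y
    using assms
    by (subst sum_struc_tensor [where T = "\<lambda>z w. T z (fst w) (snd w)"])
      (simp add: sum_struc_tensor [where T = "T z" for z] sum_struc trilin_def)
  show ?thesis
    unfolding eval3_def mult3_def by (simp add: struc_mult_eval *)
qed

lemma eval4_mult4:
  assumes "quadlin T"
  shows "eval4 (mult4 H s t) T =
    eval4 s (\<lambda>a b c d. eval4 t (\<lambda>a' b' c' d'. T (a * a') (b * b') (c * c') (d * d')))"
proof -
  have *: "(\<Sum>z\<in>B4 H. struc_tensor (struc H) (struc_tensor (struc H) (struc_tensor (struc H) (struc H))) x y z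
        * T (fst z) (fst (snd z)) (fst (snd (snd z))) (snd (snd (snd z)))) =
      T (fst x * fst y) (fst (snd x) * fst (snd y)) (fst (snd (snd x)) * fst (snd (snd y)))
        (snd (snd (snd x)) * snd (snd (snd y)))" for x y
    using assms
    by (subst sum_struc_tensor [where T = "\<lambda>z w. T z (fst w) (fst (snd w)) (snd (snd w))"])
      (simp add: sum_struc_tensor [where T = "\<lambda>w v. T z w (fst v) (snd v)" for z]
        sum_struc_tensor [where T = "T z w" for z w] sum_struc quadlin_def)
  show ?thesis
    unfolding eval4_def mult4_def by (simp add: struc_mult_eval *)
qed

lemma eval2_one2: "bilin T \<Longrightarrow> eval2 (one2 H) T = T 1 1"
  unfolding bilin_def eval2_def one2_def
  apply (subst functional_expand [of "\<lambda>a. T a 1" 1], simp)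
  apply (subst functional_expand [of "\<lambda>b. T a b" 1 for a], simp)
  by (simp add: sum.cartesian_product sum_distrib_left split_def mult.assoc)

lemma eval3_one3: "trilin T \<Longrightarrow> eval3 (one3 H) T = T 1 1 1"
  unfolding trilin_def eval3_def one3_def
  apply (subst functional_expand [of "\<lambda>a. T a 1 1" 1], simp)
  apply (subst functional_expand [of "\<lambda>b. T a b 1" 1 for a], simp)
  apply (subst functional_expand [of "\<lambda>c. T a b c" 1 for a b], simp)
  by (simp add: sum.cartesian_product sum_distrib_left split_def mult.assoc)

lemma eval3_cop_id: "eval3 (cop_id H s) T = eval2 s (\<lambda>u c. eval2 (\<Delta> u) (\<lambda>a b. T a b c))"
proof -
  have "eval3 (cop_id H s) T = (\<Sum>((a, b, c), u)\<in>B3 H \<times> bas H. s (u, c) * (\<Delta> u (a, b) * T a b c))"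
    unfolding eval3_def cop_id_def sum.cartesian_product [symmetric]
    by (simp add: split_def sum_distrib_right mult.assoc)
  also have "\<dots> = (\<Sum>((u, c), (a, b))\<in>B2 H \<times> B2 H. s (u, c) * (\<Delta> u (a, b) * T a b c))"
    by (rule sum.reindex_bij_witness [where i = "\<lambda>((u, c), (a, b)). ((a, b, c), u)"
          and j = "\<lambda>((a, b, c), u). ((u, c), (a, b))"]) auto
  also have "\<dots> = eval2 s (\<lambda>u c. eval2 (\<Delta> u) (\<lambda>a b. T a b c))"
    unfolding eval2_def sum_distrib_left sum.cartesian_product by (simp add: split_def)
  finally show ?thesis .
qed

lemma eval3_id_cop: "eval3 (id_cop H s) T = eval2 s (\<lambda>a u. eval2 (\<Delta> u) (\<lambda>b c. T a b c))"
proof -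
  have "eval3 (id_cop H s) T = (\<Sum>((a, b, c), u)\<in>B3 H \<times> bas H. s (a, u) * (\<Delta> u (b, c) * T a b c))"
    unfolding eval3_def id_cop_def sum.cartesian_product [symmetric]
    by (simp add: split_def sum_distrib_right mult.assoc)
  also have "\<dots> = (\<Sum>((a, u), (b, c))\<in>B2 H \<times> B2 H. s (a, u) * (\<Delta> u (b, c) * T a b c))"
    by (rule sum.reindex_bij_witness [where i = "\<lambda>((a, u), (b, c)). ((a, b, c), u)"
          and j = "\<lambda>((a, b, c), u). ((a, u), (b, c))"]) auto
  also have "\<dots> = eval2 s (\<lambda>a u. eval2 (\<Delta> u) (\<lambda>b c. T a b c))"
    unfolding eval2_def sum_distrib_left sum.cartesian_product by (simp add: split_def)
  finally show ?thesis .
qed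

lemma functional_sweedler2:
  assumes "functional \<phi>"
  shows "\<phi> (sweedler2 H t F) = eval2 t (\<lambda>a b. \<phi> (F a b))"
  unfolding sweedler2_def eval2_def functional_sum [OF assms] split_def
  using assms by (simp add: functional_def)

lemma functional_sweedler3:
  assumes "functional \<phi>"
  shows "\<phi> (sweedler3 H t F) = eval3 t (\<lambda>a b c. \<phi> (F a b c))"
  unfolding sweedler3_def eval3_def functional_sum [OF assms] split_def
  using assms by (simp add: functional_def)

section \<open>The quasi-Hopf identities in evaluated form\<close>

lemma cop_mult: "\<Delta> (a * b) = mult2 H (\<Delta> a) (\<Delta> b)" and cop_1: "\<Delta> 1 = one2 H"
  and coas_inverse: "mult3 H \<Phi> \<Psi> = one3 H" "mult3 H \<Psi> \<Phi> = one3 H"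
  using quasi_bialgebra unfolding is_quasi_bialgebra_def by blast+

lemma eval2_cop_mult:
  "bilin T \<Longrightarrow> eval2 (\<Delta> (a * b)) T = eval2 (\<Delta> a) (\<lambda>x y. eval2 (\<Delta> b) (\<lambda>x' y'. T (x * x') (y * y')))"
  by (simp add: cop_mult eval2_mult2)

lemma eval2_cop_1: "bilin T \<Longrightarrow> eval2 (\<Delta> 1) T = T 1 1"
  by (simp add: cop_1 eval2_one2)

lemma eval2_counit_left:
  assumes "functional \<phi>" shows "eval2 (\<Delta> h) (\<lambda>a b. \<epsilon> a * \<phi> b) = \<phi> h"
proof -
  have "sweedler2 H (\<Delta> h) (\<lambda>a b. scal H (\<epsilon> a) b) = h"
    using quasi_bialgebra unfolding is_quasi_bialgebra_def by blast
  from arg_cong [OF this, of \<phi>] show ?thesis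
    unfolding functional_sweedler2 [OF assms] using assms by (simp add: functional_def)
qed

lemma eval2_counit_right:
  assumes "functional \<phi>" shows "eval2 (\<Delta> h) (\<lambda>a b. \<epsilon> b * \<phi> a) = \<phi> h"
proof -
  have "sweedler2 H (\<Delta> h) (\<lambda>a b. scal H (\<epsilon> b) a) = h"
    using quasi_bialgebra unfolding is_quasi_bialgebra_def by blast
  from arg_cong [OF this, of \<phi>] show ?thesis
    unfolding functional_sweedler2 [OF assms] using assms by (simp add: functional_def)
qed

lemma eval2_alpha:
  assumes "functional \<phi>" shows "eval2 (\<Delta> h) (\<lambda>a b. \<phi> (S a * \<alpha> * b)) = \<epsilon> h * \<phi> \<alpha>"
proof -
  have "sweedler2 H (\<Delta> h) (\<lambda>a b. S a * \<alpha> * b) = scal H (\<epsilon> h) \<alpha>"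
    using quasi_hopf unfolding is_quasi_hopf_def by blast
  from arg_cong [OF this, of \<phi>] show ?thesis
    unfolding functional_sweedler2 [OF assms] using assms by (simp add: functional_def)
qed

lemma eval2_beta:
  assumes "functional \<phi>" shows "eval2 (\<Delta> h) (\<lambda>a b. \<phi> (a * \<beta> * S b)) = \<epsilon> h * \<phi> \<beta>"
proof -
  have "sweedler2 H (\<Delta> h) (\<lambda>a b. a * \<beta> * S b) = scal H (\<epsilon> h) \<beta>"
    using quasi_hopf unfolding is_quasi_hopf_def by blast
  from arg_cong [OF this, of \<phi>] show ?thesis
    unfolding functional_sweedler2 [OF assms] using assms by (simp add: functional_def)
qed

lemma eval3_zigzag:
  assumes "functional \<phi>" shows "eval3 \<Phi> (\<lambda>a b c. \<phi> (S a * \<alpha> * b * \<beta> * S c)) = \<phi> 1"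
proof -
  have "sweedler3 H \<Phi> (\<lambda>a b c. S a * \<alpha> * b * \<beta> * S c) = 1"
    using quasi_hopf unfolding is_quasi_hopf_def by blast
  from arg_cong [OF this, of \<phi>] show ?thesis
    unfolding functional_sweedler3 [OF assms] .
qed

lemma coas_cancel:
  assumes "trilin T"
  shows "eval3 \<Phi> (\<lambda>a b c. eval3 \<Psi> (\<lambda>a' b' c'. T (a * a') (b * b') (c * c'))) = T 1 1 1"
  using arg_cong [OF coas_inverse(1), of "\<lambda>s. eval3 s T"]
  unfolding eval3_mult3 [OF assms] eval3_one3 [OF assms] .

lemma coas_cancel':
  assumes "trilin T"
  shows "eval3 \<Psi> (\<lambda>a b c. eval3 \<Phi> (\<lambda>a' b' c'. T (a * a') (b * b') (c * c'))) = T 1 1 1"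
  using arg_cong [OF coas_inverse(2), of "\<lambda>s. eval3 s T"]
  unfolding eval3_mult3 [OF assms] eval3_one3 [OF assms] .

lemma quasi_coassoc:
  assumes "trilin T"
  shows "eval2 (\<Delta> h) (\<lambda>u c. eval2 (\<Delta> u) (\<lambda>a b. eval3 \<Phi> (\<lambda>a' b' c'. T (a * a') (b * b') (c * c')))) =
    eval3 \<Phi> (\<lambda>a b c. eval2 (\<Delta> h) (\<lambda>a' u. eval2 (\<Delta> u) (\<lambda>b' c'. T (a * a') (b * b') (c * c'))))"
proof -
  have "mult3 H (cop_id H (\<Delta> h)) \<Phi> = mult3 H \<Phi> (id_cop H (\<Delta> h))"
    using quasi_bialgebra unfolding is_quasi_bialgebra_def by blast
  from arg_cong [OF this, of "\<lambda>s. eval3 s T"] show ?thesis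
    unfolding eval3_mult3 [OF assms] eval3_cop_id eval3_id_cop .
qed

text \<open>Quasi-coassociativity for the inverse coassociator, obtained by multiplying
  \<open>quasi_coassoc\<close> with \<open>\<Psi>\<close> from both sides.\<close>

lemma quasi_coassoc':
  assumes T: "trilin T"
  shows "eval3 \<Psi> (\<lambda>a b c. eval2 (\<Delta> h) (\<lambda>u c'. eval2 (\<Delta> u) (\<lambda>a' b'. T (a * a') (b * b') (c * c')))) =
    eval2 (\<Delta> h) (\<lambda>a u. eval2 (\<Delta> u) (\<lambda>b c. eval3 \<Psi> (\<lambda>a' b' c'. T (a * a') (b * b') (c * c'))))"
    (is "?L = ?R")
proof -
  note add = trilinD [OF T]
  have 1: "trilin (\<lambda>a' b' c'. T (a * a') (b * b') (c * c'))" for a b c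
    by (simp add: trilin_def functional_simps add)
  have "?L = eval3 \<Psi> (\<lambda>a b c. eval2 (\<Delta> h) (\<lambda>u c'. eval2 (\<Delta> u) (\<lambda>a' b'.
         eval3 \<Phi> (\<lambda>p q r. eval3 \<Psi> (\<lambda>l m n.  T (a * (a' * (p * l))) (b * (b' * (q * m))) (c * (c' * (r * n))))))))"
  proof -
    have "eval3 \<Phi> (\<lambda>p q r. eval3 \<Psi> (\<lambda>l m n. T (a * (a' * (p * l))) (b * (b' * (q * m))) (c * (c' * (r * n)))))
      = T (a * a') (b * b') (c * c')" for a b c a' b' c'
      using coas_cancel [OF 1 [of "a * a'" "b * b'" "c * c'"]] by (simp add: mult.assoc)
    then show ?thesis by simp
  qed
  also have "\<dots> = eval3 \<Psi> (\<lambda>a b c. eval3 \<Phi> (\<lambda>p q r. eval2 (\<Delta> h) (\<lambda>a' u. eval2 (\<Delta> u) (\<lambda>b' c'.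
        eval3 \<Psi> (\<lambda>l m n.  T (a * (p * (a' * l))) (b * (q * (b' * m))) (c * (r * (c' * n))))))))"
  proof -
    have 5: "trilin (\<lambda>x y z. eval3 \<Psi> (\<lambda>l m n. T (a * (x * l)) (b * (y * m)) (c * (z * n))))" for a b c
      unfolding trilin_def
      by (intro conjI allI functional_intros; simp add: functional_simps add)
    show ?thesis
      using quasi_coassoc [OF 5] by (simp add: mult.assoc)
  qed
  also have "\<dots> = ?R"
  proof -
    have 5: "trilin (\<lambda>x y z. eval2 (\<Delta> h) (\<lambda>a' u. eval2 (\<Delta> u) (\<lambda>b' c'.
        eval3 \<Psi> (\<lambda>l m n.  T (x * (a' * l)) (y * (b' * m)) (z * (c' * n))))))"
      unfolding trilin_def
      by (intro conjI allI functional_intros; simp add: functional_simps add)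
    show ?thesis
      using coas_cancel' [OF 5] by (simp add: mult.assoc)
  qed
  finally show ?thesis .
qed

section \<open>The pentagon and the counits of the coassociator\<close>

text \<open>The five factors of the pentagon, evaluated on a functional of four arguments.\<close>

lemma eval4_first: "eval4 (\<lambda>(x, y, z, w). \<Sum>u\<in>bas H. s (u, z, w) * \<Delta> u (x, y)) T =
    eval3 s (\<lambda>u z w. eval2 (\<Delta> u) (\<lambda>x y. T x y z w))"
proof -
  have "eval4 (\<lambda>(x, y, z, w). \<Sum>u\<in>bas H. s (u, z, w) * \<Delta> u (x, y)) T =
      (\<Sum>((x, y, z, w), u)\<in>B4 H \<times> bas H. s (u, z, w) * (\<Delta> u (x, y) * T x y z w))"
    unfolding eval4_def sum.cartesian_product [symmetric]
    by (simp add: split_def sum_distrib_right mult.assoc)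
  also have "\<dots> = (\<Sum>((u, z, w), x, y)\<in>B3 H \<times> B2 H. s (u, z, w) * (\<Delta> u (x, y) * T x y z w))"
    by (rule sum.reindex_bij_witness [where i = "\<lambda>((u, z, w), x, y). ((x, y, z, w), u)"
          and j = "\<lambda>((x, y, z, w), u). ((u, z, w), x, y)"]) auto
  also have "\<dots> = eval3 s (\<lambda>u z w. eval2 (\<Delta> u) (\<lambda>x y. T x y z w))"
    unfolding eval3_def eval2_def sum_distrib_left sum.cartesian_product
    by (simp add: split_def)
  finally show ?thesis .
qed

lemma eval4_middle: "eval4 (\<lambda>(x, y, z, w). \<Sum>u\<in>bas H. s (x, u, w) * \<Delta> u (y, z)) T =
    eval3 s (\<lambda>x u w. eval2 (\<Delta> u) (\<lambda>y z. T x y z w))"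
proof -
  have "eval4 (\<lambda>(x, y, z, w). \<Sum>u\<in>bas H. s (x, u, w) * \<Delta> u (y, z)) T =
      (\<Sum>((x, y, z, w), u)\<in>B4 H \<times> bas H. s (x, u, w) * (\<Delta> u (y, z) * T x y z w))"
    unfolding eval4_def sum.cartesian_product [symmetric]
    by (simp add: split_def sum_distrib_right mult.assoc)
  also have "\<dots> = (\<Sum>((x, u, w), y, z)\<in>B3 H \<times> B2 H. s (x, u, w) * (\<Delta> u (y, z) * T x y z w))"
    by (rule sum.reindex_bij_witness [where i = "\<lambda>((x, u, w), y, z). ((x, y, z, w), u)"
          and j = "\<lambda>((x, y, z, w), u). ((x, u, w), y, z)"]) auto
  also have "\<dots> = eval3 s (\<lambda>x u w. eval2 (\<Delta> u) (\<lambda>y z. T x y z w))"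
    unfolding eval3_def eval2_def sum_distrib_left sum.cartesian_product
    by (simp add: split_def)
  finally show ?thesis .
qed

lemma eval4_last: "eval4 (\<lambda>(x, y, z, w). \<Sum>u\<in>bas H. s (x, y, u) * \<Delta> u (z, w)) T =
    eval3 s (\<lambda>x y u. eval2 (\<Delta> u) (\<lambda>z w. T x y z w))"
proof -
  have "eval4 (\<lambda>(x, y, z, w). \<Sum>u\<in>bas H. s (x, y, u) * \<Delta> u (z, w)) T =
      (\<Sum>((x, y, z, w), u)\<in>B4 H \<times> bas H. s (x, y, u) * (\<Delta> u (z, w) * T x y z w))"
    unfolding eval4_def sum.cartesian_product [symmetric]
    by (simp add: split_def sum_distrib_right mult.assoc)
  also have "\<dots> = (\<Sum>((x, y, u), z, w)\<in>B3 H \<times> B2 H. s (x, y, u) * (\<Delta> u (z, w) * T x y z w))"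
    by (rule sum.reindex_bij_witness [where i = "\<lambda>((x, y, u), z, w). ((x, y, z, w), u)"
          and j = "\<lambda>((x, y, z, w), u). ((x, y, u), z, w)"]) auto
  also have "\<dots> = eval3 s (\<lambda>x y u. eval2 (\<Delta> u) (\<lambda>z w. T x y z w))"
    unfolding eval3_def eval2_def sum_distrib_left sum.cartesian_product
    by (simp add: split_def)
  finally show ?thesis .
qed

lemma eval4_one_right:
  assumes "\<And>x y z. functional (\<lambda>w. T x y z w)"
  shows "eval4 (\<lambda>(x, y, z, w). s (x, y, z) * coord H 1 w) T = eval3 s (\<lambda>x y z. T x y z 1)"
proof -
  have "eval4 (\<lambda>(x, y, z, w). s (x, y, z) * coord H 1 w) T =
      (\<Sum>((x, y, z), w)\<in>B3 H \<times> bas H. s (x, y, z) * (coord H 1 w * T x y z w))"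
    unfolding eval4_def
    by (rule sum.reindex_bij_witness [where i = "\<lambda>((x, y, z), w). (x, y, z, w)"
          and j = "\<lambda>(x, y, z, w). ((x, y, z), w)"]) (auto simp: mult.assoc)
  also have "\<dots> = eval3 s (\<lambda>x y z. T x y z 1)"
    unfolding eval3_def functional_expand [OF assms, of _ _ _ 1] sum_distrib_left sum.cartesian_product
    by (simp add: split_def)
  finally show ?thesis .
qed

lemma eval4_one_left:
  assumes "\<And>y z w. functional (\<lambda>x. T x y z w)"
  shows "eval4 (\<lambda>(x, y, z, w). coord H 1 x * s (y, z, w)) T = eval3 s (\<lambda>y z w. T 1 y z w)"
proof -
  have "eval4 (\<lambda>(x, y, z, w). coord H 1 x * s (y, z, w)) T =
      (\<Sum>((y, z, w), x)\<in>B3 H \<times> bas H. s (y, z, w) * (coord H 1 x * T x y z w))"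
    unfolding eval4_def
    by (rule sum.reindex_bij_witness [where i = "\<lambda>((y, z, w), x). (x, y, z, w)"
          and j = "\<lambda>(x, y, z, w). ((y, z, w), x)"]) (auto simp: ac_simps)
  also have "\<dots> = eval3 s (\<lambda>y z w. T 1 y z w)"
    unfolding eval3_def functional_expand [OF assms, of 1] sum_distrib_left sum.cartesian_product
    by (simp add: split_def)
  finally show ?thesis .
qed

lemma pentagon:
  assumes T: "quadlin T"
  shows "eval3 \<Phi> (\<lambda>u z w. eval2 (\<Delta> u) (\<lambda>x y. eval3 \<Phi> (\<lambda>x' y' u'. eval2 (\<Delta> u') (\<lambda>z' w'.
      T (x * x') (y * y') (z * z') (w * w'))))) =
    eval3 \<Phi> (\<lambda>x y z. eval3 \<Phi> (\<lambda>x' u w'. eval2 (\<Delta> u) (\<lambda>y' z'. eval3 \<Phi> (\<lambda>y'' z'' w''.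
      T (x * x') (y * (y' * y'')) (z * (z' * z'')) (w' * w'')))))"
    (is "?L = ?R")
proof -
  note add = quadlinD [OF T]
  have q: "quadlin (\<lambda>a' b' c' d'. T (a * a') (b * b') (c * c') (d * d'))" for a b c d
    by (simp add: quadlin_def functional_simps add)
  have "mult4 H (\<lambda>(x, y, z, w). \<Sum>u\<in>bas H. \<Phi> (u, z, w) * \<Delta> u (x, y))
             (\<lambda>(x, y, z, w). \<Sum>u\<in>bas H. \<Phi> (x, y, u) * \<Delta> u (z, w)) =
     mult4 H (\<lambda>(x, y, z, w). \<Phi> (x, y, z) * coord H 1 w)
       (mult4 H (\<lambda>(x, y, z, w). \<Sum>u\<in>bas H. \<Phi> (x, u, w) * \<Delta> u (y, z))
                (\<lambda>(x, y, z, w). coord H 1 x * \<Phi> (y, z, w)))"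
    using quasi_bialgebra unfolding is_quasi_bialgebra_def by blast
  from arg_cong [OF this, of "\<lambda>s. eval4 s T"] show ?thesis
    unfolding eval4_mult4 [OF T] eval4_mult4 [OF q] eval4_first eval4_middle eval4_last
    apply (subst (asm) eval4_one_left)
     apply (simp add: functional_simps add)
    apply (subst (asm) eval4_one_right)
     apply (intro functional_intros; simp add: functional_simps add)
    by simp
qed

lemma coas_counit_middle:
  assumes T: "bilin T"
  shows "eval3 \<Phi> (\<lambda>a b c. \<epsilon> b * T a c) = T 1 1"
proof -
  have eq: "(\<lambda>(x, z). \<Sum>u\<in>bas H. \<Phi> (x, u, z) * \<epsilon> u) = one2 H"
    using quasi_bialgebra unfolding is_quasi_bialgebra_def by blast
  have "eval3 \<Phi> (\<lambda>a b c. \<epsilon> b * T a c) =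
      (\<Sum>((a, c), b)\<in>B2 H \<times> bas H. \<Phi> (a, b, c) * \<epsilon> b * T a c)"
    unfolding eval3_def
    by (rule sum.reindex_bij_witness [where i = "\<lambda>((a, c), b). (a, b, c)"
          and j = "\<lambda>(a, b, c). ((a, c), b)"]) auto
  also have "\<dots> = eval2 (\<lambda>(x, z). \<Sum>u\<in>bas H. \<Phi> (x, u, z) * \<epsilon> u) T"
    unfolding eval2_def sum.cartesian_product [symmetric]
    by (simp add: split_def sum_distrib_right)
  finally show ?thesis
    unfolding eq eval2_one2 [OF T] .
qed

text \<open>The remaining two counit properties of the coassociator follow from the one for the middle
  factor. Applying \<open>\<epsilon>\<close> to the third factor of the pentagon yields
  \<open>\<Phi> = ((id \<otimes> id \<otimes> \<epsilon>)(\<Phi>) \<otimes> 1) \<Phi>\<close>, and \<open>\<Phi>\<close> is cancelled from the right.\<close>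

lemma coas_counit_right:
  assumes B: "bilin B"
  shows "eval3 \<Phi> (\<lambda>a b c. \<epsilon> c * B a b) = B 1 1"
proof -
  note add = bilinD [OF B]
  \<comment> \<open>The factor \<open>\<Psi>\<close> on the right cancels \<open>\<Phi>\<close>.\<close>
  define T where "T = (\<lambda>a b d. eval3 \<Psi> (\<lambda>a' b' d'. \<epsilon> (d * d') * B (a * a') (b * b')))"
  have T: "trilin T"
    unfolding T_def trilin_def
    by (intro conjI allI functional_intros; simp add: functional_simps add)
  note addT = trilinD [OF T]
  have TB: "trilin (\<lambda>a b c. \<epsilon> c * B (x * a) (y * b))" for x y
    unfolding trilin_def
    by (intro conjI allI functional_intros; simp add: functional_simps add)
  have Q: "quadlin (\<lambda>a b c d. \<epsilon> c * T a b d)"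
    unfolding quadlin_def
    by (intro conjI allI functional_intros; simp add: functional_simps addT)
  have 1: "eval3 \<Phi> (\<lambda>a b c. T (x * a) (y * b) (z * c)) = \<epsilon> z * B x y" for x y z
    using coas_cancel [OF TB, of x y] unfolding T_def
    by (simp add: mult.assoc eval3_scale)
  have i1: "eval2 (\<Delta> u) (\<lambda>c d. \<epsilon> (z * c) * T p q (w * d)) = \<epsilon> z * T p q (w * u)" for u z p q w
  proof -
    have "functional (\<lambda>d. \<epsilon> z * T p q (w * d))"
      by (simp add: functional_simps addT)
    from eval2_counit_left [OF this, of u] show ?thesis by (simp add: mult_ac)
  qed
  have i2: "eval3 \<Phi> (\<lambda>u z w. eval2 (\<Delta> u) (\<lambda>x y. \<epsilon> z * (\<epsilon> w * B x y))) = B 1 1"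
  proof -
    have "bilin (\<lambda>u w. \<epsilon> w * eval2 (\<Delta> u) B)"
      unfolding bilin_def by (intro conjI allI functional_intros; simp add: functional_simps)
    from coas_counit_middle [OF this] show ?thesis
      by (simp add: eval2_scale eval2_cop_1 [OF B])
  qed
  have i3: "eval3 \<Phi> (\<lambda>b c d. \<epsilon> (z * (z' * c)) * T p (y * (y' * b)) (w * d)) = \<epsilon> z * \<epsilon> z' * T p (y * y') w"
    for z z' p y y' w
  proof -
    have "bilin (\<lambda>b d. \<epsilon> z * \<epsilon> z' * T p (y * (y' * b)) (w * d))"
      by (simp add: bilin_def functional_simps addT)
    from coas_counit_middle [OF this] show ?thesis by (simp add: mult_ac)
  qed
  have i4: "eval2 (\<Delta> u) (\<lambda>b c. \<epsilon> z * \<epsilon> c * T p (y * b) w) = \<epsilon> z * T p (y * u) w" for u z p y w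
  proof -
    have "functional (\<lambda>b. \<epsilon> z * T p (y * b) w)"
      by (simp add: functional_simps addT)
    from eval2_counit_right [OF this, of u] show ?thesis by (simp add: mult_ac)
  qed
  from pentagon [OF Q] show ?thesis
    unfolding i1 i3 i4 eval3_scale 1 1 [where z = 1, simplified] i2 by simp
qed

text \<open>Here \<open>\<epsilon>\<close> is applied to the second factor of the pentagon, and \<open>\<Phi>\<close> is cancelled from the
  left.\<close>

lemma coas_counit_left:
  assumes B: "bilin B"
  shows "eval3 \<Phi> (\<lambda>a b c. \<epsilon> a * B b c) = B 1 1"
proof -
  note add = bilinD [OF B]
  \<comment> \<open>The factor \<open>\<Psi>\<close> on the left cancels \<open>\<Phi>\<close>.\<close>
  define T where "T = (\<lambda>a b c. eval3 \<Psi> (\<lambda>a' b' c'. \<epsilon> (a' * a) * B (b' * b) (c' * c)))"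
  have T: "trilin T"
    unfolding T_def trilin_def
    by (intro conjI allI functional_intros; simp add: functional_simps add)
  note addT = trilinD [OF T]
  have TB: "trilin (\<lambda>a b c. \<epsilon> a * B (b * x) (c * y))" for x y
    unfolding trilin_def
    by (intro conjI allI functional_intros; simp add: functional_simps add)
  have Q: "quadlin (\<lambda>a b c d. \<epsilon> b * T a c d)"
    unfolding quadlin_def
    by (intro conjI allI functional_intros; simp add: functional_simps addT)
  have 1: "eval3 \<Phi> (\<lambda>a b c. T a (b * y) (c * z)) = B y z" for y z
    unfolding T_def
    by (subst eval3_swap) (use coas_cancel' [OF TB, of y z] in \<open>simp add: mult.assoc\<close>)
  have i1: "eval3 \<Phi> (\<lambda>x' y' u. eval2 (\<Delta> u) (\<lambda>c d. \<epsilon> (y * y') * T (x * x') (z * c) (w * d))) = \<epsilon> y * T x z w"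
    for x y z w
  proof -
    have "bilin (\<lambda>x' u. \<epsilon> y * eval2 (\<Delta> u) (\<lambda>c d. T (x * x') (z * c) (w * d)))"
      unfolding bilin_def by (intro conjI allI functional_intros; simp add: functional_simps addT)
    note * = coas_counit_middle [OF this]
    have "bilin (\<lambda>c d. T x (z * c) (w * d))"
      by (simp add: bilin_def functional_simps addT)
    from eval2_cop_1 [OF this] * show ?thesis
      by (simp add: mult_ac eval2_scale)
  qed
  have i2: "eval2 (\<Delta> u) (\<lambda>x y. \<epsilon> y * T x z w) = T u z w" for u z w
    by (rule eval2_counit_right) (simp add: functional_simps addT)
  have i3: "eval2 (\<Delta> u) (\<lambda>y' z'. eval3 \<Phi> (\<lambda>y'' z'' w''. \<epsilon> (y * (y' * y'')) * T x (z * (z' * z'')) (w * w''))) =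
     \<epsilon> y * eval3 \<Phi> (\<lambda>y'' z'' w''. \<epsilon> y'' * T x (z * (u * z'')) (w * w''))" for u x y z w
  proof -
    have "functional (\<lambda>u. \<epsilon> y * eval3 \<Phi> (\<lambda>y'' z'' w''. \<epsilon> y'' * T x (z * (u * z'')) (w * w'')))"
      by (intro functional_intros; simp add: functional_simps addT)
    from eval2_counit_left [OF this, of u] show ?thesis
      by (simp add: mult.assoc mult.left_commute flip: eval3_scale)
  qed
  have i4: "eval3 \<Phi> (\<lambda>x y z. \<epsilon> y * eval3 \<Phi> (\<lambda>x' u w. eval3 \<Phi> (\<lambda>y'' z'' w''. \<epsilon> y'' * T (x * x') (z * (u * z'')) (w * w''))))
     = eval3 \<Phi> (\<lambda>y'' z'' w''. \<epsilon> y'' * B z'' w'')"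
  proof -
    have "bilin (\<lambda>x z. eval3 \<Phi> (\<lambda>x' u w. eval3 \<Phi> (\<lambda>y'' z'' w''. \<epsilon> y'' * T (x * x') (z * (u * z'')) (w * w''))))"
      unfolding bilin_def by (intro conjI allI functional_intros; simp add: functional_simps addT)
    from coas_counit_middle [OF this] show ?thesis
      by (subst (asm) (2) eval3_swap) (simp add: eval3_scale 1)
  qed
  from pentagon [OF Q] show ?thesis
    unfolding i1 i2 i3 eval3_scale i4
    using 1 [of 1 1] by simp
qed

section \<open>Invariant elements\<close>

text \<open>The elements \<open>a\<close> with \<open>S(h\<^sub>1) a h\<^sub>2 = \<epsilon>(h) a\<close> for all \<open>h\<close>, that is, those for which
  the evaluation at \<open>a\<close> is a morphism from the coend to the unit object.\<close>

definition coinvariant :: "'h \<Rightarrow> bool" where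
  "coinvariant a \<longleftrightarrow> (\<forall>\<phi> h. functional \<phi> \<longrightarrow> eval2 (\<Delta> h) (\<lambda>x y. \<phi> (S x * a * y)) = \<epsilon> h * \<phi> a)"

text \<open>Surjectivity of the map from \<open>\<alpha>Z\<close> to the morphisms from the coend to the unit object.\<close>

lemma coinvariant_alphaZ:
  assumes a: "coinvariant a"
  shows "a \<in> alphaZ H"
proof -
  \<comment> \<open>The natural endomorphism \<open>X \<rightarrow> (X \<otimes> X\<^sup>\<or>) \<otimes> X \<rightarrow> X \<otimes> (X\<^sup>\<or> \<otimes> X) \<rightarrow> X\<close> made of the coevaluation and
     the pairing \<open>f \<otimes> x \<mapsto> f (a x)\<close> is the action of this element.\<close>
  define z where "z = sweedler3 H \<Psi> (\<lambda>x y w. x * \<beta> * S y * a * w)"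
  have central: "h * z = z * h" for h
  proof (rule functional_separate)
    fix \<phi> :: "'h \<Rightarrow> 'k" assume \<phi>: "functional \<phi>"
    note add = functionalD [OF \<phi>]
    have T: "trilin (\<lambda>x y w. \<phi> (x * \<beta> * S y * a * w))"
      by (simp add: trilin_def functional_simps add)
    have l: "eval2 (\<Delta> u) (\<lambda>b c. eval3 \<Psi> (\<lambda>a' b' c'. \<phi> (x * a' * \<beta> * S (b * b') * a * (c * c'))))
        = \<epsilon> u * eval3 \<Psi> (\<lambda>a' b' c'. \<phi> (x * a' * \<beta> * S b' * a * c'))" for u x
    proof -
      have "functional (\<lambda>v. \<phi> (x * a' * \<beta> * S b' * v * c'))" for a' b' c'
        by (simp add: functional_simps add)
      then have "eval2 (\<Delta> u) (\<lambda>b c. \<phi> (x * a' * \<beta> * S b' * (S b * a * c) * c')) = \<epsilon> u * \<phi> (x * a' * \<beta> * S b' * a * c')" for a' b' c'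
        using a unfolding coinvariant_def by blast
      then show ?thesis
        by (simp add: eval32_swap [symmetric] apd_mult mult.assoc eval3_scale)
    qed
    have r: "eval2 (\<Delta> u) (\<lambda>a' b'. \<phi> (x * a' * \<beta> * S (y * b') * a * (w * c))) = \<epsilon> u * \<phi> (x * \<beta> * S y * a * (w * c))" for u x y w c
    proof -
      have "functional (\<lambda>v. \<phi> (x * v * S y * a * (w * c)))"
        by (simp add: functional_simps add)
      from eval2_beta [OF this, of u] show ?thesis by (simp add: apd_mult mult.assoc)
    qed
    have "\<phi> (h * z) = eval3 \<Psi> (\<lambda>x y w. \<phi> (h * x * \<beta> * S y * a * w))"
      unfolding z_def
      by (subst functional_sweedler3 [where \<phi> = "\<lambda>v. \<phi> (h * v)"])
        (simp_all add: functional_simps add mult.assoc)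
    also have "\<dots> = eval2 (\<Delta> h) (\<lambda>x u. \<epsilon> u * eval3 \<Psi> (\<lambda>a' b' c'. \<phi> (x * a' * \<beta> * S b' * a * c')))"
      by (rule eval2_counit_right [symmetric]) (intro functional_intros; simp add: functional_simps add)
    also have "\<dots> = eval3 \<Psi> (\<lambda>x y w. eval2 (\<Delta> h) (\<lambda>u c. \<epsilon> u * \<phi> (x * \<beta> * S y * a * (w * c))))"
      using quasi_coassoc' [OF T, of h] unfolding l r by simp
    also have "\<dots> = eval3 \<Psi> (\<lambda>x y w. \<phi> (x * \<beta> * S y * a * (w * h)))"
    proof -
      have "eval2 (\<Delta> h) (\<lambda>u c. \<epsilon> u * \<phi> (x * \<beta> * S y * a * (w * c))) = \<phi> (x * \<beta> * S y * a * (w * h))" for x y w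
        by (rule eval2_counit_left) (simp add: functional_simps add)
      then show ?thesis by simp
    qed
    also have "\<dots> = \<phi> (z * h)"
      unfolding z_def
      by (subst functional_sweedler3 [where \<phi> = "\<lambda>v. \<phi> (v * h)"])
        (simp_all add: functional_simps add mult.assoc)
    finally show "\<phi> (h * z) = \<phi> (z * h)" .
  qed
  have "\<alpha> * z = a"
  proof (rule functional_separate)
    fix \<phi> :: "'h \<Rightarrow> 'k" assume \<phi>: "functional \<phi>"
    note add = functionalD [OF \<phi>]
    \<comment> \<open>The pentagon, multiplied with \<open>1 \<otimes> \<Psi>\<close> from the right, is evaluated on \<open>G\<close>. On the left hand
       side the defining property of \<open>\<alpha>\<close> and the invariance of \<open>a\<close> collapse both coproducts, which
       leaves \<open>\<alpha> z\<close>; on the right hand side the defining property of \<open>\<beta>\<close> does, which leaves the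
       zigzag expression times \<open>a\<close>.\<close>
    define G where "G = (\<lambda>x y w u. \<phi> (S x * \<alpha> * y * \<beta> * S w * a * u))"
    define T where "T = (\<lambda>x y z w. eval3 \<Psi> (\<lambda>y1 z1 w1. G x (y * y1) (z * z1) (w * w1)))"
    have addG: "G (x + x') y z w = G x y z w + G x' y z w" "G x (y + y') z w = G x y z w + G x y' z w"
      "G x y (z + z') w = G x y z w + G x y z' w" "G x y z (w + w') = G x y z w + G x y z w'"
      "G (scal H k x) y z w = k * G x y z w" "G x (scal H k y) z w = k * G x y z w"
      "G x y (scal H k z) w = k * G x y z w" "G x y z (scal H k w) = k * G x y z w"
      for x y z w x' y' z' w' k
      by (simp_all add: G_def functional_simps add)
    have T: "quadlin T"
      unfolding T_def quadlin_def
      by (intro conjI allI functional_intros; simp add: functional_simps addG)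
    note addT = quadlinD [OF T]
    have c1: "eval2 (\<Delta> u) (\<lambda>x y. T (x * x') (y * y') z w) = \<epsilon> u * T x' y' z w" for u x' y' z w
    proof -
      have "eval2 (\<Delta> u) (\<lambda>x y. G (x * x') (y * y') z w) = \<epsilon> u * G x' y' z w" for y' z w
      proof -
        have "functional (\<lambda>v. \<phi> (S x' * v * (y' * (\<beta> * (S z * (a * w))))))"
          by (simp add: functional_simps add)
        from eval2_alpha [OF this, of u] show ?thesis by (simp add: G_def apd_mult mult.assoc)
      qed
      then show ?thesis
        unfolding T_def by (simp add: eval32_swap [symmetric] mult.assoc eval3_scale)
    qed
    have c2: "eval2 (\<Delta> u) (\<lambda>x y. eval3 \<Phi> (\<lambda>x' y' u'. eval2 (\<Delta> u') (\<lambda>z' w'. T (x * x') (y * y') (z * z') (w * w')))) =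
      \<epsilon> u * eval3 \<Phi> (\<lambda>x' y' u'. eval2 (\<Delta> u') (\<lambda>z' w'. T x' y' (z * z') (w * w')))" for u z w
      unfolding eval32_swap [symmetric] eval2_swap [of "\<Delta> u"] c1 eval2_scale eval3_scale ..
    have c3: "eval3 \<Phi> (\<lambda>u z w. \<epsilon> u * eval3 \<Phi> (\<lambda>x' y' u'. eval2 (\<Delta> u') (\<lambda>z' w'. T x' y' (z * z') (w * w'))))
      = eval3 \<Phi> (\<lambda>x' y' u'. eval2 (\<Delta> u') (\<lambda>z' w'. T x' y' z' w'))"
    proof -
      have "bilin (\<lambda>z w. eval3 \<Phi> (\<lambda>x' y' u'. eval2 (\<Delta> u') (\<lambda>z' w'. T x' y' (z * z') (w * w'))))"
        unfolding bilin_def by (intro conjI allI functional_intros; simp add: functional_simps addT)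
      from coas_counit_left [OF this] show ?thesis by simp
    qed
    have c4: "eval2 (\<Delta> u) (\<lambda>z w. T x y z w) = \<epsilon> u * \<phi> (S x * \<alpha> * y * z)" for u x y
    proof -
      have "eval2 (\<Delta> u) (\<lambda>z w. G x y1 (z * z1) (w * w1)) = \<epsilon> u * G x y1 z1 w1" for y1 z1 w1
      proof -
        have "functional (\<lambda>v. \<phi> (S x * \<alpha> * y1 * \<beta> * S z1 * v * w1))"
          by (simp add: functional_simps add)
        then have "eval2 (\<Delta> u) (\<lambda>b c. \<phi> (S x * \<alpha> * y1 * \<beta> * S z1 * (S b * a * c) * w1)) = \<epsilon> u * \<phi> (S x * \<alpha> * y1 * \<beta> * S z1 * a * w1)"
          using a unfolding coinvariant_def by blast
        then show ?thesis by (simp add: G_def apd_mult mult.assoc)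
      qed
      then have "eval2 (\<Delta> u) (\<lambda>z w. T x y z w) = \<epsilon> u * eval3 \<Psi> (\<lambda>y1 z1 w1. G x (y * y1) z1 w1)"
        unfolding T_def by (simp add: eval32_swap [symmetric] eval3_scale)
      also have "eval3 \<Psi> (\<lambda>y1 z1 w1. G x (y * y1) z1 w1) = \<phi> (S x * \<alpha> * y * z)"
        unfolding z_def G_def
        by (subst functional_sweedler3 [where \<phi> = "\<lambda>v. \<phi> (S x * \<alpha> * y * v)"])
          (simp_all add: functional_simps add mult.assoc)
      finally show ?thesis .
    qed
    have c5: "eval3 \<Phi> (\<lambda>x y u. \<epsilon> u * \<phi> (S x * \<alpha> * y * z)) = \<phi> (\<alpha> * z)"
    proof -
      have "bilin (\<lambda>x y. \<phi> (S x * \<alpha> * y * z))"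
        by (simp add: bilin_def functional_simps add)
      from coas_counit_right [OF this] show ?thesis by simp
    qed
    have d1: "eval3 \<Phi> (\<lambda>y'' z'' w''. T p (q * (q' * y'')) (r * (r' * z'')) (s * w'')) = G p (q * q') (r * r') s"
      for p q q' r r' s
    proof -
      have "trilin (\<lambda>x y z. G p (q * (q' * x)) (r * (r' * y)) (s * z))"
        by (simp add: trilin_def functional_simps addG)
      from coas_cancel [OF this] show ?thesis by (simp add: T_def mult.assoc)
    qed
    have d2: "eval2 (\<Delta> u) (\<lambda>y' z'. G p (y * y') (z * z') s) = \<epsilon> u * G p y z s" for u p y z s
    proof -
      have "functional (\<lambda>v. \<phi> (S p * (\<alpha> * (y * (v * (S z * (a * s)))))))"
        by (simp add: functional_simps add)
      from eval2_beta [OF this, of u] show ?thesis by (simp add: G_def apd_mult mult.assoc)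
    qed
    have d3: "eval3 \<Phi> (\<lambda>x' u w'. \<epsilon> u * G (x * x') y z w') = G x y z 1" for x y z
    proof -
      have "bilin (\<lambda>x' w'. G (x * x') y z w')"
        by (simp add: bilin_def functional_simps addG)
      from coas_counit_middle [OF this] show ?thesis by simp
    qed
    have d4: "eval3 \<Phi> (\<lambda>x y z. G x y z 1) = \<phi> a"
    proof -
      have "functional (\<lambda>v. \<phi> (v * a))"
        by (simp add: functional_simps add)
      from eval3_zigzag [OF this] show ?thesis by (simp add: G_def)
    qed
    show "\<phi> (\<alpha> * z) = \<phi> a"
      using pentagon [OF T] unfolding c2 c3 c4 c5 d1 d2 d3 d4 .
  qed
  moreover have "z \<in> centre"
    unfolding centre_def using central by auto
  ultimately show ?thesis
    unfolding alphaZ_def by auto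
qed

section \<open>Elements of the fourth tensor power\<close>

text \<open>An element of \<open>H \<otimes> H \<otimes> H \<otimes> H\<close> is represented by the finite linear combinations of evaluations
  at quadruples that it induces. Linearity, the interchange of sums and the compatibility with linear maps
  follow by induction.\<close>

inductive combination :: "(('h \<Rightarrow> 'h \<Rightarrow> 'h \<Rightarrow> 'h \<Rightarrow> 'k) \<Rightarrow> 'k) \<Rightarrow> bool" where
  point: "combination (\<lambda>T. T a b c d)"
| zero: "combination (\<lambda>T. 0)"
| plus: "combination V \<Longrightarrow> combination W \<Longrightarrow> combination (\<lambda>T. V T + W T)"
| scale: "combination V \<Longrightarrow> combination (\<lambda>T. r * V T)"

lemma combination_sum:
  "(\<And>i. combination (V i)) \<Longrightarrow> combination (\<lambda>T. \<Sum>i\<in>A. r i * V i T)"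
proof (induction A rule: infinite_finite_induct)
  case (insert x F)
  from combination.plus [OF combination.scale [OF insert(4), of "r x" x] insert(3) [OF insert(4)]]
  show ?case using insert(1,2) by simp
qed (simp_all add: combination.zero)

lemma combination_eval2: "(\<And>a b. combination (\<lambda>T. V a b T)) \<Longrightarrow> combination (\<lambda>T. eval2 s (\<lambda>a b. V a b T))"
  unfolding eval2_def by (rule combination_sum)

lemma combination_eval3:
  "(\<And>a b c. combination (\<lambda>T. V a b c T)) \<Longrightarrow> combination (\<lambda>T. eval3 s (\<lambda>a b c. V a b c T))"
  unfolding eval3_def by (rule combination_sum)

lemma combination_linear:
  assumes "combination V"
  shows "V (\<lambda>a b c d. 0) = 0"
    "V (\<lambda>a b c d. T a b c d + U a b c d) = V T + V U"
    "V (\<lambda>a b c d. r * T a b c d) = r * V T"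
  using assms by (induction) (simp_all add: algebra_simps)

text \<open>Independent Sweedler sums may be interchanged.\<close>

lemma combination_swap:
  assumes "combination W" and V: "combination V"
  shows "V (\<lambda>a b c d. W (\<lambda>a' b' c' d'. T a b c d a' b' c' d')) =
    W (\<lambda>a' b' c' d'. V (\<lambda>a b c d. T a b c d a' b' c' d'))"
  using assms(1) by (induction) (simp_all add: combination_linear [OF V])

lemma functional_combination:
  assumes "combination V" "\<And>a b c d. functional (\<lambda>x. T x a b c d)"
  shows "functional (\<lambda>x. V (\<lambda>a b c d. T x a b c d))"
  using assms by induction (auto simp: functional_def algebra_simps)

text \<open>The product of the fourth tensor power.\<close>

definition convolve :: "('h, 'k) functional4 \<Rightarrow> ('h, 'k) functional4 \<Rightarrow> ('h, 'k) functional4" where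
  "convolve V W = (\<lambda>T. V (\<lambda>a b c d. W (\<lambda>a' b' c' d'. T (a * a') (b * b') (c * c') (d * d'))))"

lemma convolve_assoc: "convolve (convolve U V) W = convolve U (convolve V W)"
  by (simp add: convolve_def mult.assoc)

lemma combination_convolve:
  assumes "combination V" "combination W"
  shows "combination (convolve V W)"
  unfolding convolve_def using assms(1)
proof induction
  case (point a b c d)
  show ?case using assms(2) by induction (auto intro: combination.intros)
qed (auto intro: combination.intros)

lemma convolve_swap:
  assumes "combination V" "combination W"
  shows "convolve V W T = W (\<lambda>a b c d. V (\<lambda>a' b' c' d'. T (a' * a) (b' * b) (c' * c) (d' * d)))"
  unfolding convolve_def by (rule combination_swap [OF assms(2,1)])

text \<open>Two representatives stand for the same tensor if they agree on multilinear functionals.\<close>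

definition agree :: "('h, 'k) functional4 \<Rightarrow> ('h, 'k) functional4 \<Rightarrow> bool" where
  "agree V W \<longleftrightarrow> (\<forall>T. quadlin T \<longrightarrow> V T = W T)"

lemma agree_trans [trans]: "agree U V \<Longrightarrow> agree V W \<Longrightarrow> agree U W"
  by (simp add: agree_def)

lemma quadlin_left:
  assumes T: "quadlin T"
  shows "quadlin (\<lambda>a' b' c' d'. T (a * a') (b * b') (c * c') (d * d'))"
  by (simp add: quadlin_def functional_simps quadlinD [OF T])

lemma quadlin_right:
  assumes T: "quadlin T"
  shows "quadlin (\<lambda>a b c d. T (a * a') (b * b') (c * c') (d * d'))"
  by (simp add: quadlin_def functional_simps quadlinD [OF T])

lemma agree_convolve_left: "agree V W \<Longrightarrow> agree (convolve U V) (convolve U W)"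
  by (simp add: agree_def convolve_def quadlin_left)

lemma agree_convolve_right:
  assumes "agree V W" "combination U"
  shows "agree (convolve V U) (convolve W U)"
proof -
  have "quadlin (\<lambda>a b c d. U (\<lambda>a' b' c' d'. T (a * a') (b * b') (c * c') (d * d')))" if "quadlin T" for T
    unfolding quadlin_def
    by (intro conjI allI functional_combination [OF assms(2)]; simp add: functional_simps quadlinD [OF that])
  then show ?thesis
    using assms(1) by (simp add: agree_def convolve_def)
qed

lemma agree_convolve_exchange:
  assumes "agree (convolve U V) (convolve V' U)" "combination W"
  shows "agree (convolve U (convolve V W)) (convolve V' (convolve U W))"
  using agree_convolve_right [OF assms] by (simp add: convolve_assoc)

section \<open>The tensor that acts as the middle monodromy\<close>

text \<open>The iterated coproducts for the bracketings \<open>(A \<otimes> B) \<otimes> (C \<otimes> D)\<close>, \<open>((A \<otimes> B) \<otimes> C) \<otimes> D\<close> and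
  \<open>(A \<otimes> (B \<otimes> C)) \<otimes> D\<close>.\<close>

definition delta_pairs where
  "delta_pairs h T = eval2 (\<Delta> h) (\<lambda>u v. eval2 (\<Delta> u) (\<lambda>a b. eval2 (\<Delta> v) (\<lambda>c d. T a b c d)))"

definition delta_left where
  "delta_left h T = eval2 (\<Delta> h) (\<lambda>v d. eval2 (\<Delta> v) (\<lambda>u c. eval2 (\<Delta> u) (\<lambda>a b. T a b c d)))"

definition delta_middle where
  "delta_middle h T = eval2 (\<Delta> h) (\<lambda>v d. eval2 (\<Delta> v) (\<lambda>a u. eval2 (\<Delta> u) (\<lambda>b c. T a b c d)))"

text \<open>The rebracketings between these three: \<open>(\<Delta> \<otimes> id \<otimes> id)(\<Phi>)\<close>, its inverse
  \<open>(\<Delta> \<otimes> id \<otimes> id)(\<Psi>)\<close>, and \<open>\<Phi> \<otimes> 1\<close>, \<open>\<Psi> \<otimes> 1\<close>.\<close>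

definition "open_pair = (\<lambda>T. eval3 \<Phi> (\<lambda>u c d. eval2 (\<Delta> u) (\<lambda>a b. T a b c d)))"

definition "close_pair = (\<lambda>T. eval3 \<Psi> (\<lambda>u c d. eval2 (\<Delta> u) (\<lambda>a b. T a b c d)))"

definition "shift_left = (\<lambda>T. eval3 \<Phi> (\<lambda>a b c. T a b c 1))"

definition "shift_right = (\<lambda>T. eval3 \<Psi> (\<lambda>a b c. T a b c 1))"

lemma combination_delta_shift:
  "combination (delta_pairs h)" "combination (delta_left h)" "combination (delta_middle h)"
  "combination open_pair" "combination close_pair" "combination shift_left" "combination shift_right"
  unfolding delta_pairs_def delta_left_def delta_middle_def
    open_pair_def close_pair_def shift_left_def shift_right_def
  by (intro combination_eval3 combination_eval2 combination.point)+

lemma eval2_pair_mult: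
  assumes T: "quadlin T"
  shows "eval2 (\<Delta> u) (\<lambda>a b. eval2 (\<Delta> u') (\<lambda>a' b'. T (a * a') (b * b') c d)) = eval2 (\<Delta> (u * u')) (\<lambda>a b. T a b c d)"
  using T by (intro eval2_cop_mult [symmetric]) (simp add: quadlin_def bilin_def)

lemma trilin_pair:
  assumes T: "quadlin T"
  shows "trilin (\<lambda>u c d. eval2 (\<Delta> u) (\<lambda>a b. T a b c d))"
  unfolding trilin_def by (intro conjI allI functional_intros; simp add: functional_simps quadlinD [OF T])

lemma agree_open_pair: "agree (convolve open_pair (delta_pairs h)) (convolve (delta_left h) open_pair)"
  unfolding agree_def
proof (intro allI impI)
  fix T assume T: "quadlin T"
  have l: "eval2 (\<Delta> u) (\<lambda>a b. eval2 (\<Delta> h) (\<lambda>u' v. eval2 (\<Delta> u') (\<lambda>a' b'. eval2 (\<Delta> v) (\<lambda>c' d'. T (a * a') (b * b') (c * c') (d * d')))))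
     = eval2 (\<Delta> h) (\<lambda>u' v. eval2 (\<Delta> v) (\<lambda>c' d'. eval2 (\<Delta> (u * u')) (\<lambda>a b. T a b (c * c') (d * d'))))" for u c d
  proof -
    have "eval2 (\<Delta> u) (\<lambda>a b. eval2 (\<Delta> u') (\<lambda>a' b'. eval2 (\<Delta> v) (\<lambda>c' d'. T (a * a') (b * b') (c * c') (d * d')))) =
        eval2 (\<Delta> v) (\<lambda>c' d'. eval2 (\<Delta> (u * u')) (\<lambda>a b. T a b (c * c') (d * d')))" for u' v
      by (subst eval2_swap [of "\<Delta> u'" "\<Delta> v"], subst eval2_swap [of "\<Delta> u" "\<Delta> v"])
        (simp add: eval2_pair_mult [OF T])
    then show ?thesis
      by (subst eval2_swap [of "\<Delta> u" "\<Delta> h"]) simp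
  qed
  have r: "eval2 (\<Delta> u) (\<lambda>a b. eval3 \<Phi> (\<lambda>u' c' d'. eval2 (\<Delta> u') (\<lambda>a' b'. T (a * a') (b * b') (c * c') (d * d')))) =
      eval3 \<Phi> (\<lambda>u' c' d'. eval2 (\<Delta> (u * u')) (\<lambda>a b. T a b (c * c') (d * d')))" for u c d
    unfolding eval32_swap [symmetric] eval2_pair_mult [OF T] ..
  show "convolve open_pair (delta_pairs h) T = convolve (delta_left h) open_pair T"
    unfolding convolve_def open_pair_def delta_pairs_def delta_left_def l r
    by (rule quasi_coassoc [OF trilin_pair [OF T], symmetric])
qed

lemma agree_close_pair: "agree (convolve close_pair (delta_left h)) (convolve (delta_pairs h) close_pair)"
  unfolding agree_def
proof (intro allI impI)
  fix T assume T: "quadlin T"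
  have l: "eval2 (\<Delta> u) (\<lambda>a b. eval2 (\<Delta> h) (\<lambda>v d'. eval2 (\<Delta> v) (\<lambda>u' c'. eval2 (\<Delta> u') (\<lambda>a' b'. T (a * a') (b * b') (c * c') (d * d')))))
     = eval2 (\<Delta> h) (\<lambda>v d'. eval2 (\<Delta> v) (\<lambda>u' c'. eval2 (\<Delta> (u * u')) (\<lambda>a b. T a b (c * c') (d * d'))))" for u c d
    unfolding eval2_swap [of "\<Delta> u"] eval2_pair_mult [OF T] ..
  have r: "eval2 (\<Delta> u) (\<lambda>a b. eval2 (\<Delta> v) (\<lambda>c d. eval3 \<Psi> (\<lambda>u' c' d'. eval2 (\<Delta> u') (\<lambda>a' b'. T (a * a') (b * b') (c * c') (d * d'))))) =
      eval2 (\<Delta> v) (\<lambda>c d. eval3 \<Psi> (\<lambda>u' c' d'. eval2 (\<Delta> (u * u')) (\<lambda>a b. T a b (c * c') (d * d'))))" for u v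
    by (subst eval2_swap [of "\<Delta> u" "\<Delta> v"]) (simp only: eval32_swap [symmetric] eval2_pair_mult [OF T])
  show "convolve close_pair (delta_left h) T = convolve (delta_pairs h) close_pair T"
    unfolding convolve_def close_pair_def delta_pairs_def delta_left_def l r
    by (rule quasi_coassoc' [OF trilin_pair [OF T]])
qed

lemma agree_shift_right: "agree (convolve shift_right (delta_left h)) (convolve (delta_middle h) shift_right)"
  unfolding agree_def
proof (intro allI impI)
  fix T assume T: "quadlin T"
  have "trilin (\<lambda>a b c. T a b c d)" for d
    using T by (simp add: quadlin_def trilin_def)
  from quasi_coassoc' [OF this]
  show "convolve shift_right (delta_left h) T = convolve (delta_middle h) shift_right T"
    unfolding convolve_def shift_right_def delta_left_def delta_middle_def
    by (subst eval32_swap) simp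
qed

lemma agree_shift_left: "agree (convolve shift_left (delta_middle h)) (convolve (delta_left h) shift_left)"
  unfolding agree_def
proof (intro allI impI)
  fix T assume T: "quadlin T"
  have "trilin (\<lambda>a b c. T a b c d)" for d
    using T by (simp add: quadlin_def trilin_def)
  from quasi_coassoc [OF this]
  show "convolve shift_left (delta_middle h) T = convolve (delta_left h) shift_left T"
    unfolding convolve_def shift_left_def delta_left_def delta_middle_def
    by (subst eval32_swap) simp
qed

end

text \<open>A quasi-Hopf algebra with an \<open>R\<close>-matrix and a ribbon element.\<close>

locale ribbon_quasi_hopf_alg = quasi_hopf_alg H
  for H :: "('k::field, 'h::ring_1, 'z) ribbon_quasi_hopf_scheme" +
  assumes quasitriangular: "is_quasitriangular H" and ribbon: "is_ribbon H"
begin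

abbreviation "R \<equiv> rmat H"

lemma rmat_cop:
  assumes B: "bilin B"
  shows "eval2 R (\<lambda>r s. eval2 (\<Delta> h) (\<lambda>b c. B (r * b) (s * c))) =
    eval2 (\<Delta> h) (\<lambda>b c. eval2 R (\<lambda>r s. B (c * r) (b * s)))"
proof -
  have flip: "eval2 (\<lambda>(x, y). s (y, x)) U = eval2 s (\<lambda>a b. U b a)" for s U
    unfolding eval2_def
    by (rule sum.reindex_bij_witness [where i = "\<lambda>(x, y). (y, x)" and j = "\<lambda>(x, y). (y, x)"]) auto
  have "mult2 H R (\<Delta> h) = mult2 H (\<lambda>(x, y). \<Delta> h (y, x)) R"
    using quasitriangular unfolding is_quasitriangular_def by blast
  from arg_cong [OF this, of "\<lambda>s. eval2 s B"] show ?thesis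
    unfolding eval2_mult2 [OF B] flip .
qed

text \<open>\<open>1 \<otimes> R\<^sub>2\<^sub>1 R \<otimes> 1\<close>, where \<open>R\<^sub>2\<^sub>1\<close> is \<open>R\<close> with its two factors interchanged.\<close>

definition "monodromy = (\<lambda>T. eval2 R (\<lambda>r s. eval2 R (\<lambda>r' s'. T 1 (s' * r) (r' * s) 1)))"

lemma combination_monodromy: "combination monodromy"
  unfolding monodromy_def by (intro combination_eval2 combination.point)

lemma agree_monodromy: "agree (convolve monodromy (delta_middle h)) (convolve (delta_middle h) monodromy)"
  unfolding agree_def
proof (intro allI impI)
  fix T assume T: "quadlin T"
  \<comment> \<open>Both copies of \<open>R\<close> are moved past the coproduct; each of them flips it.\<close>
  have key: "eval2 R (\<lambda>r s. eval2 R (\<lambda>r' s'. eval2 (\<Delta> u) (\<lambda>b c. T a (s' * r * b) (r' * s * c) d))) =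
     eval2 (\<Delta> u) (\<lambda>b c. eval2 R (\<lambda>r s. eval2 R (\<lambda>r' s'. T a (b * (s' * r)) (c * (r' * s)) d)))" for u a d
  proof -
    have b1: "bilin (\<lambda>x y. T a (s' * x) (r' * y) d)" for r' s'
      by (simp add: bilin_def functional_simps quadlinD [OF T])
    have b2: "bilin (\<lambda>x y. T a (y * r) (x * s) d)" for r s
      by (simp add: bilin_def functional_simps quadlinD [OF T])
    have "eval2 R (\<lambda>r s. eval2 R (\<lambda>r' s'. eval2 (\<Delta> u) (\<lambda>b c. T a (s' * r * b) (r' * s * c) d)))
        = eval2 R (\<lambda>r' s'. eval2 R (\<lambda>r s. eval2 (\<Delta> u) (\<lambda>b c. T a (s' * (r * b)) (r' * (s * c)) d)))"
      by (subst eval2_swap) (simp add: mult.assoc)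
    also have "\<dots> = eval2 R (\<lambda>r' s'. eval2 (\<Delta> u) (\<lambda>b c. eval2 R (\<lambda>r s. T a (s' * (c * r)) (r' * (b * s)) d)))"
      unfolding rmat_cop [OF b1] ..
    also have "\<dots> = eval2 R (\<lambda>r s. eval2 R (\<lambda>r' s'. eval2 (\<Delta> u) (\<lambda>b c. T a (s' * c * r) (r' * b * s) d)))"
      by (subst eval2_swap [of "\<Delta> u" R], subst eval2_swap [of R R]) (simp add: mult.assoc)
    also have "\<dots> = eval2 R (\<lambda>r s. eval2 (\<Delta> u) (\<lambda>b c. eval2 R (\<lambda>r' s'. T a (b * s' * r) (c * r' * s) d)))"
      unfolding rmat_cop [OF b2] ..
    also have "\<dots> = eval2 (\<Delta> u) (\<lambda>b c. eval2 R (\<lambda>r s. eval2 R (\<lambda>r' s'. T a (b * (s' * r)) (c * (r' * s)) d)))"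
      by (subst eval2_swap [of R "\<Delta> u"]) (simp add: mult.assoc)
    finally show ?thesis .
  qed
  show "convolve monodromy (delta_middle h) T = convolve (delta_middle h) monodromy T"
    unfolding convolve_def monodromy_def delta_middle_def eval2_swap [of R "\<Delta> v" for v]
    by (simp add: key [unfolded eval2_swap [of R "\<Delta> v" for v]] mult.assoc [symmetric])
qed

text \<open>The product of the five steps from \<open>(X\<^sup>\<or> \<otimes> X) \<otimes> (Y\<^sup>\<or> \<otimes> Y)\<close> to itself: rebracket, braid
  \<open>X\<close> and \<open>Y\<^sup>\<or>\<close> twice, bracket back. The rightmost factor acts first.\<close>

definition "middle_element = convolve close_pair (convolve shift_left (convolve monodromy (convolve shift_right open_pair)))"

lemmas combinations = combination_delta_shift combination_monodromy

lemma combination_middle_element: "combination middle_element"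
  unfolding middle_element_def by (intro combination_convolve combinations)

text \<open>The middle monodromy is a morphism.\<close>

lemma agree_middle_element: "agree (convolve middle_element (delta_pairs h)) (convolve (delta_pairs h) middle_element)"
proof -
  have "agree (convolve middle_element (delta_pairs h))
      (convolve close_pair (convolve shift_left (convolve monodromy (convolve shift_right (convolve (delta_left h) open_pair)))))"
    unfolding middle_element_def convolve_assoc by (intro agree_convolve_left agree_open_pair)
  also have "agree \<dots> (convolve close_pair (convolve shift_left (convolve monodromy (convolve (delta_middle h) (convolve shift_right open_pair)))))"
    by (intro agree_convolve_left agree_convolve_exchange agree_shift_right combination_convolve combinations)
  also have "agree \<dots> (convolve close_pair (convolve shift_left (convolve (delta_middle h) (convolve monodromy (convolve shift_right open_pair)))))"
    by (intro agree_convolve_left agree_convolve_exchange agree_monodromy combination_convolve combinations)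
  also have "agree \<dots> (convolve close_pair (convolve (delta_left h) (convolve shift_left (convolve monodromy (convolve shift_right open_pair)))))"
    by (intro agree_convolve_left agree_convolve_exchange agree_shift_left combination_convolve combinations)
  also have "agree \<dots> (convolve (delta_pairs h) (convolve close_pair (convolve shift_left (convolve monodromy (convolve shift_right open_pair)))))"
    by (intro agree_convolve_left agree_convolve_exchange agree_close_pair combination_convolve combinations)
  finally show ?thesis
    unfolding middle_element_def .
qed

end

section \<open>Linear maps on coefficient families\<close>

text \<open>Linearity on the families supported in \<open>I\<close>, with values supported in \<open>J\<close>; nothing is said
  about other families.\<close>

definition lin_on :: "'i set \<Rightarrow> 'j set \<Rightarrow> (('i \<Rightarrow> 'k::field) \<Rightarrow> 'j \<Rightarrow> 'k) \<Rightarrow> bool" where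
  "lin_on I J f \<longleftrightarrow> (\<forall>x\<in>supp I. f x \<in> supp J) \<and> (\<forall>x\<in>supp I. \<forall>y\<in>supp I. f (x + y) = f x + f y) \<and>
     (\<forall>c. \<forall>x\<in>supp I. f (fscale c x) = fscale c (f x))"

lemma linear_vecs_iff: "linear_vecs X Y f \<longleftrightarrow> lin_on (idx X) (idx Y) f"
  by (simp add: linear_vecs_def lin_on_def vecs_def)

lemma supp_simps [simp]:
  "(\<lambda>i. 0) \<in> supp I" "x \<in> supp I \<Longrightarrow> y \<in> supp I \<Longrightarrow> x + y \<in> supp I"
  "x \<in> supp I \<Longrightarrow> fscale c x \<in> supp I" for x y :: "'i \<Rightarrow> 'k::field"
  by (simp_all add: supp_def fscale_def)

lemma lin_on_add: "lin_on I J f \<Longrightarrow> x \<in> supp I \<Longrightarrow> y \<in> supp I \<Longrightarrow> f (\<lambda>i. x i + y i) = (\<lambda>j. f x j + f y j)"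
  and lin_on_scale: "lin_on I J f \<Longrightarrow> x \<in> supp I \<Longrightarrow> f (\<lambda>i. c * x i) = (\<lambda>j. c * f x j)"
  and lin_on_supp: "lin_on I J f \<Longrightarrow> x \<in> supp I \<Longrightarrow> f x \<in> supp J"
  by (simp_all add: lin_on_def fscale_def plus_fun_def)

lemma lin_on_zero: "lin_on I J f \<Longrightarrow> f (\<lambda>i. 0) = (\<lambda>j. 0)"
  unfolding lin_on_def
  by (drule conjunct2, drule conjunct2, drule spec [of _ 0], drule bspec [of _ _ "\<lambda>i. 0"]) (simp_all add: fscale_def)

lemma lin_on_sum:
  assumes f: "lin_on I J f" and "\<And>a. a \<in> A \<Longrightarrow> v a \<in> supp I"
  shows "f (\<lambda>i. \<Sum>a\<in>A. c a * v a i) = (\<lambda>j. \<Sum>a\<in>A. c a * f (v a) j)"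
  using assms(2)
proof (induction A rule: infinite_finite_induct)
  case (insert x F)
  have "f (\<lambda>i. \<Sum>a\<in>insert x F. c a * v a i) = f (fscale (c x) (v x) + (\<lambda>i. \<Sum>a\<in>F. c a * v a i))"
    using insert(1,2) by (simp add: fscale_def plus_fun_def)
  also have "\<dots> = f (fscale (c x) (v x)) + f (\<lambda>i. \<Sum>a\<in>F. c a * v a i)"
  proof -
    have "(\<lambda>i. \<Sum>a\<in>F. c a * v a i) \<in> supp I"
      using insert(4) by (simp add: supp_def)
    with f insert(4) show ?thesis by (simp add: lin_on_def)
  qed
  finally show ?case
    using insert f by (simp add: lin_on_def fscale_def plus_fun_def)
qed (simp_all add: lin_on_zero [OF f])

lemma unit_vec_supp [simp]: "i \<in> I \<Longrightarrow> unit_vec i \<in> supp I"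
  by (auto simp: unit_vec_def supp_def)

lemma supp_expand:
  fixes x :: "'i \<Rightarrow> 'k::field"
  assumes "finite I" "x \<in> supp I"
  shows "x = (\<lambda>j. \<Sum>i\<in>I. x i * unit_vec i j)"
proof
  fix j
  have "(\<Sum>i\<in>I. x i * unit_vec i j) = (\<Sum>i\<in>I. if j = i then x i else 0)"
    by (rule sum.cong) (auto simp: unit_vec_def)
  then show "x j = (\<Sum>i\<in>I. x i * unit_vec i j)"
    using assms by (auto simp: supp_def)
qed

lemma lin_on_expand:
  assumes "lin_on I J f" "finite I" "x \<in> supp I"
  shows "f x = (\<lambda>j. \<Sum>i\<in>I. x i * f (unit_vec i) j)"
  by (subst supp_expand [OF assms(2,3)]) (simp add: lin_on_sum [OF assms(1)])

lemma lin_on_ext: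
  assumes "lin_on I J f" "lin_on I J' g" "finite I" "\<And>i. i \<in> I \<Longrightarrow> f (unit_vec i) = g (unit_vec i)" "x \<in> supp I"
  shows "f x = g x"
  using lin_on_expand [OF assms(1,3,5)] lin_on_expand [OF assms(2,3,5)] assms(4) by simp

lemma lin_on_comp: "lin_on I J f \<Longrightarrow> lin_on J K g \<Longrightarrow> lin_on I K (g \<circ> f)"
  by (simp add: lin_on_def)

lemma lin_on_id: "lin_on I I (\<lambda>x. x)"
  by (simp add: lin_on_def)

lemma lin_on_lincomb:
  assumes "\<And>a. lin_on I J (f a)"
  shows "lin_on I J (\<lambda>t j. \<Sum>a\<in>A. c a * f a t j)"
  using assms
  by (auto simp: lin_on_def supp_def fun_eq_iff fscale_def algebra_simps sum.distrib sum_distrib_left)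

text \<open>The coefficient family of \<open>x \<otimes> y\<close>.\<close>

definition pure :: "('i \<Rightarrow> 'k::field) \<Rightarrow> ('j \<Rightarrow> 'k) \<Rightarrow> 'i \<times> 'j \<Rightarrow> 'k" where
  "pure x y = (\<lambda>(i, j). x i * y j)"

lemma pure_supp [simp]: "x \<in> supp I \<Longrightarrow> y \<in> supp J \<Longrightarrow> pure x y \<in> supp (I \<times> J)"
  by (auto simp: pure_def supp_def)

lemma unit_vec_pair: "unit_vec (i, j) = pure (unit_vec i) (unit_vec j)"
  by (auto simp: pure_def unit_vec_def)

lemma tmap_pure:
  assumes "lin_on I I' f" "lin_on J J' g" "x \<in> supp I" "y \<in> supp J"
  shows "tmap f g (pure x y) = pure (f x) (g y)"
proof -
  have "f (\<lambda>i. x i * y j) = (\<lambda>i. f x i * y j)" for j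
    using lin_on_scale [OF assms(1,3), of "y j"] by (simp add: mult.commute)
  moreover have "g (\<lambda>j. f x a * y j) = (\<lambda>j. f x a * g y j)" for a
    by (rule lin_on_scale [OF assms(2,4)])
  ultimately show ?thesis
    by (auto simp: tmap_def pure_def fun_eq_iff)
qed

lemma lin_on_tmap:
  assumes f: "lin_on I I' f" and g: "lin_on J J' g"
  shows "lin_on (I \<times> J) (I' \<times> J') (tmap f g)"
proof -
  have s: "(\<lambda>i. t (i, j)) \<in> supp I" if "t \<in> supp (I \<times> J)" for t j
    using that by (simp add: supp_def)
  have s': "(\<lambda>j. f (\<lambda>i. t (i, j)) a) \<in> supp J" if "t \<in> supp (I \<times> J)" for t a
    using that lin_on_zero [OF f] by (simp add: supp_def)
  have p: "f (\<lambda>i. t (i, j) + u (i, j)) = (\<lambda>i. f (\<lambda>i. t (i, j)) i + f (\<lambda>i. u (i, j)) i)"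
    if "t \<in> supp (I \<times> J)" "u \<in> supp (I \<times> J)" for t u j
    by (rule lin_on_add [OF f s [OF that(1)] s [OF that(2)]])
  have q: "f (\<lambda>i. c * t (i, j)) = (\<lambda>i. c * f (\<lambda>i. t (i, j)) i)" if "t \<in> supp (I \<times> J)" for t c j
    by (rule lin_on_scale [OF f s [OF that]])
  have p': "g (\<lambda>j. f (\<lambda>i. t (i, j)) a + f (\<lambda>i. u (i, j)) a) = (\<lambda>b. g (\<lambda>j. f (\<lambda>i. t (i, j)) a) b + g (\<lambda>j. f (\<lambda>i. u (i, j)) a) b)"
    if "t \<in> supp (I \<times> J)" "u \<in> supp (I \<times> J)" for t u a
    by (rule lin_on_add [OF g s' [OF that(1)] s' [OF that(2)]])
  have q': "g (\<lambda>j. c * f (\<lambda>i. t (i, j)) a) = (\<lambda>b. c * g (\<lambda>j. f (\<lambda>i. t (i, j)) a) b)" if "t \<in> supp (I \<times> J)" for t c a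
    by (rule lin_on_scale [OF g s' [OF that]])
  have "tmap f g t (a, b) = 0" if t: "t \<in> supp (I \<times> J)" and ab: "(a, b) \<notin> I' \<times> J'" for t a b
  proof (cases "b \<in> J'")
    case False
    then show ?thesis using lin_on_supp [OF g s' [OF t]] by (simp add: tmap_def supp_def)
  next
    case True
    then have "a \<notin> I'" using ab by simp
    then have "f (\<lambda>i. t (i, j)) a = 0" for j
      using lin_on_supp [OF f s [OF t]] by (simp add: supp_def)
    then show ?thesis by (simp add: tmap_def lin_on_zero [OF g])
  qed
  then have "tmap f g t \<in> supp (I' \<times> J')" if "t \<in> supp (I \<times> J)" for t
    using that by (auto simp: supp_def)
  then show ?thesis
    unfolding lin_on_def
    by (auto simp: tmap_def fun_eq_iff fscale_def p q p' q')
qed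

lemma tmap_comp_left: "tmap (f \<circ> g) (\<lambda>x. x) = tmap f (\<lambda>x. x) \<circ> tmap g (\<lambda>x. x)"
  by (simp add: tmap_def fun_eq_iff)

lemma hmoduleD:
  assumes "hmodule H X"
  shows "finite (idx X)" "lin_on (idx X) (idx X) (act X h)"
    "x \<in> supp (idx X) \<Longrightarrow> act X (a + b) x = (\<lambda>i. act X a x i + act X b x i)"
    "x \<in> supp (idx X) \<Longrightarrow> act X (scal H c a) x = (\<lambda>i. c * act X a x i)"
    "x \<in> supp (idx X) \<Longrightarrow> act X 1 x = x"
    "x \<in> supp (idx X) \<Longrightarrow> act X (a * b) x = act X a (act X b x)"
    "x \<in> supp (idx X) \<Longrightarrow> act X a x \<in> supp (idx X)"
  using assms by (auto simp: hmodule_def linear_vecs_iff vecs_def fscale_def plus_fun_def lin_on_def)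

context quasi_hopf_alg
begin

section \<open>Associators on pure tensors\<close>

lemma lin_on_eval2:
  assumes "lin_on I J L" "\<And>a b. v a b \<in> supp I"
  shows "L (\<lambda>i. eval2 s (\<lambda>a b. v a b i)) = (\<lambda>j. eval2 s (\<lambda>a b. L (v a b) j))"
  unfolding eval2_def by (rule lin_on_sum [OF assms])

lemma combination_supp:
  assumes "combination V" "\<And>a b c d. v a b c d \<in> supp I"
  shows "(\<lambda>i. V (\<lambda>a b c d. v a b c d i)) \<in> supp I"
  using assms by induction (auto simp: supp_def)

lemma combination_lin_on:
  assumes "combination V" and L: "lin_on I J L" and v: "\<And>a b c d. v a b c d \<in> supp I"
  shows "L (\<lambda>i. V (\<lambda>a b c d. v a b c d i)) = (\<lambda>j. V (\<lambda>a b c d. L (v a b c d) j))"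
  using assms(1)
proof induction
  case zero
  show ?case by (rule lin_on_zero [OF L])
next
  case (plus V W)
  have "L ((\<lambda>i. V (\<lambda>a b c d. v a b c d i)) + (\<lambda>i. W (\<lambda>a b c d. v a b c d i))) =
      L (\<lambda>i. V (\<lambda>a b c d. v a b c d i)) + L (\<lambda>i. W (\<lambda>a b c d. v a b c d i))"
    using L combination_supp [of _ v, OF _ v] plus(1,2) unfolding lin_on_def by blast
  then show ?case unfolding plus.IH by (simp add: plus_fun_def)
next
  case (scale V r)
  have "L (fscale r (\<lambda>i. V (\<lambda>a b c d. v a b c d i))) = fscale r (L (\<lambda>i. V (\<lambda>a b c d. v a b c d i)))"
    using L combination_supp [of _ v, OF _ v] scale(1) unfolding lin_on_def by blast
  then show ?case unfolding scale.IH by (simp add: fscale_def)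
qed simp

lemma hmodule_dual:
  assumes X: "hmodule H X"
  shows "hmodule H (dual H X)"
proof -
  note [simp] = hmoduleD [OF X]
  have mult: "act (dual H X) (a * b) f i = act (dual H X) a (act (dual H X) b f) i" for a b f i
  proof (cases "i \<in> idx X")
    case True
    have "act (dual H X) (a * b) f i = (\<Sum>j\<in>idx X. f j * act X (S b) (act X (S a) (unit_vec i)) j)"
      using True by (simp add: dual_def apd_mult)
    also have "\<dots> = (\<Sum>j\<in>idx X. \<Sum>k\<in>idx X. f j * (act X (S a) (unit_vec i) k * act X (S b) (unit_vec k) j))"
      using True by (subst lin_on_expand [OF hmoduleD(2) [OF X], where x = "act X (S a) (unit_vec i)"]) (simp_all add: sum_distrib_left)
    also have "\<dots> = (\<Sum>k\<in>idx X. \<Sum>j\<in>idx X. f j * (act X (S a) (unit_vec i) k * act X (S b) (unit_vec k) j))"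
      by (rule sum.swap)
    also have "\<dots> = act (dual H X) a (act (dual H X) b f) i"
      using True by (simp add: dual_def sum_distrib_right sum_distrib_left mult_ac)
    finally show ?thesis .
  qed (simp add: dual_def)
  have one: "act (dual H X) 1 f = f" if "f \<in> supp (idx X)" for f
  proof
    fix i
    have "(\<Sum>j\<in>idx X. f j * unit_vec i j) = (\<Sum>j\<in>idx X. if j = i then f j else 0)"
      by (rule sum.cong) (auto simp: unit_vec_def)
    moreover have "f i = 0" if "i \<notin> idx X"
      using \<open>f \<in> supp (idx X)\<close> that by (simp add: supp_def)
    ultimately show "act (dual H X) 1 f i = f i"
      by (simp add: dual_def)
  qed
  have add: "act (dual H X) (a + b) f = act (dual H X) a f + act (dual H X) b f"
    and scal: "act (dual H X) (scal H c a) f = fscale c (act (dual H X) a f)" for a b c f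
    by (auto simp: dual_def fun_eq_iff fscale_def algebra_simps sum.distrib sum_distrib_left)
  have lin: "lin_on (idx X) (idx X) (act (dual H X) h)" for h
    by (auto simp: lin_on_def dual_def supp_def fun_eq_iff fscale_def algebra_simps sum.distrib sum_distrib_left)
  have idx: "idx (dual H X) = idx X" by (simp add: dual_def)
  show ?thesis
    unfolding hmodule_def linear_vecs_iff vecs_def idx
    using mult one add scal lin by (auto simp: fun_eq_iff)
qed

lemma act2_eval: "act2 H X Y s t = (\<lambda>p. eval2 s (\<lambda>a b. tmap (act X a) (act Y b) t p))"
  by (simp add: act2_def eval2_def split_def)

lemma act3_eval: "act3 H X Y Z s t = (\<lambda>p. eval3 s (\<lambda>a b c. tmap (act X a) (tmap (act Y b) (act Z c)) t p))"
  by (simp add: act3_def eval3_def split_def)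

text \<open>Every element of \<open>H\<close> acts linearly, and no module axiom is required. This is enough for the
  linearity of the structure maps, and tensor products inherit it without computation.\<close>

definition preaction :: "('k, 'h, 'i) hmod \<Rightarrow> bool" where
  "preaction X \<longleftrightarrow> (\<forall>h. lin_on (idx X) (idx X) (act X h))"

lemma preaction_hmodule: "hmodule H X \<Longrightarrow> preaction X"
  by (simp add: preaction_def hmoduleD)

lemma preaction_supp: "preaction X \<Longrightarrow> x \<in> supp (idx X) \<Longrightarrow> act X h x \<in> supp (idx X)"
  by (simp add: preaction_def lin_on_def)

lemma lin_on_act2:
  assumes "preaction X" "preaction Y"
  shows "lin_on (idx X \<times> idx Y) (idx X \<times> idx Y) (act2 H X Y s)"
  unfolding act2_def split_def
  using assms by (intro lin_on_lincomb lin_on_tmap) (auto simp: preaction_def)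

lemma lin_on_act3:
  assumes "preaction X" "preaction Y" "preaction Z"
  shows "lin_on (idx X \<times> idx Y \<times> idx Z) (idx X \<times> idx Y \<times> idx Z) (act3 H X Y Z s)"
  unfolding act3_def split_def
  using assms by (intro lin_on_lincomb lin_on_tmap) (auto simp: preaction_def)

lemma preaction_tens: "preaction X \<Longrightarrow> preaction Y \<Longrightarrow> preaction (tens H X Y)"
  using lin_on_act2 [of X Y] by (simp add: preaction_def tens_def)

lemma lin_on_rebracket:
  assumes "lin_on (I \<times> J \<times> K) (I' \<times> J' \<times> K') f"
  shows "lin_on (I \<times> J \<times> K) ((I' \<times> J') \<times> K') (\<lambda>t ((i, j), l). f t (i, j, l))"
    "lin_on ((I \<times> J) \<times> K) (I' \<times> J' \<times> K') (\<lambda>t. f (\<lambda>(i, j, l). t ((i, j), l)))"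
proof -
  show "lin_on (I \<times> J \<times> K) ((I' \<times> J') \<times> K') (\<lambda>t ((i, j), l). f t (i, j, l))"
    using assms by (auto simp: lin_on_def supp_def fscale_def fun_eq_iff)
  have "lin_on ((I \<times> J) \<times> K) (I \<times> J \<times> K) (\<lambda>t (i, j, l). t ((i, j), l))"
    by (auto simp: lin_on_def supp_def fscale_def fun_eq_iff)
  from lin_on_comp [OF this assms]
  show "lin_on ((I \<times> J) \<times> K) (I' \<times> J' \<times> K') (\<lambda>t. f (\<lambda>(i, j, l). t ((i, j), l)))"
    by (simp add: comp_def)
qed

lemma lin_on_assoc:
  assumes "preaction X" "preaction Y" "preaction Z"
  shows "lin_on (idx X \<times> idx Y \<times> idx Z) ((idx X \<times> idx Y) \<times> idx Z) (assoc H X Y Z)"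
    "lin_on ((idx X \<times> idx Y) \<times> idx Z) (idx X \<times> idx Y \<times> idx Z) (assoc_inv H X Y Z)"
  using lin_on_rebracket [OF lin_on_act3 [OF assms]]
  unfolding assoc_def [abs_def] assoc_inv_def [abs_def] by auto

lemma act2_pure:
  assumes "preaction X" "preaction Y" "x \<in> supp (idx X)" "y \<in> supp (idx Y)"
  shows "act2 H X Y s (pure x y) = (\<lambda>p. eval2 s (\<lambda>a b. pure (act X a x) (act Y b y) p))"
proof -
  have "tmap (act X a) (act Y b) (pure x y) = pure (act X a x) (act Y b y)" for a b
    using tmap_pure assms unfolding preaction_def by blast
  then show ?thesis by (simp add: act2_eval)
qed

lemma act3_pure:
  assumes "preaction X" "preaction Y" "preaction Z" "x \<in> supp (idx X)" "y \<in> supp (idx Y)" "z \<in> supp (idx Z)"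
  shows "act3 H X Y Z s (pure x (pure y z)) = (\<lambda>p. eval3 s (\<lambda>a b c. pure (act X a x) (pure (act Y b y) (act Z c z)) p))"
proof -
  have "tmap (act Y b) (act Z c) (pure y z) = pure (act Y b y) (act Z c z)" for b c
    using tmap_pure assms unfolding preaction_def by blast
  moreover have "lin_on (idx Y \<times> idx Z) (idx Y \<times> idx Z) (tmap (act Y b) (act Z c))" for b c
    using lin_on_tmap assms unfolding preaction_def by blast
  moreover have "tmap (act X a) (tmap (act Y b) (act Z c)) (pure x (pure y z)) =
      pure (act X a x) (tmap (act Y b) (act Z c) (pure y z))" for a b c
    by (rule tmap_pure [where I = "idx X" and I' = "idx X" and J = "idx Y \<times> idx Z" and J' = "idx Y \<times> idx Z"])
      (use assms calculation(2) in \<open>auto simp: preaction_def\<close>)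
  ultimately show ?thesis by (simp add: act3_eval)
qed

lemma assoc_pure:
  assumes "preaction X" "preaction Y" "preaction Z" "x \<in> supp (idx X)" "y \<in> supp (idx Y)" "z \<in> supp (idx Z)"
  shows "assoc H X Y Z (pure x (pure y z)) = (\<lambda>p. eval3 \<Phi> (\<lambda>a b c. pure (pure (act X a x) (act Y b y)) (act Z c z) p))"
  unfolding assoc_def act3_pure [OF assms]
  by (auto simp: pure_def fun_eq_iff mult.assoc)

lemma assoc_inv_pure:
  assumes "preaction X" "preaction Y" "preaction Z" "x \<in> supp (idx X)" "y \<in> supp (idx Y)" "z \<in> supp (idx Z)"
  shows "assoc_inv H X Y Z (pure (pure x y) z) = (\<lambda>p. eval3 \<Psi> (\<lambda>a b c. pure (act X a x) (pure (act Y b y) (act Z c z)) p))"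
proof -
  have "(\<lambda>(i, j, l). pure (pure x y) z ((i, j), l)) = pure x (pure y z)"
    by (auto simp: pure_def fun_eq_iff mult.assoc)
  then show ?thesis
    unfolding assoc_inv_def by (simp add: act3_pure [OF assms])
qed

lemma idx_simps [simp]: "idx (tens H X Y) = idx X \<times> idx Y" "idx (dual H X) = idx X"
  "idx (coend H) = bas H" "act (tens H X Y) h = act2 H X Y (\<Delta> h)"
  by (simp_all add: tens_def dual_def coend_def)

lemma act_tens_pure:
  assumes "preaction X" "preaction Y" "x \<in> supp (idx X)" "y \<in> supp (idx Y)"
  shows "act (tens H X Y) h (pure x y) = (\<lambda>p. eval2 (\<Delta> h) (\<lambda>a b. pure (act X a x) (act Y b y) p))"
  by (simp add: act2_pure [OF assms])

lemma tmap_id_right_pure: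
  assumes "lin_on I I' f" "x \<in> supp I" "y \<in> supp J"
  shows "tmap f (\<lambda>x. x) (pure x y) = pure (f x) y"
  by (rule tmap_pure [OF assms(1) lin_on_id assms(2,3)])

lemma tmap_id_left_pure:
  assumes "lin_on J J' g" "x \<in> supp I" "y \<in> supp J"
  shows "tmap (\<lambda>x. x) g (pure x y) = pure x (g y)"
  by (rule tmap_pure [OF lin_on_id assms(1) assms(2,3)])

lemma pure_eval2: "pure (\<lambda>i. eval2 s (\<lambda>a b. x a b i)) y = (\<lambda>p. eval2 s (\<lambda>a b. pure (x a b) y p))"
  "pure z (\<lambda>i. eval2 s (\<lambda>a b. x a b i)) = (\<lambda>p. eval2 s (\<lambda>a b. pure z (x a b) p))"
  and pure_eval3: "pure (\<lambda>i. eval3 t (\<lambda>a b c. w a b c i)) y = (\<lambda>p. eval3 t (\<lambda>a b c. pure (w a b c) y p))"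
  "pure z (\<lambda>i. eval3 t (\<lambda>a b c. w a b c i)) = (\<lambda>p. eval3 t (\<lambda>a b c. pure z (w a b c) p))"
  by (auto simp: pure_def fun_eq_iff eval2_def eval3_def sum_distrib_left sum_distrib_right mult_ac)

text \<open>The rebracketings that occur in the middle monodromy, as actions of tensors.\<close>

lemma assoc_open_pair:
  assumes [simp]: "preaction A" "preaction B" "preaction C" "preaction D"
    "x \<in> supp (idx A)" "y \<in> supp (idx B)" "z \<in> supp (idx C)" "w \<in> supp (idx D)"
  shows "assoc H (tens H A B) C D (pure (pure x y) (pure z w)) =
    (\<lambda>p. open_pair (\<lambda>a b c d. pure (pure (pure (act A a x) (act B b y)) (act C c z)) (act D d w) p))"
proof -
  have "assoc H (tens H A B) C D (pure (pure x y) (pure z w)) =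
    (\<lambda>p. eval3 \<Phi> (\<lambda>u c d. pure (pure (act (tens H A B) u (pure x y)) (act C c z)) (act D d w) p))"
    by (rule assoc_pure) (simp_all add: preaction_tens)
  then show ?thesis
    by (simp only: act_tens_pure assms pure_eval2 open_pair_def)
qed

lemma assoc_inv_close_pair:
  assumes [simp]: "preaction A" "preaction B" "preaction C" "preaction D"
    "x \<in> supp (idx A)" "y \<in> supp (idx B)" "z \<in> supp (idx C)" "w \<in> supp (idx D)"
  shows "assoc_inv H (tens H A B) C D (pure (pure (pure x y) z) w) =
    (\<lambda>p. close_pair (\<lambda>a b c d. pure (pure (act A a x) (act B b y)) (pure (act C c z) (act D d w)) p))"
proof -
  have "assoc_inv H (tens H A B) C D (pure (pure (pure x y) z) w) =
    (\<lambda>p. eval3 \<Psi> (\<lambda>u c d. pure (act (tens H A B) u (pure x y)) (pure (act C c z) (act D d w)) p))"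
    by (rule assoc_inv_pure) (simp_all add: preaction_tens)
  then show ?thesis
    by (simp only: act_tens_pure assms pure_eval2 close_pair_def)
qed

lemma assoc_inv_shift_right:
  assumes [simp]: "preaction A" "preaction B" "preaction C"  "hmodule H D"
    "x \<in> supp (idx A)" "y \<in> supp (idx B)" "z \<in> supp (idx C)" "w \<in> supp (idx D)"
  shows "tmap (assoc_inv H A B C) (\<lambda>x. x) (pure (pure (pure x y) z) w) =
    (\<lambda>p. shift_right (\<lambda>a b c d. pure (pure (act A a x) (pure (act B b y) (act C c z))) (act D d w) p))"
proof -
  have "tmap (assoc_inv H A B C) (\<lambda>x. x) (pure (pure (pure x y) z) w) = pure (assoc_inv H A B C (pure (pure x y) z)) w"
    by (rule tmap_id_right_pure [OF _ _ assms(8)], rule lin_on_assoc) simp_all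
  then show ?thesis
    by (simp add: assoc_inv_pure pure_eval3 shift_right_def hmoduleD(5) [OF assms(4)])
qed

lemma assoc_shift_left:
  assumes [simp]: "preaction A" "preaction B" "preaction C"  "hmodule H D"
    "x \<in> supp (idx A)" "y \<in> supp (idx B)" "z \<in> supp (idx C)" "w \<in> supp (idx D)"
  shows "tmap (assoc H A B C) (\<lambda>x. x) (pure (pure x (pure y z)) w) =
    (\<lambda>p. shift_left (\<lambda>a b c d. pure (pure (pure (act A a x) (act B b y)) (act C c z)) (act D d w) p))"
proof -
  have "tmap (assoc H A B C) (\<lambda>x. x) (pure (pure x (pure y z)) w) = pure (assoc H A B C (pure x (pure y z))) w"
    by (rule tmap_id_right_pure [OF _ _ assms(8)], rule lin_on_assoc) simp_all
  then show ?thesis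
    by (simp add: assoc_pure pure_eval3 shift_left_def hmoduleD(5) [OF assms(4)])
qed

section \<open>The dinatural transformation into the coend\<close>

lemma lin_on_jmap:
  assumes X: "hmodule H X"
  shows "lin_on (idx X \<times> idx X) (bas H) (jmap H X)"
  unfolding lin_on_def jmap_def
  by (auto simp: supp_def fscale_def fun_eq_iff split_def algebra_simps sum.distrib sum_distrib_left)

lemma hpair_basis: "b \<in> bas H \<Longrightarrow> hpair H f b = f b"
  by (simp add: hpair_def coord_basis if_distrib [of "(*) _"] cong: if_cong)

lemma hpair_eqI: "functional \<phi> \<Longrightarrow> (\<And>b. b \<in> bas H \<Longrightarrow> f b = \<phi> b) \<Longrightarrow> hpair H f h = \<phi> h"
  by (simp add: hpair_def functional_expand [of \<phi> h] mult.commute)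

lemma hpair_jmap:
  assumes X: "hmodule H X" and t: "t \<in> supp (idx X \<times> idx X)"
  shows "hpair H (jmap H X t) h = (\<Sum>(i, j)\<in>idx X \<times> idx X. t (i, j) * act X h (unit_vec j) i)"
proof (rule hpair_eqI)
  have "act X (a + b) (unit_vec j) i = act X a (unit_vec j) i + act X b (unit_vec j) i"
    "act X (scal H c a) (unit_vec j) i = c * act X a (unit_vec j) i" if "j \<in> idx X" for a b c i j
    using hmoduleD(3,4) [OF X, of "unit_vec j"] that by simp_all
  then show "functional (\<lambda>h. \<Sum>(i, j)\<in>idx X \<times> idx X. t (i, j) * act X h (unit_vec j) i)"
    unfolding functional_def split_def
    by (auto simp: algebra_simps sum_distrib_left simp flip: sum.distrib intro!: sum.cong)
qed (simp add: jmap_def)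

lemma hpair_jmap_pure:
  assumes X: "hmodule H X" and f: "f \<in> supp (idx X)" and x: "x \<in> supp (idx X)"
  shows "hpair H (jmap H X (pure f x)) h = (\<Sum>i\<in>idx X. f i * act X h x i)"
proof -
  have "hpair H (jmap H X (pure f x)) h = (\<Sum>i\<in>idx X. f i * (\<Sum>j\<in>idx X. x j * act X h (unit_vec j) i))"
    by (subst hpair_jmap [OF X pure_supp [OF f x]])
      (simp add: pure_def split_def sum_distrib_left sum.cartesian_product mult.assoc)
  also have "\<dots> = (\<Sum>i\<in>idx X. f i * act X h x i)"
    by (simp add: lin_on_expand [OF hmoduleD(2) [OF X] hmoduleD(1) [OF X] x, of h])
  finally show ?thesis .
qed

text \<open>The dinatural transformation intertwines the action of \<open>a \<otimes> b\<close> on \<open>X\<^sup>\<or> \<otimes> X\<close> with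
  \<open>f \<mapsto> f (S(a) ? b)\<close>. So the two tensor factors act on the coend separately.\<close>

lemma hpair_jmap_act:
  assumes X: "hmodule H X" and f: "f \<in> supp (idx X)" and x: "x \<in> supp (idx X)"
  shows "hpair H (jmap H X (pure (act (dual H X) a f) (act X b x))) h = hpair H (jmap H X (pure f x)) (S a * h * b)"
proof -
  note [simp] = hmoduleD [OF X]
  have d: "act (dual H X) a f \<in> supp (idx X)"
    using hmoduleD(7) [OF hmodule_dual [OF X], of f a] f by simp
  define y where "y = act X h (act X b x)"
  have y: "y \<in> supp (idx X)" by (simp add: y_def x)
  have "(\<Sum>i\<in>idx X. act (dual H X) a f i * y i) = (\<Sum>i\<in>idx X. \<Sum>j\<in>idx X. f j * (y i * act X (S a) (unit_vec i) j))"
    by (simp add: dual_def sum_distrib_right sum_distrib_left mult_ac)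
  also have "\<dots> = (\<Sum>j\<in>idx X. f j * (\<Sum>i\<in>idx X. y i * act X (S a) (unit_vec i) j))"
    by (subst sum.swap) (simp add: sum_distrib_left)
  also have "\<dots> = (\<Sum>j\<in>idx X. f j * act X (S a) y j)"
    by (simp add: lin_on_expand [OF hmoduleD(2) [OF X] hmoduleD(1) [OF X] y, of "S a"])
  finally show ?thesis
    using hpair_jmap_pure [OF X d, of "act X b x" h] hpair_jmap_pure [OF X f x, of "S a * h * b"]
    by (simp add: x y_def mult.assoc)
qed

end

context ribbon_quasi_hopf_alg
begin

section \<open>The middle monodromy on pure tensors\<close>

lemma lin_on_braid:
  assumes "preaction X" "preaction Y"
  shows "lin_on (idx X \<times> idx Y) (idx Y \<times> idx X) (braid H X Y)"
  using lin_on_act2 [OF assms, of R]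
  unfolding braid_def [abs_def]
  by (auto simp: lin_on_def supp_def fscale_def fun_eq_iff)

lemma braid_pure:
  assumes "preaction X" "preaction Y" "x \<in> supp (idx X)" "y \<in> supp (idx Y)"
  shows "braid H X Y (pure x y) = (\<lambda>p. eval2 R (\<lambda>r s. pure (act Y s y) (act X r x) p))"
  unfolding braid_def act2_pure [OF assms]
  by (auto simp: pure_def fun_eq_iff mult.commute)

lemma double_braid_pure:
  assumes X: "hmodule H X" and Y: "hmodule H Y" and [simp]: "x \<in> supp (idx X)" "y \<in> supp (idx Y)"
  shows "(braid H Y X \<circ> braid H X Y) (pure x y) =
    (\<lambda>p. eval2 R (\<lambda>r s. eval2 R (\<lambda>r' s'. pure (act X (s' * r) x) (act Y (r' * s) y) p)))"
proof -
  note [simp] = preaction_hmodule [OF X] preaction_hmodule [OF Y] hmoduleD [OF X] hmoduleD [OF Y]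
  have "(braid H Y X \<circ> braid H X Y) (pure x y) = (\<lambda>p. eval2 R (\<lambda>r s. braid H Y X (pure (act Y s y) (act X r x)) p))"
    unfolding o_apply
    by (subst braid_pure, simp_all del: o_apply) (rule lin_on_eval2 [OF lin_on_braid], simp_all)
  then show ?thesis by (simp add: braid_pure)
qed

lemma braid_monodromy:
  assumes A: "hmodule H A" and B: "hmodule H B" and C: "hmodule H C" and D: "hmodule H D" and
    [simp]: "x \<in> supp (idx A)" "y \<in> supp (idx B)" "z \<in> supp (idx C)" "w \<in> supp (idx D)"
  shows "tmap (tmap (\<lambda>x. x) (braid H C B \<circ> braid H B C)) (\<lambda>x. x) (pure (pure x (pure y z)) w) =
    (\<lambda>p. monodromy (\<lambda>a b c d. pure (pure (act A a x) (pure (act B b y) (act C c z))) (act D d w) p))"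
proof -
  have l: "lin_on (idx B \<times> idx C) (idx B \<times> idx C) (braid H C B \<circ> braid H B C)"
    using B C by (intro lin_on_comp [OF lin_on_braid lin_on_braid] preaction_hmodule)
  have "tmap (tmap (\<lambda>x. x) (braid H C B \<circ> braid H B C)) (\<lambda>x. x) (pure (pure x (pure y z)) w) =
      pure (tmap (\<lambda>x. x) (braid H C B \<circ> braid H B C) (pure x (pure y z))) w"
    by (rule tmap_id_right_pure [OF lin_on_tmap [OF lin_on_id [of "idx A"] l] _ assms(8)]) simp
  also have "\<dots> = pure (pure x ((braid H C B \<circ> braid H B C) (pure y z))) w"
    by (subst tmap_id_left_pure [OF l assms(5)]) simp_all
  finally show ?thesis
    unfolding double_braid_pure [OF B C assms(6,7)] pure_eval2
    by (simp add: monodromy_def hmoduleD(5) [OF A] hmoduleD(5) [OF D])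
qed

lemma middle_monodromy_decompose:
  "middle_monodromy H X Y = assoc_inv H (dxx H X) (dual H Y) Y
     \<circ> (tmap (assoc H (dual H X) X (dual H Y)) (\<lambda>x. x)
     \<circ> (tmap (tmap (\<lambda>x. x) (braid H (dual H Y) X \<circ> braid H X (dual H Y))) (\<lambda>x. x)
     \<circ> (tmap (assoc_inv H (dual H X) X (dual H Y)) (\<lambda>x. x)
     \<circ> assoc H (dxx H X) (dual H Y) Y)))"
  unfolding middle_monodromy_def tmap_comp_left by (simp only: comp_assoc)

context
  fixes X :: "('k, 'h, 'i) hmod" and Y :: "('k, 'h, 'j) hmod"
  assumes X: "hmodule H X" and Y: "hmodule H Y"
begin

lemma preactions: "preaction X" "preaction Y" "preaction (dual H X)" "preaction (dual H Y)" "preaction (dxx H X)"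
  using X Y by (simp_all add: preaction_hmodule preaction_tens hmodule_dual)

lemma lin_on_steps:
  "lin_on ((idx X \<times> idx X) \<times> idx Y \<times> idx Y) (((idx X \<times> idx X) \<times> idx Y) \<times> idx Y) (assoc H (dxx H X) (dual H Y) Y)"
  "lin_on (((idx X \<times> idx X) \<times> idx Y) \<times> idx Y) ((idx X \<times> idx X \<times> idx Y) \<times> idx Y)
     (tmap (assoc_inv H (dual H X) X (dual H Y)) (\<lambda>x. x))"
  "lin_on ((idx X \<times> idx X \<times> idx Y) \<times> idx Y) ((idx X \<times> idx X \<times> idx Y) \<times> idx Y)
     (tmap (tmap (\<lambda>x. x) (braid H (dual H Y) X \<circ> braid H X (dual H Y))) (\<lambda>x. x))"
  "lin_on ((idx X \<times> idx X \<times> idx Y) \<times> idx Y) (((idx X \<times> idx X) \<times> idx Y) \<times> idx Y)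
     (tmap (assoc H (dual H X) X (dual H Y)) (\<lambda>x. x))"
  "lin_on (((idx X \<times> idx X) \<times> idx Y) \<times> idx Y) ((idx X \<times> idx X) \<times> idx Y \<times> idx Y)
     (assoc_inv H (dxx H X) (dual H Y) Y)"
proof -
  note as = lin_on_assoc [of "dual H X" X "dual H Y"] lin_on_assoc [of "dxx H X" "dual H Y" Y]
  have br: "lin_on (idx X \<times> idx Y) (idx X \<times> idx Y) (braid H (dual H Y) X \<circ> braid H X (dual H Y))"
    using lin_on_comp [OF lin_on_braid [of X "dual H Y"] lin_on_braid [of "dual H Y" X]] by (simp add: preactions)
  show "lin_on ((idx X \<times> idx X) \<times> idx Y \<times> idx Y) (((idx X \<times> idx X) \<times> idx Y) \<times> idx Y) (assoc H (dxx H X) (dual H Y) Y)"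
    "lin_on (((idx X \<times> idx X) \<times> idx Y) \<times> idx Y) ((idx X \<times> idx X) \<times> idx Y \<times> idx Y)
     (assoc_inv H (dxx H X) (dual H Y) Y)"
    using as(3,4) by (simp_all add: preactions)
  show "lin_on (((idx X \<times> idx X) \<times> idx Y) \<times> idx Y) ((idx X \<times> idx X \<times> idx Y) \<times> idx Y)
     (tmap (assoc_inv H (dual H X) X (dual H Y)) (\<lambda>x. x))"
    "lin_on ((idx X \<times> idx X \<times> idx Y) \<times> idx Y) (((idx X \<times> idx X) \<times> idx Y) \<times> idx Y)
     (tmap (assoc H (dual H X) X (dual H Y)) (\<lambda>x. x))"
    using as(1,2) by (intro lin_on_tmap lin_on_id; simp add: preactions)+
  show "lin_on ((idx X \<times> idx X \<times> idx Y) \<times> idx Y) ((idx X \<times> idx X \<times> idx Y) \<times> idx Y)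
     (tmap (tmap (\<lambda>x. x) (braid H (dual H Y) X \<circ> braid H X (dual H Y))) (\<lambda>x. x))"
    by (intro lin_on_tmap lin_on_id br)
qed

lemma lin_on_middle_monodromy:
  "lin_on ((idx X \<times> idx X) \<times> idx Y \<times> idx Y) ((idx X \<times> idx X) \<times> idx Y \<times> idx Y) (middle_monodromy H X Y)"
  unfolding middle_monodromy_decompose
  by (rule lin_on_comp [OF lin_on_comp [OF lin_on_comp [OF lin_on_comp [OF
      lin_on_steps(1) lin_on_steps(2)] lin_on_steps(3)] lin_on_steps(4)] lin_on_steps(5)])

text \<open>The five steps applied in turn; the one that is applied first is the outermost sum.\<close>

lemma middle_monodromy_pure:
  assumes [simp]: "f \<in> supp (idx X)" "x \<in> supp (idx X)" "g \<in> supp (idx Y)" "y \<in> supp (idx Y)"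
  shows "middle_monodromy H X Y (pure (pure f x) (pure g y)) = (\<lambda>p.
    open_pair (\<lambda>a1 b1 c1 d1. shift_right (\<lambda>a2 b2 c2 d2. monodromy (\<lambda>a3 b3 c3 d3.
    shift_left (\<lambda>a4 b4 c4 d4. close_pair (\<lambda>a5 b5 c5 d5.
      pure (pure (act (dual H X) a5 (act (dual H X) a4 (act (dual H X) a3 (act (dual H X) a2 (act (dual H X) a1 f)))))
                 (act X b5 (act X b4 (act X b3 (act X b2 (act X b1 x))))))
           (pure (act (dual H Y) c5 (act (dual H Y) c4 (act (dual H Y) c3 (act (dual H Y) c2 (act (dual H Y) c1 g)))))
                 (act Y d5 (act Y d4 (act Y d3 (act Y d2 (act Y d1 y)))))) p))))))"
proof -
  have X': "hmodule H (dual H X)" and Y': "hmodule H (dual H Y)"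
    using X Y by (simp_all add: hmodule_dual)
  have [simp]: "act X h v \<in> supp (idx X)" "act (dual H X) h v \<in> supp (idx X)" if "v \<in> supp (idx X)" for h v
    using preaction_supp [of X v h] preaction_supp [of "dual H X" v h] that by (simp_all add: preactions)
  have [simp]: "act Y h v \<in> supp (idx Y)" "act (dual H Y) h v \<in> supp (idx Y)" if "v \<in> supp (idx Y)" for h v
    using preaction_supp [of Y v h] preaction_supp [of "dual H Y" v h] that by (simp_all add: preactions)
  let ?L1 = "assoc H (dxx H X) (dual H Y) Y"
  let ?L2 = "tmap (assoc_inv H (dual H X) X (dual H Y)) (\<lambda>x. x)"
  let ?L3 = "tmap (tmap (\<lambda>x. x) (braid H (dual H Y) X \<circ> braid H X (dual H Y))) (\<lambda>x. x)"
  let ?L4 = "tmap (assoc H (dual H X) X (dual H Y)) (\<lambda>x. x)"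
  let ?L5 = "assoc_inv H (dxx H X) (dual H Y) Y"
  note l = lin_on_steps
  note l4 = lin_on_comp [OF l(4) l(5)]
  note l3 = lin_on_comp [OF l(3) l4]
  note l2 = lin_on_comp [OF l(2) l3]
  have e1: "?L5 (?L4 (?L3 (?L2 (?L1 (pure (pure f x) (pure g y)))))) = (\<lambda>p. open_pair (\<lambda>a b c d.
      ?L5 (?L4 (?L3 (?L2 (pure (pure (pure (act (dual H X) a f) (act X b x)) (act (dual H Y) c g)) (act Y d y))))) p))"
    using combination_lin_on [OF combinations(4) l2] by (subst assoc_open_pair) (simp_all add: preactions comp_assoc)
  have e2: "?L5 (?L4 (?L3 (?L2 (pure (pure (pure f x) g) y)))) = (\<lambda>p. shift_right (\<lambda>a b c d.
      ?L5 (?L4 (?L3 (pure (pure (act (dual H X) a f) (pure (act X b x) (act (dual H Y) c g))) (act Y d y)))) p))"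
    if [simp]: "f \<in> supp (idx X)" "x \<in> supp (idx X)" "g \<in> supp (idx Y)" "y \<in> supp (idx Y)" for f x g y
    using combination_lin_on [OF combinations(7) l3] by (subst assoc_inv_shift_right [OF _ _ _ Y]) (simp_all add: preactions Y comp_assoc)
  have e3: "?L5 (?L4 (?L3 (pure (pure f (pure x g)) y))) = (\<lambda>p. monodromy (\<lambda>a b c d.
      ?L5 (?L4 (pure (pure (act (dual H X) a f) (pure (act X b x) (act (dual H Y) c g))) (act Y d y))) p))"
    if [simp]: "f \<in> supp (idx X)" "x \<in> supp (idx X)" "g \<in> supp (idx Y)" "y \<in> supp (idx Y)" for f x g y
    using combination_lin_on [OF combinations(8) l4] by (subst braid_monodromy [OF X' X Y' Y]) simp_all
  have e4: "?L5 (?L4 (pure (pure f (pure x g)) y)) = (\<lambda>p. shift_left (\<lambda>a b c d.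
      ?L5 (pure (pure (pure (act (dual H X) a f) (act X b x)) (act (dual H Y) c g)) (act Y d y)) p))"
    if [simp]: "f \<in> supp (idx X)" "x \<in> supp (idx X)" "g \<in> supp (idx Y)" "y \<in> supp (idx Y)" for f x g y
    using combination_lin_on [OF combinations(6) l(5)] by (subst assoc_shift_left [OF _ _ _ Y]) (simp_all add: preactions Y)
  have e5: "?L5 (pure (pure (pure f x) g) y) = (\<lambda>p. close_pair (\<lambda>a b c d.
      pure (pure (act (dual H X) a f) (act X b x)) (pure (act (dual H Y) c g) (act Y d y)) p))"
    if [simp]: "f \<in> supp (idx X)" "x \<in> supp (idx X)" "g \<in> supp (idx Y)" "y \<in> supp (idx Y)" for f x g y
    by (rule assoc_inv_close_pair) (simp_all add: preactions)
  show ?thesis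
    using e1 by (simp add: middle_monodromy_decompose e2 e3 e4 e5)
qed

end

end

context quasi_hopf_alg
begin

section \<open>The monodromy of the coend\<close>

lemma hpair_functional: "functional \<phi> \<Longrightarrow> hpair H (\<lambda>b. if b \<in> bas H then \<phi> b else 0) h = \<phi> h"
  by (rule hpair_eqI) simp_all

lemma hpair_scale: "hpair H (\<lambda>b. c * f b) h = c * hpair H f h" "hpair H (\<lambda>b. f b * c) h = hpair H f h * c"
  and hpair_add: "hpair H (\<lambda>b. f b + g b) h = hpair H f h + hpair H g h"
  and hpair_zero: "hpair H (\<lambda>b. 0) h = 0"
  by (simp_all add: hpair_def algebra_simps sum.distrib sum_distrib_left)

lemma hpair_eval2: "hpair H (\<lambda>b. eval2 s (\<lambda>x y. F x y b)) h = eval2 s (\<lambda>x y. hpair H (F x y) h)"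
  unfolding hpair_def eval2_def sum_distrib_left sum_distrib_right
  by (subst sum.swap) (simp add: mult_ac)

lemma jmap_act:
  assumes "hmodule H X" "f \<in> supp (idx X)" "x \<in> supp (idx X)" "p \<in> bas H"
  shows "jmap H X (pure (act (dual H X) a f) (act X b x)) p = hpair H (jmap H X (pure f x)) (S a * p * b)"
  using hpair_jmap_act [OF assms(1-3), of a b p] by (simp add: hpair_basis assms(4))

text \<open>The value of an element of \<open>H\<^sup>* \<otimes> H\<^sup>*\<close> at a pair of elements of \<open>H\<close>.\<close>

definition hpair2 :: "('h \<times> 'h \<Rightarrow> 'k) \<Rightarrow> 'h \<Rightarrow> 'h \<Rightarrow> 'k" where
  "hpair2 F h k = hpair H (\<lambda>q. hpair H (\<lambda>p. F (p, q)) h) k"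

lemma bilin_hpair2: "bilin (hpair2 F)"
  unfolding bilin_def hpair2_def
  by (auto simp: functional_def hpair_add hpair_scale functionalD [OF functional_hpair])

lemmas hpair2D = bilinD [OF bilin_hpair2]

lemma hpair2_eqI:
  assumes "bilin B" "\<And>p q. p \<in> bas H \<Longrightarrow> q \<in> bas H \<Longrightarrow> F (p, q) = B p q"
  shows "hpair2 F h k = B h k"
  unfolding hpair2_def
proof (rule hpair_eqI)
  show "hpair H (\<lambda>p. F (p, q)) h = B h q" if "q \<in> bas H" for q
    using assms that by (intro hpair_eqI) (auto simp: bilin_def)
qed (use assms in \<open>simp add: bilin_def\<close>)

lemma hpair2_pure: "hpair2 (pure f g) h k = hpair H f h * hpair H g k"
  by (simp add: hpair2_def pure_def hpair_scale)

lemma hpair2_linear: "hpair2 (F + G) h k = hpair2 F h k + hpair2 G h k" "hpair2 (fscale c F) h k = c * hpair2 F h k"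
  by (simp_all add: hpair2_def plus_fun_def fscale_def hpair_add hpair_scale)

lemma quadlin_hpair2: "quadlin (\<lambda>a b c d. hpair2 F (S a * h * b) (S c * k * d))"
  by (simp add: quadlin_def functional_simps hpair2D)

lemma act_coend: "act (coend H) h f = (\<lambda>b. if b \<in> bas H then eval2 (\<Delta> h) (\<lambda>x y. hpair H f (S x * b * y)) else 0)"
  by (auto simp: coend_def functional_sweedler2 [OF functional_hpair] fun_eq_iff)

lemma hpair_act_coend: "hpair H (act (coend H) h f) k = eval2 (\<Delta> h) (\<lambda>x y. hpair H f (S x * k * y))"
proof (rule hpair_eqI)
  show "functional (\<lambda>k. eval2 (\<Delta> h) (\<lambda>x y. hpair H f (S x * k * y)))"
    by (intro functional_intros; simp add: functional_simps functionalD [OF functional_hpair])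
qed (simp add: act_coend)

lemma lin_on_act_coend: "lin_on (bas H) (bas H) (act (coend H) h)"
  unfolding lin_on_def
  by (auto simp: act_coend supp_def fun_eq_iff fscale_def plus_fun_def hpair_add hpair_scale eval2_scale)
    (simp add: eval2_def algebra_simps sum.distrib)

lemma preaction_coend: "preaction (coend H)"
  by (simp add: preaction_def lin_on_act_coend)

lemma act_coend_tens: "act (tens H (coend H) (coend H)) h F = (\<lambda>(p, q). if p \<in> bas H \<and> q \<in> bas H
    then delta_pairs h (\<lambda>a b c d. hpair2 F (S a * p * b) (S c * q * d)) else 0)"
proof -
  have "tmap (act (coend H) u) (act (coend H) v) F (p, q) = (if p \<in> bas H \<and> q \<in> bas H
    then eval2 (\<Delta> u) (\<lambda>a b. eval2 (\<Delta> v) (\<lambda>c d. hpair2 F (S a * p * b) (S c * q * d))) else 0)" for u v p q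
  proof (cases "p \<in> bas H \<and> q \<in> bas H")
    case True
    then have "tmap (act (coend H) u) (act (coend H) v) F (p, q) =
       eval2 (\<Delta> v) (\<lambda>c d. eval2 (\<Delta> u) (\<lambda>a b. hpair2 F (S a * p * b) (S c * q * d)))"
      by (simp add: tmap_def act_coend hpair_eval2 hpair2_def)
    then show ?thesis
      using True by (subst (asm) eval2_swap) simp
  qed (auto simp: tmap_def act_coend hpair_zero eval2_def)
  then show ?thesis
    by (auto simp: act2_eval delta_pairs_def fun_eq_iff eval2_def)
qed

lemma hpair2_act: "hpair2 (act (tens H (coend H) (coend H)) h F) x y =
    delta_pairs h (\<lambda>a b c d. hpair2 F (S a * x * b) (S c * y * d))"
proof (rule hpair2_eqI)
  show "bilin (\<lambda>x y. delta_pairs h (\<lambda>a b c d. hpair2 F (S a * x * b) (S c * y * d)))"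
    unfolding bilin_def
    by (intro conjI allI functional_combination [OF combination_delta_shift(1)]; simp add: functional_simps hpair2D)
qed (simp only: act_coend_tens, simp)

end

context ribbon_quasi_hopf_alg
begin

text \<open>The map \<open>F \<mapsto> F(S(M\<^sub>1) ? M\<^sub>2, S(M\<^sub>3) ? M\<^sub>4)\<close> for the tensor \<open>M\<close> that acts as the middle
  monodromy.\<close>

definition coend_monodromy where
  "coend_monodromy F = (\<lambda>(p, q). if p \<in> bas H \<and> q \<in> bas H
     then middle_element (\<lambda>a b c d. hpair2 F (S a * p * b) (S c * q * d)) else 0)"

lemma hpair2_coend_monodromy: "hpair2 (coend_monodromy F) h k = middle_element (\<lambda>a b c d. hpair2 F (S a * h * b) (S c * k * d))"
proof (rule hpair2_eqI)
  show "bilin (\<lambda>x y. middle_element (\<lambda>a b c d. hpair2 F (S a * x * b) (S c * y * d)))"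
    unfolding bilin_def
    by (intro conjI allI functional_combination [OF combination_middle_element]; simp add: functional_simps hpair2D)
qed (simp add: coend_monodromy_def)

lemma lin_on_coend_monodromy: "lin_on (B2 H) (B2 H) coend_monodromy"
  unfolding lin_on_def
  by (auto simp: coend_monodromy_def supp_def hpair2_linear fun_eq_iff combination_linear [OF combination_middle_element])
    (auto simp: fscale_def)

lemma coend_monodromy_act: "coend_monodromy (act (tens H (coend H) (coend H)) h F) = act (tens H (coend H) (coend H)) h (coend_monodromy F)"
proof -
  have "middle_element (\<lambda>a b c d. hpair2 (act (tens H (coend H) (coend H)) h F) (S a * p * b) (S c * q * d)) =
      delta_pairs h (\<lambda>a b c d. hpair2 (coend_monodromy F) (S a * p * b) (S c * q * d))" for p q
    using agree_middle_element [of h, unfolded agree_def convolve_def, rule_format, OF quadlin_hpair2 [of F p q]]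
    by (simp add: hpair2_coend_monodromy hpair2_act apd_mult mult.assoc del: idx_simps(4))
  then show ?thesis
    by (simp only: coend_monodromy_def [of "act _ _ _"] act_coend_tens [of _ "coend_monodromy F"])
qed

text \<open>The defining property of \<open>\<Q>\<close>. Both sides are linear, so pure tensors suffice.\<close>

lemma coend_monodromy_jmap:
  assumes X: "hmodule H X" and Y: "hmodule H Y" and t: "t \<in> supp ((idx X \<times> idx X) \<times> (idx Y \<times> idx Y))"
  shows "coend_monodromy (tmap (jmap H X) (jmap H Y) t) = tmap (jmap H X) (jmap H Y) (middle_monodromy H X Y t)"
proof -
  let ?I = "(idx X \<times> idx X) \<times> (idx Y \<times> idx Y)" and ?J = "tmap (jmap H X) (jmap H Y)"
  have J: "lin_on ?I (B2 H) ?J"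
    by (intro lin_on_tmap lin_on_jmap X Y)
  have J_pure: "?J (pure u v) = pure (jmap H X u) (jmap H Y v)" if "u \<in> supp (idx X \<times> idx X)" "v \<in> supp (idx Y \<times> idx Y)" for u v
    by (rule tmap_pure [OF lin_on_jmap [OF X] lin_on_jmap [OF Y] that])
  have pure: "coend_monodromy (?J (pure (pure f x) (pure g y))) = ?J (middle_monodromy H X Y (pure (pure f x) (pure g y)))"
    if [simp]: "f \<in> supp (idx X)" "x \<in> supp (idx X)" "g \<in> supp (idx Y)" "y \<in> supp (idx Y)" for f x g y
  proof -
    have [simp]: "act X h v \<in> supp (idx X)" "act (dual H X) h v \<in> supp (idx X)" if "v \<in> supp (idx X)" for h v
      using preaction_supp [of X v h] preaction_supp [of "dual H X" v h] that by (simp_all add: preactions [OF X Y])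
    have [simp]: "act Y h v \<in> supp (idx Y)" "act (dual H Y) h v \<in> supp (idx Y)" if "v \<in> supp (idx Y)" for h v
      using preaction_supp [of Y v h] preaction_supp [of "dual H Y" v h] that by (simp_all add: preactions [OF X Y])
    \<comment> \<open>The functional on which the tensor is to be evaluated.\<close>
    define T where "T = (\<lambda>p q a b c d. hpair2 (pure (jmap H X (pure f x)) (jmap H Y (pure g y))) (S a * p * b) (S c * q * d))"
    have mm: "?J (middle_monodromy H X Y (pure (pure f x) (pure g y))) = (\<lambda>p.
      open_pair (\<lambda>a1 b1 c1 d1. shift_right (\<lambda>a2 b2 c2 d2. monodromy (\<lambda>a3 b3 c3 d3.
      shift_left (\<lambda>a4 b4 c4 d4. close_pair (\<lambda>a5 b5 c5 d5.
      pure (jmap H X (pure (act (dual H X) a5 (act (dual H X) a4 (act (dual H X) a3 (act (dual H X) a2 (act (dual H X) a1 f)))))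
                 (act X b5 (act X b4 (act X b3 (act X b2 (act X b1 x)))))))
           (jmap H Y (pure (act (dual H Y) c5 (act (dual H Y) c4 (act (dual H Y) c3 (act (dual H Y) c2 (act (dual H Y) c1 g)))))
                 (act Y d5 (act Y d4 (act Y d3 (act Y d2 (act Y d1 y))))))) p))))))"
      by (simp add: middle_monodromy_pure [OF X Y] combinations [THEN combination_lin_on, OF J] combinations [THEN combination_supp] J_pure)
    have fact: "jmap H X (pure (act (dual H X) a5 (act (dual H X) a4 (act (dual H X) a3 (act (dual H X) a2 (act (dual H X) a1 f)))))
          (act X b5 (act X b4 (act X b3 (act X b2 (act X b1 x)))))) p *
        jmap H Y (pure (act (dual H Y) c5 (act (dual H Y) c4 (act (dual H Y) c3 (act (dual H Y) c2 (act (dual H Y) c1 g)))))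
          (act Y d5 (act Y d4 (act Y d3 (act Y d2 (act Y d1 y)))))) q =
        (if p \<in> bas H \<and> q \<in> bas H then T p q (a5 * a4 * a3 * a2 * a1) (b5 * b4 * b3 * b2 * b1)
            (c5 * c4 * c3 * c2 * c1) (d5 * d4 * d3 * d2 * d1) else 0)"
      for a1 a2 a3 a4 a5 b1 b2 b3 b4 b5 c1 c2 c3 c4 c5 d1 d2 d3 d4 d5 p q
    proof (cases "p \<in> bas H \<and> q \<in> bas H")
      case True
      then show ?thesis
        by (simp add: T_def hpair2_pure hpair_jmap_act [OF X] hpair_jmap_act [OF Y] jmap_act [OF X] jmap_act [OF Y] apd_mult mult.assoc)
    qed (auto simp: jmap_def)
    have "coend_monodromy (?J (pure (pure f x) (pure g y))) (p, q) = ?J (middle_monodromy H X Y (pure (pure f x) (pure g y))) (p, q)" for p q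
    proof -
      have "?J (middle_monodromy H X Y (pure (pure f x) (pure g y))) (p, q) =
          (if p \<in> bas H \<and> q \<in> bas H then middle_element (T p q) else 0)"
        unfolding mm pure_def [of "jmap _ _ _"] case_prod_conv fact middle_element_def convolve_assoc [symmetric]
        by (cases "p \<in> bas H"; cases "q \<in> bas H")
          (simp_all add: convolve_swap combination_convolve combinations combinations [THEN combination_linear(1)])
      then show ?thesis
        by (simp add: coend_monodromy_def T_def J_pure)
    qed
    then show ?thesis
      by (simp add: fun_eq_iff)
  qed
  show ?thesis
  proof (rule lin_on_ext [OF lin_on_comp [OF J lin_on_coend_monodromy] lin_on_comp [OF lin_on_middle_monodromy [OF X Y] J], unfolded o_apply])
    show "finite ?I" using hmoduleD(1) [OF X] hmoduleD(1) [OF Y] by simp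
    show "coend_monodromy (?J (unit_vec i)) = ?J (middle_monodromy H X Y (unit_vec i))" if "i \<in> ?I" for i
      using that by (auto simp: unit_vec_pair intro!: pure)
  qed (rule t)
qed

end

context quasi_hopf_alg
begin

section \<open>Structure maps described by the dinatural transformation\<close>

text \<open>The regular module, reindexed by natural numbers, with its unit \<open>x\<close>: every functional \<open>g\<close>
  is \<open>j (f \<otimes> x)\<close> for the functional \<open>f\<close> that corresponds to \<open>g\<close>. This gives uniqueness of maps that
  are described by the dinatural transformations.\<close>

lemma regular_module:
  obtains X :: "('k, 'h, nat) hmod" and x
  where "hmodule H X" "x \<in> supp (idx X)"
    "\<And>g. g \<in> supp (bas H) \<Longrightarrow> \<exists>f\<in>supp (idx X). jmap H X (pure f x) = g"
proof -
  obtain e :: "nat \<Rightarrow> 'h" and n where e: "bij_betw e {..<n} (bas H)"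
    using ex_bij_betw_nat_finite [OF finite_bas] by (auto simp: atLeast0LessThan)
  then have eb: "e i \<in> bas H" if "i < n" for i using that by (auto simp: bij_betw_def)
  define \<iota> where "\<iota> v = (\<Sum>j<n. scal H (v j) (e j))" for v
  define \<kappa> where "\<kappa> h = (\<lambda>i. if i < n then coord H h (e i) else 0)" for h
  note coordD = functionalD [OF functional_coord]
  have \<iota>\<kappa>: "\<iota> (\<kappa> h) = h" for h
    using sum.reindex_bij_betw [OF e, of "\<lambda>b. scal H (coord H h b) b"] coord_sum [of h]
    by (simp add: \<iota>_def \<kappa>_def)
  have \<kappa>\<iota>: "\<kappa> (\<iota> v) = v" if "v \<in> supp {..<n}" for v
  proof
    fix i
    have "coord H (\<iota> v) (e i) = v i" if i: "i < n"
    proof -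
      have "coord H (\<iota> v) (e i) = (\<Sum>j<n. v j * coord H (e j) (e i))"
        unfolding \<iota>_def functional_sum [OF functional_coord] by (simp add: coordD)
      also have "\<dots> = (\<Sum>j<n. if j = i then v j else 0)"
      proof (rule sum.cong [OF refl])
        fix j assume "j \<in> {..<n}"
        then have "e i = e j \<longleftrightarrow> j = i"
          using e i by (auto simp: bij_betw_def inj_on_def)
        then show "v j * coord H (e j) (e i) = (if j = i then v j else 0)"
          using eb [of j] \<open>j \<in> {..<n}\<close> by (simp add: coord_basis)
      qed
      finally show ?thesis using i by simp
    qed
    then show "\<kappa> (\<iota> v) i = v i"
      using that by (simp add: \<kappa>_def supp_def)
  qed
  have lin\<iota>: "\<iota> (v + w) = \<iota> v + \<iota> w" "\<iota> (fscale c v) = scal H c (\<iota> v)" for v w c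
    by (simp_all add: \<iota>_def fscale_def vs.scale_left_distrib sum.distrib vs.scale_sum_right)
  have lin\<kappa>: "\<kappa> (a + b) = \<kappa> a + \<kappa> b" "\<kappa> (scal H c a) = fscale c (\<kappa> a)" for a b c
    by (auto simp: \<kappa>_def fscale_def coordD fun_eq_iff)
  have supp\<kappa>: "\<kappa> h \<in> supp {..<n}" for h
    by (simp add: \<kappa>_def supp_def)
  define X :: "('k, 'h, nat) hmod" where "X = \<lparr>idx = {..<n}, act = (\<lambda>h v. \<kappa> (h * \<iota> v))\<rparr>"
  have X: "hmodule H X"
    by (simp add: hmodule_def linear_vecs_def vecs_def X_def supp\<kappa> lin\<iota> lin\<kappa> \<iota>\<kappa> \<kappa>\<iota> distrib_left distrib_right mult.assoc)
  have "\<exists>f\<in>supp (idx X). jmap H X (pure f (\<kappa> 1)) = g" if g: "g \<in> supp (bas H)" for g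
  proof
    define f where "f i = (if i < n then g (e i) else 0)" for i
    show f: "f \<in> supp (idx X)" by (simp add: X_def f_def supp_def)
    have \<kappa>1: "\<kappa> 1 \<in> supp (idx X)" by (simp add: X_def supp\<kappa>)
    have "jmap H X (pure f (\<kappa> 1)) b = g b" for b
    proof (cases "b \<in> bas H")
      case True
      have "jmap H X (pure f (\<kappa> 1)) b = (\<Sum>i<n. g (e i) * coord H b (e i))"
        using hpair_jmap_pure [OF X f \<kappa>1, of b] True
        by (simp add: hpair_basis f_def X_def \<iota>\<kappa>) (simp add: \<kappa>_def)
      also have "\<dots> = hpair H g b"
        unfolding hpair_def by (rule sum.reindex_bij_betw [OF e])
      finally show ?thesis using True by (simp add: hpair_basis)
    next
      case False
      then show ?thesis using g by (simp add: jmap_def supp_def)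
    qed
    then show "jmap H X (pure f (\<kappa> 1)) = g" by auto
  qed
  then show ?thesis
    using that [OF X, of "\<kappa> 1"] by (simp add: X_def supp\<kappa>)
qed

lemma morph_eqI:
  assumes "e \<in> morph X Y" "e' \<in> morph X Z" "\<And>x. x \<in> vecs X \<Longrightarrow> e x = e' x"
  shows "e = e'"
  using assms unfolding morph_def by (intro extensionalityI [of e "vecs X"]) auto

lemma supp_coend [simp]: "vecs (coend H) = supp (bas H)"
  by (simp add: vecs_def)

lemma counit_coend_eq: "counit_coend H = restrict (\<lambda>f _. hpair H f \<alpha>) (supp (bas H))"
  unfolding counit_coend_def
proof (rule the_equality)
  let ?e = "restrict (\<lambda>f (_::unit). hpair H f \<alpha>) (supp (bas H))"
  have act: "act (coend H) h f \<in> supp (bas H)" if "f \<in> supp (bas H)" for h f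
    using lin_on_act_coend that by (simp add: lin_on_def)
  have e: "?e \<in> morph (coend H) (one_mod H)"
    by (auto simp: morph_def hom_def linear_vecs_def one_mod_def act hpair_act_coend eval2_alpha [OF functional_hpair])
      (auto simp: vecs_def supp_def fun_eq_iff fscale_def plus_fun_def hpair_add hpair_scale)
  have j: "?e (jmap H X t) = ev H X t" if "hmodule H X" "t \<in> vecs (dxx H X)" for X :: "('k, 'h, nat) hmod" and t
    using lin_on_supp [OF lin_on_jmap [OF that(1)]] that hpair_jmap [OF that(1), of t \<alpha>]
    by (simp add: vecs_def ev_def)
  show "?e \<in> morph (coend H) (one_mod H) \<and>
     (\<forall>X :: ('k, 'h, nat) hmod. hmodule H X \<longrightarrow> (\<forall>t\<in>vecs (dxx H X). ?e (jmap H X t) = ev H X t))"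
    using e j by blast
  fix e' assume e': "e' \<in> morph (coend H) (one_mod H) \<and>
     (\<forall>X :: ('k, 'h, nat) hmod. hmodule H X \<longrightarrow> (\<forall>t\<in>vecs (dxx H X). e' (jmap H X t) = ev H X t))"
  obtain X :: "('k, 'h, nat) hmod" and x where X: "hmodule H X" "x \<in> supp (idx X)"
    and s: "\<And>g. g \<in> supp (bas H) \<Longrightarrow> \<exists>f\<in>supp (idx X). jmap H X (pure f x) = g"
    using regular_module by blast
  have "e' g = ?e g" if g: "g \<in> vecs (coend H)" for g
  proof -
    obtain f where f: "f \<in> supp (idx X)" "jmap H X (pure f x) = g"
      using s g by auto
    then have "pure f x \<in> vecs (dxx H X)" using X by (simp add: vecs_def)
    with e' j X(1) f show ?thesis by metis
  qed
  with e e' show "e' = ?e" by (blast intro: morph_eqI)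
qed

end

context ribbon_quasi_hopf_alg
begin

lemma Qmap_eq: "Qmap H = restrict coend_monodromy (supp (B2 H))"
  unfolding Qmap_def
proof (rule the_equality)
  let ?q = "restrict coend_monodromy (supp (B2 H))" and ?L = "tens H (coend H) (coend H)"
  have vL: "vecs ?L = supp (B2 H)" by (simp add: vecs_def)
  have act: "act ?L h F \<in> supp (B2 H)" if "F \<in> supp (B2 H)" for h F
    using preaction_supp [OF preaction_tens [OF preaction_coend preaction_coend], of F h] that by simp
  have q: "?q \<in> morph ?L ?L"
    using lin_on_coend_monodromy by (auto simp: morph_def hom_def vL linear_vecs_iff coend_monodromy_act act lin_on_def simp del: idx_simps(4))
  have j: "?q (tmap (jmap H X) (jmap H Y) t) = tmap (jmap H X) (jmap H Y) (middle_monodromy H X Y t)"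
    if "hmodule H X" "hmodule H Y" "t \<in> vecs (tens H (dxx H X) (dxx H Y))"
    for X Y :: "('k, 'h, nat) hmod" and t
    using lin_on_supp [OF lin_on_tmap [OF lin_on_jmap [OF that(1)] lin_on_jmap [OF that(2)]], of t] coend_monodromy_jmap [OF that(1,2), of t] that(3)
    by (simp add: vecs_def)
  let ?P = "\<lambda>q. q \<in> morph ?L ?L \<and> (\<forall>(X :: ('k, 'h, nat) hmod) (Y :: ('k, 'h, nat) hmod). hmodule H X \<longrightarrow> hmodule H Y \<longrightarrow>
       (\<forall>t\<in>vecs (tens H (dxx H X) (dxx H Y)).
          q (tmap (jmap H X) (jmap H Y) t) = tmap (jmap H X) (jmap H Y) (middle_monodromy H X Y t)))"
  show "?P ?q"
    using q j by blast
  fix q' assume q': "?P q'"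
  obtain X :: "('k, 'h, nat) hmod" and x where X: "hmodule H X" "x \<in> supp (idx X)"
    and s: "\<And>g. g \<in> supp (bas H) \<Longrightarrow> \<exists>f\<in>supp (idx X). jmap H X (pure f x) = g"
    using regular_module by blast
  have pure: "q' (pure f g) = ?q (pure f g)" if fg: "f \<in> supp (bas H)" "g \<in> supp (bas H)" for f g
  proof -
    obtain f' g' where f': "f' \<in> supp (idx X)" "jmap H X (pure f' x) = f"
      and g': "g' \<in> supp (idx X)" "jmap H X (pure g' x) = g"
      using s [OF fg(1)] s [OF fg(2)] by blast
    then have t: "pure (pure f' x) (pure g' x) \<in> vecs (tens H (dxx H X) (dxx H X))"
      using X by (simp add: vecs_def)
    have "tmap (jmap H X) (jmap H X) (pure (pure f' x) (pure g' x)) = pure f g"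
      using tmap_pure [OF lin_on_jmap [OF X(1)] lin_on_jmap [OF X(1)], of "pure f' x" "pure g' x"] f' g' X(2) by simp
    with q' j [OF X(1) X(1) t] X(1) t show ?thesis by metis
  qed
  have "q' F = ?q F" if F: "F \<in> vecs ?L" for F
  proof (rule lin_on_ext [of "B2 H" "B2 H" q' "B2 H" ?q])
    show "lin_on (B2 H) (B2 H) q'" "lin_on (B2 H) (B2 H) ?q"
      using q q' by (auto simp: morph_def hom_def linear_vecs_iff)
    show "q' (unit_vec i) = ?q (unit_vec i)" if "i \<in> B2 H" for i
      using that by (cases i) (simp add: unit_vec_pair pure del: restrict_apply)
  qed (use F in \<open>simp_all add: vL\<close>)
  with q q' show "q' = ?q" by (blast intro: morph_eqI)
qed

lemma hopf_pairing_pure: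
  assumes "f \<in> supp (bas H)" "g \<in> supp (bas H)"
  shows "hopf_pairing H (pure f g) () = hpair2 (coend_monodromy (pure f g)) \<alpha> \<alpha>"
proof -
  define G where "G = coend_monodromy (pure f g)"
  have G: "G \<in> supp (B2 H)" unfolding G_def using lin_on_supp [OF lin_on_coend_monodromy] assms by simp
  have "(\<lambda>i. G (i, j)) \<in> supp (bas H)" "(\<lambda>j. hpair H (\<lambda>i. G (i, j)) \<alpha>) \<in> supp (bas H)" for j
    using G by (auto simp: supp_def hpair_zero)
  then show ?thesis
    using assms by (simp add: hopf_pairing_def lunit_def tmap_def counit_coend_eq Qmap_eq hpair2_def G_def)
qed

lemma Scoend_hpair:
  assumes "f \<in> supp (bas H)" "lam \<in> supp (bas H)"
  shows "hpair H (Scoend H lam f) h = hpair2 (coend_monodromy (pure f lam)) \<alpha> h"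
proof -
  define G where "G = coend_monodromy (pure f lam)"
  have G: "G \<in> supp (B2 H)" unfolding G_def using lin_on_supp [OF lin_on_coend_monodromy] assms by simp
  have s: "(\<lambda>i. G (i, j)) \<in> supp (bas H)" for j
    using G by (auto simp: supp_def)
  have p: "tmap (\<lambda>x. x) (from_one lam) (runit_inv f) = pure f lam"
    by (auto simp: tmap_def from_one_def runit_inv_def pure_def)
  have q: "Qmap H (pure f lam) = G"
    using assms by (simp add: Qmap_eq G_def)
  have "lunit (tmap (counit_coend H) (\<lambda>x. x) G) = (\<lambda>b. hpair H (\<lambda>i. G (i, b)) \<alpha>)"
    by (simp add: lunit_def tmap_def counit_coend_eq s fun_eq_iff)
  then have "Scoend H lam f = (\<lambda>b. hpair H (\<lambda>i. G (i, b)) \<alpha>)"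
    by (simp add: Scoend_def p q)
  then show ?thesis by (simp add: hpair2_def G_def)
qed

lemma functional_expand_dual:
  assumes "lin_on (bas H) {()} (\<lambda>f _. P f)" and "g \<in> supp (bas H)"
  shows "P g = (\<Sum>b\<in>bas H. g b * P (unit_vec b))"
  using lin_on_expand [OF assms(1) finite_bas assms(2)] by metis

lemma pure_linear: "pure (x + y) z = pure x z + pure y z" "pure (fscale c x) z = fscale c (pure x z)"
  "pure z (x + y) = pure z x + pure z y" "pure z (fscale c x) = fscale c (pure z x)"
  by (auto simp: pure_def fscale_def fun_eq_iff algebra_simps)

text \<open>The order of the arguments: the first factor of the representing element is paired with the
  second argument of the Hopf pairing.\<close>

lemma omega_hat_pairing:
  assumes "f \<in> supp (bas H)" "g \<in> supp (bas H)"
  shows "hpair2 (coend_monodromy (pure f g)) \<alpha> \<alpha> = eval2 (omega_hat H) (\<lambda>a b. hpair H g a * hpair H f b)"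
proof -
  define P where "P f g = hpair2 (coend_monodromy (pure f g)) \<alpha> \<alpha>" for f g
  let ?W = "\<lambda>w. w \<in> supp (B2 H) \<and>
     (\<forall>f\<in>vecs (coend H). \<forall>g\<in>vecs (coend H).
        hopf_pairing H (\<lambda>(a, b). f a * g b) () =
          (\<Sum>(a, b)\<in>B2 H. w (a, b) * hpair H g a * hpair H f b))"
  have W: "?W w \<longleftrightarrow> w \<in> supp (B2 H) \<and> (\<forall>f\<in>supp (bas H). \<forall>g\<in>supp (bas H).
      P f g = eval2 w (\<lambda>a b. hpair H g a * hpair H f b))" for w
    using hopf_pairing_pure by (auto simp: pure_def eval2_def P_def split_def mult.assoc)
  have Qlin: "F \<in> supp (B2 H) \<Longrightarrow> G \<in> supp (B2 H) \<Longrightarrow> coend_monodromy (F + G) = coend_monodromy F + coend_monodromy G"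
    "F \<in> supp (B2 H) \<Longrightarrow> coend_monodromy (fscale c F) = fscale c (coend_monodromy F)" for F G c
    using lin_on_coend_monodromy by (auto simp: lin_on_def)
  have lin: "lin_on (bas H) {()} (\<lambda>f _. P f g)" "lin_on (bas H) {()} (\<lambda>f _. P g f)" if "g \<in> supp (bas H)" for g
    using that by (auto simp: lin_on_def P_def pure_linear Qlin hpair2_linear fscale_def [of _ "\<lambda>_. _"] supp_def [of "{()}"])
  have P_expand: "P f g = (\<Sum>(a, b)\<in>B2 H. P (unit_vec b) (unit_vec a) * (g a * f b))"
    if "f \<in> supp (bas H)" "g \<in> supp (bas H)" for f g
  proof -
    have "P f g = (\<Sum>a\<in>bas H. g a * P f (unit_vec a))"
      by (rule functional_expand_dual [OF lin(2) [OF that(1)] that(2)])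
    also have "\<dots> = (\<Sum>a\<in>bas H. g a * (\<Sum>b\<in>bas H. f b * P (unit_vec b) (unit_vec a)))"
      using functional_expand_dual [OF lin(1) that(1)] by simp
    finally show ?thesis
      by (simp add: sum_distrib_left sum.cartesian_product mult_ac)
  qed
  have ev: "eval2 w (\<lambda>a b. hpair H g a * hpair H f b) = (\<Sum>(a, b)\<in>B2 H. w (a, b) * (g a * f b))" for w f g
    unfolding eval2_def by (rule sum.cong) (auto simp: hpair_basis)
  have uniq: "w (a, b) = P (unit_vec b) (unit_vec a)" if w: "?W w" and ab: "a \<in> bas H" "b \<in> bas H" for w a b
  proof -
    have "P (unit_vec b) (unit_vec a) = (\<Sum>(x, y)\<in>B2 H. w (x, y) * (unit_vec a x * unit_vec b y))"
      using w ab unfolding W ev by simp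
    also have "\<dots> = (\<Sum>p\<in>B2 H. if p = (a, b) then w p else 0)"
      by (rule sum.cong) (auto simp: unit_vec_def split: if_splits)
    finally show ?thesis using ab by simp
  qed
  have "?W (\<lambda>(a, b). if a \<in> bas H \<and> b \<in> bas H then P (unit_vec b) (unit_vec a) else 0)"
    unfolding W ev using P_expand by (auto simp: supp_def intro!: sum.cong)
  moreover have "w = w'" if w: "?W w" and w': "?W w'" for w w'
  proof
    fix p
    show "w p = w' p"
    proof (cases "p \<in> B2 H")
      case True
      then show ?thesis using uniq [OF w] uniq [OF w'] by (cases p) simp
    next
      case False
      then show ?thesis using w w' by (cases p) (auto simp: supp_def)
    qed
  qed
  ultimately have "\<exists>!w. ?W w" by blast
  from theI' [OF this] have "?W (omega_hat H)"
    unfolding omega_hat_def .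
  then show ?thesis using assms unfolding W P_def by blast
qed

lemma rib_inv: "rib_inv H * rib H = 1" "rib H * rib_inv H = 1"
proof -
  obtain w where w: "w * rib H = 1" "rib H * w = 1"
    using ribbon unfolding is_ribbon_def by blast
  have "w' = w" if "w' * rib H = 1" for w'
    using that w(2) by (metis mult.assoc mult_1_left mult_1_right)
  then have "\<exists>!w. w * rib H = 1 \<and> rib H * w = 1"
    using w by blast
  from theI' [OF this] show "rib_inv H * rib H = 1" "rib H * rib_inv H = 1"
    by (simp_all add: rib_inv_def)
qed

lemma rib_inv_central: "rib_inv H * h = h * rib_inv H"
proof -
  have "rib H * h = h * rib H"
    using ribbon unfolding is_ribbon_def centre_def by blast
  then have "rib_inv H * (rib H * h) * rib_inv H = rib_inv H * (h * rib H) * rib_inv H"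
    by simp
  then show ?thesis
    by (metis mult.assoc mult_1_left mult_1_right rib_inv)
qed

text \<open>The map \<open>f \<mapsto> f (? v\<^sup>-\<^sup>1)\<close> with \<open>v\<close> the ribbon element.\<close>

definition coend_twist where
  "coend_twist f = (\<lambda>b. if b \<in> bas H then hpair H f (b * rib_inv H) else 0)"

lemma hpair_coend_twist: "hpair H (coend_twist f) h = hpair H f (h * rib_inv H)"
  unfolding coend_twist_def
  by (rule hpair_functional) (simp add: functional_simps functionalD [OF functional_hpair])

lemma lin_on_coend_twist: "lin_on (bas H) (bas H) coend_twist"
  by (auto simp: lin_on_def coend_twist_def supp_def fun_eq_iff fscale_def plus_fun_def hpair_add hpair_scale)

lemma coend_twist_jmap:
  assumes X: "hmodule H X" and t: "t \<in> supp (idx X \<times> idx X)"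
  shows "coend_twist (jmap H X t) = jmap H X (tmap (\<lambda>x. x) (twist H X) t)"
proof -
  have tw: "lin_on (idx X) (idx X) (twist H X)"
    by (simp add: twist_def hmoduleD(2) [OF X])
  have pure: "coend_twist (jmap H X (pure f x)) = jmap H X (tmap (\<lambda>x. x) (twist H X) (pure f x))"
    if f: "f \<in> supp (idx X)" and x: "x \<in> supp (idx X)" for f x
  proof -
    have "tmap (\<lambda>x. x) (twist H X) (pure f x) = pure (act (dual H X) 1 f) (act X (rib_inv H) x)"
      using hmoduleD(5) [OF hmodule_dual [OF X], of f] f x
      by (simp add: tmap_id_left_pure [OF tw, unfolded twist_def] twist_def)
    moreover have "jmap H X (pure (act (dual H X) 1 f) (act X (rib_inv H) x)) b = coend_twist (jmap H X (pure f x)) b" for b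
      using jmap_act [OF X f x, of b 1 "rib_inv H"] by (cases "b \<in> bas H") (simp_all add: coend_twist_def jmap_def)
    ultimately show ?thesis by auto
  qed
  show ?thesis
  proof (rule lin_on_ext [OF lin_on_comp [OF lin_on_jmap [OF X] lin_on_coend_twist]
        lin_on_comp [OF lin_on_tmap [OF lin_on_id [of "idx X"] tw] lin_on_jmap [OF X]], unfolded o_apply])
    show "finite (idx X \<times> idx X)" using hmoduleD(1) [OF X] by simp
    show "coend_twist (jmap H X (unit_vec i)) = jmap H X (tmap (\<lambda>x. x) (twist H X) (unit_vec i))" if "i \<in> idx X \<times> idx X" for i
      using that by (auto simp: unit_vec_pair intro!: pure)
  qed (rule t)
qed

lemma coend_twist_act: "coend_twist (act (coend H) h f) = act (coend H) h (coend_twist f)"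
  by (auto simp: act_coend [of h "coend_twist f"] coend_twist_def [of "act _ _ _"] hpair_coend_twist hpair_act_coend mult.assoc rib_inv_central fun_eq_iff)

lemma Tcoend_eq: "Tcoend H = restrict coend_twist (supp (bas H))"
  unfolding Tcoend_def
proof (rule the_equality)
  let ?t = "restrict coend_twist (supp (bas H))"
  let ?P = "\<lambda>f. f \<in> morph (coend H) (coend H) \<and>
     (\<forall>X :: ('k, 'h, nat) hmod. hmodule H X \<longrightarrow>
       (\<forall>t\<in>vecs (dxx H X). f (jmap H X t) = jmap H X (tmap (\<lambda>x. x) (twist H X) t)))"
  have act: "act (coend H) h f \<in> supp (bas H)" if "f \<in> supp (bas H)" for h f
    using lin_on_act_coend that by (simp add: lin_on_def)
  have m: "?t \<in> morph (coend H) (coend H)"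
    using lin_on_coend_twist by (auto simp: morph_def hom_def linear_vecs_iff coend_twist_act act lin_on_def)
  have j: "?t (jmap H X t) = jmap H X (tmap (\<lambda>x. x) (twist H X) t)"
    if "hmodule H X" "t \<in> vecs (dxx H X)" for X :: "('k, 'h, nat) hmod" and t
    using lin_on_supp [OF lin_on_jmap [OF that(1)], of t] coend_twist_jmap [OF that(1), of t] that(2)
    by (simp add: vecs_def)
  show "?P ?t"
    using m j by blast
  fix t' assume t': "?P t'"
  obtain X :: "('k, 'h, nat) hmod" and x where X: "hmodule H X" "x \<in> supp (idx X)"
    and s: "\<And>g. g \<in> supp (bas H) \<Longrightarrow> \<exists>f\<in>supp (idx X). jmap H X (pure f x) = g"
    using regular_module by blast
  have "t' g = ?t g" if g: "g \<in> vecs (coend H)" for g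
  proof -
    obtain f where f: "f \<in> supp (idx X)" "jmap H X (pure f x) = g"
      using s g by auto
    then have "pure f x \<in> vecs (dxx H X)" using X by (simp add: vecs_def)
    with t' j X(1) f show ?thesis by metis
  qed
  with m t' show "t' = ?t" by (blast intro: morph_eqI)
qed

end

context quasi_hopf_alg
begin

section \<open>The transported maps\<close>

lemma transport_eq:
  assumes "h' \<in> alphaZ H" "\<And>f. f \<in> supp (bas H) \<Longrightarrow> hpair H f h' = hpair H (F f) h"
  shows "transport H F h = h'"
  unfolding transport_def
proof (rule the_equality)
  show "h' \<in> alphaZ H \<and> (\<forall>f\<in>vecs (coend H). hpair H f h' = hpair H (F f) h)"
    using assms by simp
  fix k assume k: "k \<in> alphaZ H \<and> (\<forall>f\<in>vecs (coend H). hpair H f k = hpair H (F f) h)"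
  show "k = h'"
  proof (rule functional_separate)
    fix \<phi> :: "'h \<Rightarrow> 'k" assume \<phi>: "functional \<phi>"
    let ?f = "\<lambda>b. if b \<in> bas H then \<phi> b else 0"
    have "?f \<in> supp (bas H)" by (simp add: supp_def)
    with k assms(2) have "hpair H ?f k = hpair H ?f h'" by simp
    then show "\<phi> k = \<phi> h'" by (simp only: hpair_functional [OF \<phi>])
  qed
qed

lemma coinvariantI:
  assumes "\<And>f h. f \<in> supp (bas H) \<Longrightarrow> hpair H (act (coend H) h f) a = \<epsilon> h * hpair H f a"
  shows "coinvariant a"
  unfolding coinvariant_def
proof (intro allI impI)
  fix \<phi> :: "'h \<Rightarrow> 'k" and h assume \<phi>: "functional \<phi>"
  let ?f = "\<lambda>b. if b \<in> bas H then \<phi> b else 0"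
  have "?f \<in> supp (bas H)" by (simp add: supp_def)
  from assms [OF this, of h]
  show "eval2 (\<Delta> h) (\<lambda>x y. \<phi> (S x * a * y)) = \<epsilon> h * \<phi> a"
    by (simp only: hpair_act_coend hpair_functional [OF \<phi>])
qed

text \<open>A right monadic cointegral is in particular a morphism from the unit object to \<open>A\<^sub>2(1)\<close>.
  The action on \<open>A\<^sub>2(1)\<close> is the coadjoint action, because the middle leg of the iterated
  coproduct acts on the unit object by \<open>\<epsilon>\<close>.\<close>

lemma cointegral_invariant:
  assumes "right_monadic_cointegral H lam"
  shows "lam \<in> supp (bas H)" "act (coend H) h lam = fscale (\<epsilon> h) lam"
proof -
  show lam: "lam \<in> supp (bas H)"
    using assms by (simp add: right_monadic_cointegral_def)
  have hom: "runit_inv \<circ> from_one lam \<in> hom (one_mod H) (A2 H (one_mod H))"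
    using assms by (simp add: right_monadic_cointegral_def)
  define u :: "unit \<Rightarrow> 'k" where "u = (\<lambda>_. 1)"
  have "u \<in> vecs (one_mod H)" by (simp add: vecs_def one_mod_def supp_def)
  with hom have eq: "runit_inv (from_one lam (act (one_mod H) h u)) = act (A2 H (one_mod H)) h (runit_inv (from_one lam u))"
    by (simp add: hom_def)
  have "\<epsilon> h * lam b = act (coend H) h lam b" for b
  proof (cases "b \<in> bas H")
    case True
    have "\<epsilon> h * lam b = eval3 (id_cop H (\<Delta> h)) (\<lambda>x y w. \<epsilon> y * hpair H lam (S x * b * w))"
      using fun_cong [OF eq, of "(b, ())"] True
      by (simp add: runit_inv_def from_one_def one_mod_def A2_def u_def eval3_def split_def)
    also have "\<dots> = eval2 (\<Delta> h) (\<lambda>x v. hpair H lam (S x * b * v))"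
    proof -
      have "eval2 (\<Delta> v) (\<lambda>y w. \<epsilon> y * hpair H lam (S x * b * w)) = hpair H lam (S x * b * v)" for x v
        by (rule eval2_counit_left) (simp add: functional_simps functionalD [OF functional_hpair])
      then show ?thesis by (simp add: eval3_id_cop)
    qed
    finally show ?thesis using True by (simp add: act_coend)
  next
    case False
    then show ?thesis using lam by (simp add: act_coend supp_def)
  qed
  then show "act (coend H) h lam = fscale (\<epsilon> h) lam"
    by (auto simp: fscale_def)
qed

lemma act_pure_invariant:
  assumes lam: "\<And>h. act (coend H) h lam = fscale (\<epsilon> h) lam" "lam \<in> supp (bas H)" and f: "f \<in> supp (bas H)"
  shows "act (tens H (coend H) (coend H)) h (pure f lam) = pure (act (coend H) h f) lam"
proof -
  have "eval2 (\<Delta> h) (\<lambda>a b. \<epsilon> b * (act (coend H) a f p * lam q)) = act (coend H) h f p * lam q" for p q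
  proof (rule eval2_counit_right)
    show "functional (\<lambda>a. act (coend H) a f p * lam q)"
      unfolding act_coend
      by (cases "p \<in> bas H") (simp_all, intro functional_intros, simp_all add: functional_simps)
  qed
  then have "eval2 (\<Delta> h) (\<lambda>a b. pure (act (coend H) a f) (act (coend H) b lam) (p, q)) = act (coend H) h f p * lam q" for p q
    by (simp add: lam(1) pure_def fscale_def mult_ac)
  then show ?thesis
    using act_tens_pure [OF preaction_coend preaction_coend, of f lam h] lam(2) f
    by (auto simp: pure_def [of "act (coend H) h f"] fun_eq_iff)
qed

lemma hpair2_act_alphaZ:
  assumes "z \<in> centre"
  shows "hpair2 (act (tens H (coend H) (coend H)) h G) \<alpha> (\<alpha> * z) = \<epsilon> h * hpair2 G \<alpha> (\<alpha> * z)"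
proof -
  have z: "z * x = x * z" for x using assms by (simp add: centre_def)
  have 1: "eval2 (\<Delta> v) (\<lambda>c d. hpair2 G x (S c * (\<alpha> * z) * d)) = \<epsilon> v * hpair2 G x (\<alpha> * z)" for v x
  proof -
    have "functional (\<lambda>k. hpair2 G x (k * z))" by (simp add: functional_simps hpair2D)
    from eval2_alpha [OF this, of v] show ?thesis by (simp add: mult.assoc z)
  qed
  have 2: "eval2 (\<Delta> u) (\<lambda>a b. hpair2 G (S a * \<alpha> * b) y) = \<epsilon> u * hpair2 G \<alpha> y" for u y
  proof -
    have "functional (\<lambda>k. hpair2 G k y)" by (simp add: functional_simps hpair2D)
    from eval2_alpha [OF this, of u] show ?thesis by simp
  qed
  have 3: "eval2 (\<Delta> h) (\<lambda>u v. \<epsilon> v * (\<epsilon> u * hpair2 G \<alpha> (\<alpha> * z))) = \<epsilon> h * hpair2 G \<alpha> (\<alpha> * z)"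
    by (rule eval2_counit_right) (intro functional_intros)
  show ?thesis
    unfolding hpair2_act delta_pairs_def 1 eval2_scale 2 3 ..
qed

lemma centre_scal: "z \<in> centre \<Longrightarrow> scal H c z \<in> centre"
  by (simp add: centre_def)

lemma linear_endo_on_alphaZ:
  assumes "\<And>z. z \<in> centre \<Longrightarrow> F (\<alpha> * z) = G z" "\<And>z. z \<in> centre \<Longrightarrow> G z \<in> alphaZ H"
    "\<And>z z'. G (z + z') = G z + G z'" "\<And>c z. G (scal H c z) = scal H c (G z)"
  shows "linear_endo_on (scal H) (alphaZ H) F"
proof -
  have add: "F (\<alpha> * z + \<alpha> * z') = G z + G z'" if "z \<in> centre" "z' \<in> centre" for z z'
    using assms(1) [of "z + z'"] that by (simp add: assms(3) distrib_left) (simp add: centre_def distrib_left distrib_right assms(3))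
  have scal: "F (scal H c (\<alpha> * z)) = scal H c (G z)" if "z \<in> centre" for z c
    using assms(1) [OF centre_scal [OF that], of c] by (simp add: assms(4))
  show ?thesis
    unfolding linear_endo_on_def alphaZ_def
    using assms(1,2) add scal by (auto simp: alphaZ_def)
qed

end

context ribbon_quasi_hopf_alg
begin

lemma T_alphaZ_eq:
  assumes z: "z \<in> centre"
  shows "T_alphaZ H (\<alpha> * z) = rib_inv H * (\<alpha> * z)" "rib_inv H * (\<alpha> * z) \<in> alphaZ H"
proof -
  have "\<alpha> * (rib_inv H * z) = rib_inv H * (\<alpha> * z)"
    by (metis mult.assoc rib_inv_central)
  moreover have "rib_inv H * z \<in> centre"
    using z by (simp add: centre_def) (metis mult.assoc rib_inv_central)
  ultimately show mem: "rib_inv H * (\<alpha> * z) \<in> alphaZ H"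
    unfolding alphaZ_def by (metis image_eqI)
  show "T_alphaZ H (\<alpha> * z) = rib_inv H * (\<alpha> * z)"
    unfolding T_alphaZ_def
    by (rule transport_eq [OF mem]) (simp add: Tcoend_eq hpair_coend_twist flip: rib_inv_central)
qed

text \<open>The right hand side of the formula for the \<open>S\<close>-transformation.\<close>

definition S_value where
  "S_value lam z = sweedler2 H (omega_hat H) (\<lambda>w1 w2. scal H (hpair H lam (w1 * z)) w2)"

lemma hpair_S_value:
  assumes f: "f \<in> supp (bas H)" and lam: "lam \<in> supp (bas H)" and z: "z \<in> centre"
  shows "hpair H f (S_value lam z) = hpair2 (coend_monodromy (pure f lam)) \<alpha> (\<alpha> * z)"
proof -
  have zc: "z * x = x * z" for x using z by (simp add: centre_def)
  \<comment> \<open>The functional \<open>\<lambda>(? z)\<close>.\<close>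
  define g where "g = (\<lambda>b. if b \<in> bas H then hpair H lam (b * z) else 0)"
  have g: "g \<in> supp (bas H)" by (simp add: g_def supp_def)
  have gp: "hpair H g h = hpair H lam (h * z)" for h
    unfolding g_def by (rule hpair_functional) (simp add: functional_simps functionalD [OF functional_hpair])
  have "hpair H f (S_value lam z) = eval2 (omega_hat H) (\<lambda>a b. hpair H g a * hpair H f b)"
    unfolding S_value_def functional_sweedler2 [OF functional_hpair]
    by (simp add: functionalD [OF functional_hpair] gp)
  also have "\<dots> = hpair2 (coend_monodromy (pure f g)) \<alpha> \<alpha>"
    by (rule omega_hat_pairing [OF f g, symmetric])
  also have "\<dots> = hpair2 (coend_monodromy (pure f lam)) \<alpha> (\<alpha> * z)"
    by (simp add: hpair2_coend_monodromy hpair2_pure gp mult.assoc zc)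
  finally show ?thesis .
qed

lemma S_alphaZ_eq:
  assumes lam: "right_monadic_cointegral H lam" and z: "z \<in> centre"
  shows "S_alphaZ H lam (\<alpha> * z) = S_value lam z" "S_value lam z \<in> alphaZ H"
proof -
  note lam_supp = cointegral_invariant(1) [OF lam]
  have "coinvariant (S_value lam z)"
  proof (rule coinvariantI)
    fix f :: "'h \<Rightarrow> 'k" and h assume f: "f \<in> supp (bas H)"
    have hf: "act (coend H) h f \<in> supp (bas H)"
      using lin_on_supp [OF lin_on_act_coend f] .
    have "hpair H (act (coend H) h f) (S_value lam z) = hpair2 (coend_monodromy (act (tens H (coend H) (coend H)) h (pure f lam))) \<alpha> (\<alpha> * z)"
      unfolding hpair_S_value [OF hf lam_supp z] act_pure_invariant [OF cointegral_invariant(2) [OF lam] lam_supp f] ..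
    also have "\<dots> = \<epsilon> h * hpair H f (S_value lam z)"
      unfolding coend_monodromy_act hpair2_act_alphaZ [OF z] hpair_S_value [OF f lam_supp z] ..
    finally show "hpair H (act (coend H) h f) (S_value lam z) = \<epsilon> h * hpair H f (S_value lam z)" .
  qed
  then show mem: "S_value lam z \<in> alphaZ H"
    by (rule coinvariant_alphaZ)
  show "S_alphaZ H lam (\<alpha> * z) = S_value lam z"
    unfolding S_alphaZ_def
    by (rule transport_eq [OF mem]) (simp add: Scoend_hpair lam_supp hpair_S_value z)
qed

lemma S_value_linear:
  "S_value lam (z + z') = S_value lam z + S_value lam z'"
  "S_value lam (scal H c z) = scal H c (S_value lam z)"
  by (simp_all add: S_value_def sweedler2_def split_def distrib_left functionalD [OF functional_hpair]
      vs.scale_left_distrib vs.scale_right_distrib sum.distrib vs.scale_sum_right mult_ac)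

end

theorem proposition7p1:
  fixes H :: "('k::alg_closed_field, 'h::ring_1) ribbon_quasi_hopf"
    and lam :: "'h \<Rightarrow> 'k"
  assumes "factorisable_ribbon_quasi_hopf H"
    and "right_monadic_cointegral H lam"
    and "lam \<noteq> 0"
  shows "linear_endo_on (scal H) (alphaZ H) (S_alphaZ H lam) \<and>
    linear_endo_on (scal H) (alphaZ H) (T_alphaZ H) \<and>
    (\<forall>z\<in>centre.
       S_alphaZ H lam (alp H * z) =
         sweedler2 H (omega_hat H) (\<lambda>w1 w2. scal H (hpair H lam (w1 * z)) w2) \<and>
       T_alphaZ H (alp H * z) = rib_inv H * (alp H * z))"
proof -
  interpret ribbon_quasi_hopf_alg H
    using assms(1) by unfold_locales (auto simp: factorisable_ribbon_quasi_hopf_def)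
  have "linear_endo_on (scal H) (alphaZ H) (S_alphaZ H lam)"
    by (rule linear_endo_on_alphaZ [where G = "S_value lam"])
      (simp_all add: S_alphaZ_eq [OF assms(2)] S_value_linear)
  moreover have "linear_endo_on (scal H) (alphaZ H) (T_alphaZ H)"
    by (rule linear_endo_on_alphaZ [where G = "\<lambda>z. rib_inv H * (alp H * z)"])
      (simp_all add: T_alphaZ_eq distrib_left)
  ultimately show ?thesis
    using S_alphaZ_eq(1) [OF assms(2)] T_alphaZ_eq(1) by (simp add: S_value_def)
qed

end
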